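(* There is a set $\mathcal{L}$ of linear maps $L:\mathbb{R}^d\to\mathbb{R}^{k-d}$ (identified with a subset of $\mathbb{R}^{d(k-d)}$ via matrix entries) of full Lebesgue measure with the following property. Let $L\in\mathcal{L}$, let $E$ be its graph (which is totally irrational), and let $\mathcal{W}$ be a window that is a parallelotope generated by vectors in $F\cap\mathbb{Z}^k$. Then for any admissible $F_0$, $\Omega$, regular $s$, and any $\epsilon>0$, for all sufficiently large $r$, \[\#\xi_2(r)\le(\log r)^{(1+\epsilon)(d+1)(k-d)}.\] Furthermore, suppose $\Omega$ is the set of points of $E$ whose first $d$ coordinates lie in a hypercube in $\mathbb{R}^d$ centered at the origin, i.e. $\Omega=\{(x,L(x)):x\in Q\}$ for such a hypercube $Q$. Then for any $\epsilon>0$ and all sufficiently large $r$, \[\#\xi_1(r)\le(\log r)^{(1+\epsilon)(d+1)(k-d)}.\]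
   Context: Fix integers $1\le d<k$. For $x\in\mathbb{R}^m$, $|x|=\max_i|x_i|$. Let $L:\mathbb{R}^d\to\mathbb{R}^{k-d}$ be linear, $L(x)=Ax$ with $A=(\alpha_{ij})$, and let $E=\{(x,L(x)):x\in\mathbb{R}^d\}\subseteq\mathbb{R}^k$. We say $E$ is totally irrational if $E+\mathbb{Z}^k$ is dense in $\mathbb{R}^k$. Let $F=\{0\}\times\mathbb{R}^{k-d}$, and let $F_0$ be a subspace complementary to $E$ with $F_0\cap\mathbb{Z}^k=\{0\}$. Denote by $\pi_1:\mathbb{R}^k\to E$ the projection along $F_0$, by $\pi_2:\mathbb{R}^k\to E$ the projection along $F$, and by $\pi^*:\mathbb{R}^k\to F$ the projection along $E$. A window is a compact $\mathcal{W}\subseteq F$ equal to the closure of its interior (in $F$). The strip is $\mathcal{S}=(\pi^* )^{-1}(\mathcal{W})$. A point $s$ is regular if $(\mathbb{Z}^k+s)\cap\partial\mathcal{S}=\emptyset$. The cut and project set is $Y=\pi_1(\mathcal{S}\cap(\mathbb{Z}^k+s))$. For $y\in Y$, $\tilde y$ denotes the unique point of $\mathcal{S}\cap(\mathbb{Z}^k+s)$ with $\pi_1(\tilde y)=y$. Let $\Omega\subseteq E$ be a bounded convex set containing a neighborhood of $0$ in $E$. For $y\in Y$ and $r\ge0$, define \[P_1(y,r)=\{y'\in Y:y'-y\in r\Omega\},\qquad P_2(y,r)=\{y'\in Y:\pi_2(\tilde y'-\tilde y)\in r\Omega\}.\] For $i\in\{1,2\}$, the patches $P_i(y_1,r)$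 and $P_i(y_2,r)$ are equivalent if $P_i(y_1,r)=P_i(y_2,r)+y_1-y_2$; write $\mathcal{P}_i(y,r)$ for the equivalence class. The frequency of a class $\mathcal{P}$ is \[\xi_{\mathcal{P}}=\lim_{R\to\infty}\frac{\#\{y'\in Y:|y'|\le R,\ \mathcal{P}_i(y',r)=\mathcal{P}\}}{\#\{y'\in Y:|y'|\le R\}}.\] $\xi_i(r)$ is the set of distinct frequencies of the type $i$ patch classes of size $r$. These notions are defined under the standing assumption that $E$ is totally irrational, and $\xi_i(r)$ is independent of the regular point $s$. A window is a parallelotope generated by vectors in $F\cap\mathbb{Z}^k$ if $\mathcal{W}=\{\sum_jt_jw_j:0\le t_j\le1\}$ for linearly independent $w_1,\dots,w_{k-d}\in F\cap\mathbb{Z}^k$. *)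

theory Defs
  imports "HOL-Analysis.Analysis"
begin

text \<open>Points of R^k are represented as pairs (x, y) with x in R^d = real^'d and
  y in R^(k-d) = real^'e; so d = CARD('d) and k - d = CARD('e).
  A linear map L is given by its matrix A :: real^'d^'e, L x = A *v x.\<close>

type_synonym ('d, 'e) pt = "(real^'d) \<times> (real^'e)"

definition graphE :: "real^'d::finite^'e::finite \<Rightarrow> ('d::finite, 'e::finite) pt set" where
  "graphE A = {(x, A *v x) | x. True}"

definition Fsp :: "('d::finite, 'e::finite) pt set" where
  "Fsp = {z. fst z = 0}"

definition Zk :: "('d::finite, 'e::finite) pt set" where
  "Zk = {z. (\<forall>i. fst z $ i \<in> \<int>) \<and> (\<forall>j. snd z $ j \<in> \<int>)}"

definition totally_irrational :: "real^'d::finite^'e::finite \<Rightarrow> bool" where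
  "totally_irrational A \<longleftrightarrow> closure {u + z | u z. u \<in> graphE A \<and> z \<in> Zk} = UNIV"

definition proj_along :: "'a::real_vector set \<Rightarrow> 'a set \<Rightarrow> 'a \<Rightarrow> 'a" where
  "proj_along U V z = (THE u. u \<in> U \<and> z - u \<in> V)"

definition admissible_F0 :: "real^'d::finite^'e::finite \<Rightarrow> ('d::finite, 'e::finite) pt set \<Rightarrow> bool" where
  "admissible_F0 A F0 \<longleftrightarrow> subspace F0 \<and> graphE A \<inter> F0 = {0}
     \<and> (\<forall>z. \<exists>u v. u \<in> graphE A \<and> v \<in> F0 \<and> z = u + v) \<and> F0 \<inter> Zk = {0}"

definition admissible_Omega :: "real^'d::finite^'e::finite \<Rightarrow> ('d::finite, 'e::finite) pt set \<Rightarrow> bool" where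
  "admissible_Omega A \<Omega> \<longleftrightarrow> \<Omega> \<subseteq> graphE A \<and> bounded \<Omega> \<and> convex \<Omega>
     \<and> (\<exists>e>0. graphE A \<inter> ball 0 e \<subseteq> \<Omega>)"

definition parallelotope_window :: "('d::finite, 'e::finite) pt set \<Rightarrow> bool" where
  "parallelotope_window W \<longleftrightarrow> (\<exists>w :: 'e \<Rightarrow> ('d::finite, 'e::finite) pt.
     (\<forall>j. w j \<in> Fsp \<inter> Zk) \<and> inj w \<and> independent (range w) \<and>
     W = {(\<Sum>j\<in>UNIV. t j *\<^sub>R w j) | t. \<forall>j. 0 \<le> t j \<and> t j \<le> 1})"

definition strip :: "real^'d::finite^'e::finite \<Rightarrow> ('d::finite, 'e::finite) pt set \<Rightarrow> ('d::finite, 'e::finite) pt set" where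
  "strip A W = {z. proj_along Fsp (graphE A) z \<in> W}"

definition shifted_lattice :: "('d::finite, 'e::finite) pt \<Rightarrow> ('d::finite, 'e::finite) pt set" where
  "shifted_lattice s = (\<lambda>z. z + s) ` Zk"

definition regular :: "real^'d::finite^'e::finite \<Rightarrow> ('d::finite, 'e::finite) pt set \<Rightarrow> ('d::finite, 'e::finite) pt \<Rightarrow> bool" where
  "regular A W s \<longleftrightarrow> shifted_lattice s \<inter> frontier (strip A W) = {}"

definition cps :: "real^'d::finite^'e::finite \<Rightarrow> ('d::finite, 'e::finite) pt set \<Rightarrow> ('d::finite, 'e::finite) pt set \<Rightarrow> ('d::finite, 'e::finite) pt \<Rightarrow> ('d::finite, 'e::finite) pt set" where
  "cps A F0 W s = proj_along (graphE A) F0 ` (strip A W \<inter> shifted_lattice s)"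

definition lift :: "real^'d::finite^'e::finite \<Rightarrow> ('d::finite, 'e::finite) pt set \<Rightarrow> ('d::finite, 'e::finite) pt set \<Rightarrow> ('d::finite, 'e::finite) pt \<Rightarrow> ('d::finite, 'e::finite) pt \<Rightarrow> ('d::finite, 'e::finite) pt" where
  "lift A F0 W s y = (THE z. z \<in> strip A W \<inter> shifted_lattice s \<and> proj_along (graphE A) F0 z = y)"

definition patch :: "nat \<Rightarrow> real^'d::finite^'e::finite \<Rightarrow> ('d::finite, 'e::finite) pt set \<Rightarrow> ('d::finite, 'e::finite) pt set \<Rightarrow> ('d::finite, 'e::finite) pt
    \<Rightarrow> ('d::finite, 'e::finite) pt set \<Rightarrow> ('d::finite, 'e::finite) pt \<Rightarrow> real \<Rightarrow> ('d::finite, 'e::finite) pt set" where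
  "patch i A F0 W s \<Omega> y r =
    (if i = 1 then {y' \<in> cps A F0 W s. y' - y \<in> (\<lambda>z. r *\<^sub>R z) ` \<Omega>}
     else {y' \<in> cps A F0 W s.
             proj_along (graphE A) Fsp (lift A F0 W s y' - lift A F0 W s y) \<in> (\<lambda>z. r *\<^sub>R z) ` \<Omega>})"

text \<open>Equivalence class of the patch at y: P(y1,r) ~ P(y2,r) iff P(y1,r) = P(y2,r) + y1 - y2,
  i.e. iff the recentred patches P(y1,r) - y1 and P(y2,r) - y2 coincide. The recentred patch
  is used as canonical representative of the class.\<close>
definition pclass :: "nat \<Rightarrow> real^'d::finite^'e::finite \<Rightarrow> ('d::finite, 'e::finite) pt set \<Rightarrow> ('d::finite, 'e::finite) pt set \<Rightarrow> ('d::finite, 'e::finite) pt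
    \<Rightarrow> ('d::finite, 'e::finite) pt set \<Rightarrow> ('d::finite, 'e::finite) pt \<Rightarrow> real \<Rightarrow> ('d::finite, 'e::finite) pt set" where
  "pclass i A F0 W s \<Omega> y r = (\<lambda>z. z - y) ` patch i A F0 W s \<Omega> y r"

definition freq :: "nat \<Rightarrow> real^'d::finite^'e::finite \<Rightarrow> ('d::finite, 'e::finite) pt set \<Rightarrow> ('d::finite, 'e::finite) pt set \<Rightarrow> ('d::finite, 'e::finite) pt
    \<Rightarrow> ('d::finite, 'e::finite) pt set \<Rightarrow> real \<Rightarrow> ('d::finite, 'e::finite) pt set \<Rightarrow> real" where
  "freq i A F0 W s \<Omega> r P = Lim at_top (\<lambda>R::real.
      real (card {y' \<in> cps A F0 W s. infnorm y' \<le> R \<and> pclass i A F0 W s \<Omega> y' r = P})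
      / real (card {y' \<in> cps A F0 W s. infnorm y' \<le> R}))"

definition xi :: "nat \<Rightarrow> real^'d::finite^'e::finite \<Rightarrow> ('d::finite, 'e::finite) pt set \<Rightarrow> ('d::finite, 'e::finite) pt set \<Rightarrow> ('d::finite, 'e::finite) pt
    \<Rightarrow> ('d::finite, 'e::finite) pt set \<Rightarrow> real \<Rightarrow> real set" where
  "xi i A F0 W s \<Omega> r = freq i A F0 W s \<Omega> r ` {pclass i A F0 W s \<Omega> y r | y. y \<in> cps A F0 W s}"

definition cube_Omega :: "real^'d::finite^'e::finite \<Rightarrow> real \<Rightarrow> ('d::finite, 'e::finite) pt set" where
  "cube_Omega A a = {(x, A *v x) | x. \<forall>i. \<bar>x $ i\<bar> \<le> a}"

end

theory Submission
  imports Defs "HOL-Real_Asymp.Real_Asymp"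
begin

text \<open>
  In the coordinates given by its generators, the window is the unit cube, and the class of a patch
  is decided by the position of a lattice point relative to the hyperplanes \<open>t $ j = x\<close>, where \<open>x\<close>
  runs through the \<open>j\<close>-th coordinates of projected integer vectors with first component in a region
  of size \<open>r\<close>. Since the window tiles \<open>F\<close>, classes of type 2 correspond to boxes between neighbouring
  hyperplanes; classes of type 1 are obtained by cutting such boxes along the boundedly many layers
  near the faces of the cube. By density of the projected lattice and a packing argument, the
  frequency of a cell does not change under translation, so it suffices to count cells up to
  translation.

  The side lengths of the boxes are, up to a fixed denominator, distances of \<open>(A *v q) \<bullet> c\<close> to the
  integers. Averaged over both \<open>A\<close> and the target point, the events that distinct \<open>q\<close> hit a short
  interval are pairwise independent. The second moment and Borel--Cantelli at the scales \<open>2^n\<close> show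
  for almost every \<open>A\<close> that with \<open>T = 2^(- n d) n^(1 + \<epsilon>)\<close> all gaps are at most \<open>4 T\<close>, while only
  \<open>O(n^(1 + \<epsilon>))\<close> vectors \<open>q\<close> come within \<open>T\<close> of an integer; so every coordinate contributes
  \<open>(log r)^((1 + \<epsilon>) (d + 1))\<close> configurations at most.
\<close>

section \<open>Linear forms modulo one\<close>

text \<open>The target width is under opposing demands: to leave no gap uncovered it must be at
  least of order \<open>2^(- n d)\<close>, yet few vectors may hit it. The factor
  \<open>n^(1 + \<epsilon>)\<close> is the price for failure probabilities that are summable over
  the scales. All other constants (denominators, ratios of radii, numbers of layers) are absorbed by
  enlarging the exponent a little.

  Layers arise because on the strip the projection along \<open>F0\<close> differs from that along
  \<open>F\<close> by a bounded vector, so type 1 membership is undecided for displacements at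
  bounded distance from the boundary of the dilated \<Omega>. For a hypercube these lie in boundedly
  many hyperplanes \<open>n $ i = const\<close>. Differences inside one such hyperplane have a
  vanishing coordinate; there are only about \<open>2^(n (d - 1))\<close> of them up to size
  \<open>2^n\<close>, their expected number of hits is of order
  \<open>n^(1 + \<epsilon>) / 2^n\<close>, and eventually none occurs.

  One null set has to serve all windows and all \<epsilon>. Integrality of the generators leaves
  countably many integer vectors \<open>c\<close> to treat, and \<epsilon> is restricted to the
  values \<open>1 / (k + 1)\<close>.\<close>

definition near_int :: "real \<Rightarrow> real set" where
  "near_int T = {y. \<exists>p::int. \<bar>y - of_int p\<bar> \<le> T}"

lemma near_int_measurable [measurable]: "near_int T \<in> sets borel"
proof -
  have "near_int T = (\<Union>p::int. {of_int p - T..of_int p + T})"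
    by (auto simp: near_int_def abs_le_iff algebra_simps)
  then show ?thesis by simp
qed

lemma near_int_add_int [simp]: "y + of_int k \<in> near_int T \<longleftrightarrow> y \<in> near_int T"
proof
  assume "y + of_int k \<in> near_int T"
  then obtain p where "\<bar>y + of_int k - of_int p\<bar> \<le> T" by (auto simp: near_int_def)
  then have "\<bar>y - of_int (p - k)\<bar> \<le> T" by (simp add: algebra_simps)
  then show "y \<in> near_int T" unfolding near_int_def by blast
next
  assume "y \<in> near_int T"
  then obtain p where "\<bar>y - of_int p\<bar> \<le> T" by (auto simp: near_int_def)
  then have "\<bar>y + of_int k - of_int (p + k)\<bar> \<le> T" by (simp add: algebra_simps)
  then show "y + of_int k \<in> near_int T" unfolding near_int_def by blast
qed

lemma near_int_minus: "- y \<in> near_int T \<longleftrightarrow> y \<in> near_int T"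
proof -
  have "y \<in> near_int T" if "- y \<in> near_int T" for y
  proof -
    obtain p where "\<bar>- y - of_int p\<bar> \<le> T" using \<open>- y \<in> near_int T\<close> by (auto simp: near_int_def)
    then have "\<bar>y - of_int (- p)\<bar> \<le> T" by simp
    then show ?thesis unfolding near_int_def by blast
  qed
  from this[of y] this[of "- y"] show ?thesis by auto
qed

lemma near_int_mono: "T \<le> T' \<Longrightarrow> near_int T \<subseteq> near_int T'"
  by (auto simp: near_int_def) (meson order_trans)

lemma near_int_add: "y \<in> near_int T \<Longrightarrow> z \<in> near_int T' \<Longrightarrow> y + z \<in> near_int (T + T')"
proof -
  assume "y \<in> near_int T" "z \<in> near_int T'"
  then obtain p q where "\<bar>y - of_int p\<bar> \<le> T" "\<bar>z - of_int q\<bar> \<le> T'" by (auto simp: near_int_def)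
  then have "\<bar>y + z - of_int (p + q)\<bar> \<le> T + T'" by simp
  then show ?thesis unfolding near_int_def by blast
qed

lemma emeasure_lborel_shift:
  fixes S :: "'a::euclidean_space set"
  assumes [measurable]: "S \<in> sets borel"
  shows "emeasure lborel {x. c + x \<in> S} = emeasure lborel S"
proof -
  have "emeasure lborel S = emeasure (distr lborel borel ((+) c)) S"
    by (simp add: lborel_distr_plus)
  also have "\<dots> = emeasure lborel {x. c + x \<in> S}"
    by (subst emeasure_distr) (auto simp: vimage_def)
  finally show ?thesis by simp
qed

text \<open>The interval contains exactly one integer. Cut there, its two pieces are moved by
  integers and change places inside \<open>{0..<1}\<close>.\<close>

lemma emeasure_periodic_unit_interval:
  fixes a :: real
  assumes [measurable]: "P \<in> sets borel" and per: "\<And>y k. y + of_int k \<in> P \<longleftrightarrow> y \<in> P"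
  shows "emeasure lborel (P \<inter> {a..<a+1}) = emeasure lborel (P \<inter> {0..<1})"
proof -
  define n where "n = \<lceil>a\<rceil>"
  have n: "a \<le> of_int n" "of_int n < a + 1" unfolding n_def by linarith+
  have sh: "emeasure lborel (P \<inter> {u..<v}) = emeasure lborel (P \<inter> {u - of_int k..<v - of_int k})" for u v k
  proof -
    have "emeasure lborel (P \<inter> {u..<v}) = emeasure lborel {x. of_int k + x \<in> P \<inter> {u..<v}}"
      by (rule emeasure_lborel_shift[symmetric]) simp
    also have "{x. of_int k + x \<in> P \<inter> {u..<v}} = P \<inter> {u - of_int k..<v - of_int k}"
      using per[of _ k] by (auto simp: add.commute algebra_simps)
    finally show ?thesis .
  qed
  have split: "emeasure lborel (P \<inter> {u..<w}) = emeasure lborel (P \<inter> {u..<v}) + emeasure lborel (P \<inter> {v..<w})"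
    if "u \<le> v" "v \<le> w" for u v w
    by (subst plus_emeasure) (use that in \<open>auto intro!: arg_cong[where f="emeasure lborel"]\<close>)
  have "emeasure lborel (P \<inter> {a..<a+1})
      = emeasure lborel (P \<inter> {a..<of_int n}) + emeasure lborel (P \<inter> {of_int n..<a+1})"
    using n by (intro split) auto
  also have "emeasure lborel (P \<inter> {a..<of_int n}) = emeasure lborel (P \<inter> {a + 1 - of_int n..<1})"
    by (subst sh[of _ _ "n - 1"]) (simp add: algebra_simps)
  also have "emeasure lborel (P \<inter> {of_int n..<a+1}) = emeasure lborel (P \<inter> {0..<a + 1 - of_int n})"
    by (subst sh[of _ _ n]) (simp add: algebra_simps)
  also have "emeasure lborel (P \<inter> {a + 1 - of_int n..<1}) + emeasure lborel (P \<inter> {0..<a + 1 - of_int n})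
     = emeasure lborel (P \<inter> {0..<1})"
    using n by (subst add.commute, intro split[symmetric]) auto
  finally show ?thesis .
qed

lemma emeasure_periodic_interval:
  assumes [measurable]: "P \<in> sets borel" and per: "\<And>y k. y + of_int k \<in> P \<longleftrightarrow> y \<in> P"
  shows "emeasure lborel (P \<inter> {a..<a + real m}) = of_nat m * emeasure lborel (P \<inter> {0..<1})"
proof (induction m)
  case (Suc m)
  have "P \<inter> {a..<a + real (Suc m)} = (P \<inter> {a..<a + real m}) \<union> (P \<inter> {a + real m..<(a + real m) + 1})"
    by auto
  also have "emeasure lborel \<dots> = emeasure lborel (P \<inter> {a..<a + real m}) + emeasure lborel (P \<inter> {a + real m..<(a + real m) + 1})"
    by (subst plus_emeasure) auto
  finally show ?case
    using Suc emeasure_periodic_unit_interval[OF assms, of "a + real m"] by (simp add: algebra_simps)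
qed simp

lemma near_int_half: "0 \<le> T \<Longrightarrow> T < 1/2 \<Longrightarrow> near_int T \<inter> {-1/2..<1/2} = {-T..T}"
proof (safe, goal_cases)
  case (1 y)
  then obtain p where p: "\<bar>y - of_int p\<bar> \<le> T" by (auto simp: near_int_def)
  then have "\<bar>real_of_int p\<bar> < 1" using 1 by (auto simp: abs_le_iff)
  then have "p = 0" by linarith
  then show ?case using p by auto
next
  case (2 y) then show ?case by (auto simp: near_int_def intro!: exI[of _ 0])
qed auto

lemma emeasure_near_int:
  assumes "0 \<le> T" "T < 1/2"
  shows "emeasure lborel (near_int T \<inter> {0..<1}) = ennreal (2 * T)"
proof -
  have "emeasure lborel (near_int T \<inter> {0..<1}) = emeasure lborel (near_int T \<inter> {-1/2..<-1/2+1})"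
    by (rule emeasure_periodic_unit_interval[symmetric]) auto
  also have "\<dots> = ennreal (2 * T)" using near_int_half[OF assms] assms by simp
  finally show ?thesis .
qed

lemma emeasure_near_int_le:
  assumes "0 \<le> T"
  shows "emeasure lborel (near_int T \<inter> {0..<1}) \<le> ennreal (2 * T)"
proof (cases "T < 1/2")
  case True then show ?thesis using emeasure_near_int[OF assms] by simp
next
  case False
  have "emeasure lborel (near_int T \<inter> {0..<1}) \<le> emeasure lborel {0..<1::real}"
    by (intro emeasure_mono) auto
  also have "\<dots> \<le> ennreal (2 * T)" using False by (simp add: ennreal_leI flip: ennreal_1)
  finally show ?thesis .
qed

text \<open>Multiplication by a nonzero integer wraps a unit interval a whole number of times around
  the circle and therefore preserves measure modulo one. This is where integrality of coefficients
  enters the measure estimates.\<close>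

lemma emeasure_scaled_near_int_le:
  assumes T: "0 \<le> T" and c: "c \<in> \<int>" "c \<noteq> 0"
  shows "emeasure lborel {y \<in> {a..<a+1}. c * y + x \<in> near_int T} \<le> ennreal (2 * T)"
proof -
  have pos: "emeasure lborel {y \<in> {a..<a+1}. real m * y + x \<in> near_int T} \<le> ennreal (2 * T)"
    if m: "m > 0" for m :: nat and x
  proof -
    define S where "S = near_int T \<inter> {real m * a + x..<(real m * a + x) + real m}"
    have [measurable]: "S \<in> sets borel" by (simp add: S_def)
    have "(\<integral>\<^sup>+u. indicator S u \<partial>lborel) = ennreal \<bar>real m\<bar> * (\<integral>\<^sup>+y. indicator S (x + real m * y) \<partial>lborel)"
      using m by (intro nn_integral_real_affine) auto
    also have "(\<lambda>y. indicator S (x + real m * y) :: ennreal) = indicator {y \<in> {a..<a+1}. real m * y + x \<in> near_int T}"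
    proof
      fix y
      have "real m * a \<le> real m * y \<longleftrightarrow> a \<le> y" "real m * y < real m * (a + 1) \<longleftrightarrow> y < a + 1"
        using m by auto
      then have "x + real m * y \<in> S \<longleftrightarrow> y \<in> {y \<in> {a..<a+1}. real m * y + x \<in> near_int T}"
        unfolding S_def by (auto simp: algebra_simps)
      then show "indicator S (x + real m * y) = (indicator {y \<in> {a..<a+1}. real m * y + x \<in> near_int T} y :: ennreal)"
        by (simp add: indicator_def)
    qed
    finally have "emeasure lborel S = of_nat m * emeasure lborel {y \<in> {a..<a+1}. real m * y + x \<in> near_int T}"
      by (simp add: ennreal_of_nat_eq_real_of_nat)
    moreover have "emeasure lborel S = of_nat m * emeasure lborel (near_int T \<inter> {0..<1})"
      unfolding S_def by (rule emeasure_periodic_interval) auto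
    ultimately have "emeasure lborel {y \<in> {a..<a+1}. real m * y + x \<in> near_int T} = emeasure lborel (near_int T \<inter> {0..<1})"
      using m by (simp add: ennreal_mult_cancel_left of_nat_less_top less_top[symmetric])
    then show ?thesis using emeasure_near_int_le[OF T] by simp
  qed
  obtain k :: int where k: "c = of_int k" using c by (auto elim: Ints_cases)
  show ?thesis
  proof (cases "k > 0")
    case True
    then show ?thesis using pos[of "nat k" x] k by simp
  next
    case False
    then have "{y \<in> {a..<a+1}. c * y + x \<in> near_int T} = {y \<in> {a..<a+1}. real (nat (-k)) * y + (-x) \<in> near_int T}"
      using near_int_minus[of "c * _ + x" T] k by (auto simp: algebra_simps)
    then show ?thesis using pos[of "nat (-k)" "-x"] False c k by simp
  qed
qed

section \<open>Integer linear forms on a unit cube are uniformly distributed modulo one\<close>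

definition unit_cube :: "'a::euclidean_space \<Rightarrow> 'a set" where
  "unit_cube a = {z. \<forall>b\<in>Basis. a \<bullet> b \<le> z \<bullet> b \<and> z \<bullet> b < a \<bullet> b + 1}"

lemma unit_cube_measurable [measurable]: "unit_cube a \<in> sets borel"
proof -
  have "unit_cube a = (\<Inter>b\<in>Basis. {z. a \<bullet> b \<le> z \<bullet> b} \<inter> {z. z \<bullet> b < a \<bullet> b + 1})"
    by (auto simp: unit_cube_def)
  also have "\<dots> \<in> sets borel"
    by (intro sets.finite_INT) (auto intro!: sets.Int borel_closed borel_open closed_Collect_le open_Collect_less continuous_intros)
  finally show ?thesis .
qed

lemma emeasure_unit_cube: "emeasure lborel (unit_cube a) = 1"
proof (rule antisym)
  have "emeasure lborel (unit_cube a) \<le> emeasure lborel (cbox a (a + One))"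
    by (intro emeasure_mono) (auto simp: unit_cube_def cbox_def inner_simps less_imp_le)
  then show "emeasure lborel (unit_cube a) \<le> 1" by (simp add: inner_simps)
  have "emeasure lborel (box a (a + One)) \<le> emeasure lborel (unit_cube a)"
    by (intro emeasure_mono) (auto simp: unit_cube_def box_def inner_simps less_imp_le)
  then show "1 \<le> emeasure lborel (unit_cube a)" by (simp add: inner_simps)
qed

text \<open>Fubini in one coordinate \<open>b\<close> in which \<open>h\<close> does not vanish:
  with the other coordinates frozen, the form is a nonzero integer multiple of one real variable
  plus a constant.\<close>

lemma emeasure_linear_form_near_int:
  fixes h a :: "'a::euclidean_space"
  assumes T: "0 \<le> T" and h: "\<And>b. b \<in> Basis \<Longrightarrow> h \<bullet> b \<in> \<int>" "h \<noteq> 0"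
  shows "emeasure lborel {A \<in> unit_cube a. A \<bullet> h + x \<in> near_int T} \<le> ennreal (2 * T)"
proof -
  obtain b where b: "b \<in> Basis" "h \<bullet> b \<noteq> 0" using h(2) euclidean_all_zero_iff by blast
  define B where "B = (Basis - {b} :: 'a set)"
  have B: "finite B" "b \<notin> B" "Basis = insert b B" using b by (auto simp: B_def)
  interpret product_sigma_finite "\<lambda>_::'a. lborel :: real measure" by standard
  define S where "S = {A \<in> unit_cube a. A \<bullet> h + x \<in> near_int T}"
  have S[measurable]: "S \<in> sets borel" unfolding S_def by measurable
  define R where "R = (\<Pi>\<^sub>E i\<in>B. {a \<bullet> i..<a \<bullet> i + 1})"
  have R[measurable]: "R \<in> sets (\<Pi>\<^sub>M i\<in>B. (lborel :: real measure))" unfolding R_def using B by (intro sets_PiM_I_finite) auto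
  have m: "(\<lambda>f. indicator S (\<Sum>i\<in>Basis. f i *\<^sub>R i) :: ennreal) \<in> borel_measurable (\<Pi>\<^sub>M i\<in>insert b B. lborel)"
    unfolding B(3)[symmetric] by measurable
  have "emeasure lborel S = (\<integral>\<^sup>+A. indicator S A \<partial>lborel)" by simp
  also have "\<dots> = (\<integral>\<^sup>+f. indicator S (\<Sum>i\<in>Basis. f i *\<^sub>R i) \<partial>(\<Pi>\<^sub>M i\<in>Basis. lborel))"
    by (subst lborel_eq, subst nn_integral_distr) auto
  also have "\<dots> = (\<integral>\<^sup>+f. indicator S (\<Sum>i\<in>Basis. f i *\<^sub>R i) \<partial>(\<Pi>\<^sub>M i\<in>insert b B. lborel))"
    using B(3) by simp
  also have "\<dots> = (\<integral>\<^sup>+f. (\<integral>\<^sup>+y. indicator S (\<Sum>i\<in>Basis. (f(b:=y)) i *\<^sub>R i) \<partial>lborel) \<partial>(\<Pi>\<^sub>M i\<in>B. lborel))"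
    using B m by (subst product_nn_integral_insert) auto
  also have "\<dots> \<le> (\<integral>\<^sup>+f. ennreal (2 * T) * indicator R f \<partial>(\<Pi>\<^sub>M i\<in>B. lborel))"
  proof (rule nn_integral_mono)
    fix f assume f: "f \<in> space (\<Pi>\<^sub>M i\<in>B. (lborel :: real measure))"
    define g where "g = (\<Sum>i\<in>B. f i *\<^sub>R i)"
    have sm: "(\<Sum>i\<in>Basis. (f(b:=y)) i *\<^sub>R i) = y *\<^sub>R b + g" for y
    proof -
      have "(\<Sum>i\<in>Basis. (f(b:=y)) i *\<^sub>R i) = (\<Sum>i\<in>insert b B. (f(b:=y)) i *\<^sub>R i)"
        using B(3) by simp
      also have "\<dots> = y *\<^sub>R b + (\<Sum>i\<in>B. (f(b:=y)) i *\<^sub>R i)"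
        using B(1,2) by simp
      also have "(\<Sum>i\<in>B. (f(b:=y)) i *\<^sub>R i) = g"
        unfolding g_def using B(2) by (intro sum.cong) auto
      finally show ?thesis .
    qed
    have comp: "(y *\<^sub>R b + g) \<bullet> i = (if i = b then y else f i)" if "i \<in> Basis" for i y
    proof -
      have "(y *\<^sub>R b + g) \<bullet> i = (\<Sum>j\<in>Basis. (f(b:=y)) j *\<^sub>R j) \<bullet> i" by (simp only: sm)
      also have "\<dots> = (f(b:=y)) i" using that by (simp add: inner_sum_left_Basis)
      finally show ?thesis by simp
    qed
    have inR: "f \<in> R" if "y *\<^sub>R b + g \<in> unit_cube a" for y
      using that comp f B unfolding R_def unit_cube_def space_PiM PiE_def
      by (auto simp: Pi_iff extensional_def) (metis insertCI)+
    have yI: "y \<in> {a \<bullet> b..<a \<bullet> b + 1}" if "y *\<^sub>R b + g \<in> unit_cube a" for y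
      using that comp[of b y] b unfolding unit_cube_def by auto
    have "(\<integral>\<^sup>+y. indicator S (\<Sum>i\<in>Basis. (f(b:=y)) i *\<^sub>R i) \<partial>lborel)
       \<le> (\<integral>\<^sup>+y. indicator R f * indicator {y \<in> {a \<bullet> b..<a \<bullet> b + 1}. (b \<bullet> h) * y + (g \<bullet> h + x) \<in> near_int T} y \<partial>lborel)"
    proof (intro nn_integral_mono)
      fix y :: real
      show "indicator S (\<Sum>i\<in>Basis. (f(b:=y)) i *\<^sub>R i) \<le> (indicator R f * indicator {y \<in> {a \<bullet> b..<a \<bullet> b + 1}. (b \<bullet> h) * y + (g \<bullet> h + x) \<in> near_int T} y :: ennreal)"
      proof (cases "y *\<^sub>R b + g \<in> S")
        case True
        then have "y *\<^sub>R b + g \<in> unit_cube a" "(y *\<^sub>R b + g) \<bullet> h + x \<in> near_int T" by (auto simp: S_def)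
        then show ?thesis using inR yI sm True by (auto simp: inner_simps algebra_simps)
      qed (simp add: sm del: fun_upd_apply)
    qed
    also have "\<dots> = indicator R f * emeasure lborel {y \<in> {a \<bullet> b..<a \<bullet> b + 1}. (b \<bullet> h) * y + (g \<bullet> h + x) \<in> near_int T}"
      by (subst nn_integral_cmult) auto
    also have "\<dots> \<le> indicator R f * ennreal (2 * T)"
      using b h(1)[of b] by (intro mult_left_mono emeasure_scaled_near_int_le T) (auto simp: inner_commute)
    finally show "(\<integral>\<^sup>+y. indicator S (\<Sum>i\<in>Basis. (f(b:=y)) i *\<^sub>R i) \<partial>lborel) \<le> ennreal (2 * T) * indicator R f"
      by (simp add: mult.commute)
  qed
  also have "\<dots> = ennreal (2 * T) * emeasure (\<Pi>\<^sub>M i\<in>B. lborel) R"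
    by (subst nn_integral_cmult) auto
  also have "emeasure (\<Pi>\<^sub>M i\<in>B. lborel) R = 1"
    unfolding R_def using B by (subst emeasure_PiM) auto
  finally show ?thesis by (simp add: S_def)
qed

section \<open>The second moment\<close>

text \<open>The correlation of two arcs of half-length \<open>T\<close> on the circle whose centres
  differ by \<open>y\<close>.\<close>

definition overlap :: "real \<Rightarrow> real \<Rightarrow> real" where
  "overlap T y = measure lborel {x \<in> {0..<1}. x \<in> near_int T \<and> x + y \<in> near_int T}"

lemma overlap_nonneg: "0 \<le> overlap T y"
  by (simp add: overlap_def)

lemma emeasure_subset_unit_interval:
  "{x \<in> {0..<1::real}. P x} \<in> sets lborel \<Longrightarrow> emeasure lborel {x \<in> {0..<1}. P x} = ennreal (measure lborel {x \<in> {0..<1}. P x})"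
proof (rule emeasure_eq_ennreal_measure)
  assume *: "{x \<in> {0..<1::real}. P x} \<in> sets lborel"
  have "emeasure lborel {x \<in> {0..<1::real}. P x} \<le> emeasure lborel {0..<1::real}"
    by (rule emeasure_mono) auto
  then show "emeasure lborel {x \<in> {0..<1::real}. P x} \<noteq> top"
    by (auto simp: top_unique)
qed

lemma emeasure_overlap:
  "emeasure lborel {x \<in> {0..<1}. x \<in> near_int T \<and> x + y \<in> near_int T} = ennreal (overlap T y)"
  unfolding overlap_def by (rule emeasure_subset_unit_interval) measurable

lemma measure_overlap:
  "measure lborel {x \<in> {0..<1}. x - u \<in> near_int T \<and> x - v \<in> near_int T} = overlap T (u - v)"
proof -
  define P where "P = {x. x \<in> near_int T \<and> x + (u - v) \<in> near_int T}"
  have [measurable]: "P \<in> sets borel" unfolding P_def by measurable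
  have per: "y + of_int k \<in> P \<longleftrightarrow> y \<in> P" for y k
    using near_int_add_int[of "y + (u - v)" k T] by (auto simp: P_def algebra_simps)
  have "emeasure lborel {x \<in> {0..<1}. x - u \<in> near_int T \<and> x - v \<in> near_int T}
     = emeasure lborel {x. - u + x \<in> P \<inter> {-u..<-u+1}}"
    by (rule arg_cong[where f = "emeasure lborel"]) (auto simp: P_def algebra_simps)
  also have "\<dots> = emeasure lborel (P \<inter> {-u..<-u+1})" by (rule emeasure_lborel_shift) simp
  also have "\<dots> = emeasure lborel (P \<inter> {0..<1})" by (rule emeasure_periodic_unit_interval) (use per in auto)
  also have "P \<inter> {0..<1} = {x \<in> {0..<1}. x \<in> near_int T \<and> x + (u - v) \<in> near_int T}"
    by (auto simp: P_def)
  finally show ?thesis by (simp add: overlap_def measure_def)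
qed

lemma measure_near_int_shift:
  assumes "0 \<le> T" "T < 1/2"
  shows "measure lborel {x \<in> {0..<1}. x - u \<in> near_int T} = 2 * T"
proof -
  have "measure lborel {x \<in> {0..<1}. x - u \<in> near_int T} = overlap T 0"
    using measure_overlap[of u T u] by simp
  also have "{x \<in> {0..<1}. x \<in> near_int T \<and> x + 0 \<in> near_int T} = near_int T \<inter> {0..<1}" by auto
  then have "overlap T 0 = 2 * T"
    using emeasure_near_int[OF assms] assms by (simp add: overlap_def measure_def)
  finally show ?thesis .
qed

lemma overlap_0: "0 \<le> T \<Longrightarrow> T < 1/2 \<Longrightarrow> overlap T 0 = 2 * T"
  using measure_near_int_shift[of T 0] measure_overlap[of 0 T 0] by simp

text \<open>Two intervals of length \<open>2 * T\<close> with centres at distance at most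
  \<open>T\<close> share an interval of length at least \<open>T\<close>. Working in the period
  \<open>{-1/2..<1/2}\<close> keeps that interval in one piece.\<close>

lemma overlap_ge:
  assumes T: "0 \<le> T" "T < 1/2" and y: "y \<in> near_int T"
  shows "overlap T y \<ge> T"
proof -
  obtain p where p: "\<bar>y - of_int p\<bar> \<le> T" using y by (auto simp: near_int_def)
  define \<theta> where "\<theta> = y - of_int p"
  define P where "P = {x. x \<in> near_int T \<and> x + y \<in> near_int T}"
  have [measurable]: "P \<in> sets borel" unfolding P_def by measurable
  have per: "z + of_int k \<in> P \<longleftrightarrow> z \<in> P" for z k
    using near_int_add_int[of "z + y" k T] by (auto simp: P_def algebra_simps)
  have sub: "{max (-T) (-T-\<theta>)..min T (T-\<theta>)} \<subseteq> P \<inter> {-1/2..<-1/2+1}"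
  proof
    fix x assume x: "x \<in> {max (-T) (-T-\<theta>)..min T (T-\<theta>)}"
    have "\<bar>x - of_int 0\<bar> \<le> T" "\<bar>x + y - of_int p\<bar> \<le> T" using x by (auto simp: \<theta>_def)
    then have "x \<in> P" unfolding P_def near_int_def by blast
    then show "x \<in> P \<inter> {-1/2..<-1/2+1}" using x T by auto
  qed
  have "ennreal T \<le> emeasure lborel {max (-T) (-T-\<theta>)..min T (T-\<theta>)}"
    using T p by (auto simp: emeasure_lborel_Icc_eq \<theta>_def max_def min_def intro!: ennreal_leI)
  also have "\<dots> \<le> emeasure lborel (P \<inter> {-1/2..<-1/2+1})"
    using sub by (intro emeasure_mono) auto
  also have "\<dots> = emeasure lborel (P \<inter> {0..<1})" by (rule emeasure_periodic_unit_interval) (use per in auto)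
  also have "P \<inter> {0..<1} = {x \<in> {0..<1}. x \<in> near_int T \<and> x + y \<in> near_int T}"
    by (auto simp: P_def)
  finally show ?thesis unfolding emeasure_overlap by (simp add: overlap_nonneg)
qed

text \<open>After the integrals are exchanged the point \<open>x\<close> is fixed, and the form
  shifted by \<open>x\<close> is uniformly distributed modulo one over the cube. The conditions on
  \<open>x\<close> and on \<open>x + A \<bullet> h\<close> thus behave like independent events of
  probability \<open>2 * T\<close>.\<close>

lemma nn_integral_overlap:
  fixes h a :: "'a::euclidean_space"
  assumes T: "0 \<le> T" and h: "\<And>b. b \<in> Basis \<Longrightarrow> h \<bullet> b \<in> \<int>" "h \<noteq> 0"
  shows "(\<integral>\<^sup>+A. ennreal (overlap T (A \<bullet> h)) * indicator (unit_cube a) A \<partial>lborel) \<le> ennreal ((2 * T)\<^sup>2)"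
    and "(\<lambda>A. ennreal (overlap T (A \<bullet> h))) \<in> borel_measurable borel"
proof -
  define f :: "real \<Rightarrow> 'a \<Rightarrow> ennreal" where
    "f x A = indicator (near_int T \<inter> {0..<1}) x * indicator (near_int T) (x + A \<bullet> h)" for x A
  have [measurable]: "(\<lambda>(x, A). f x A) \<in> borel_measurable (lborel \<Otimes>\<^sub>M lborel)"
    unfolding f_def by measurable
  have ov: "ennreal (overlap T (A \<bullet> h)) = (\<integral>\<^sup>+x. f x A \<partial>lborel)" for A
  proof -
    have "ennreal (overlap T (A \<bullet> h)) = (\<integral>\<^sup>+x. indicator {x \<in> {0..<1}. x \<in> near_int T \<and> x + A \<bullet> h \<in> near_int T} x \<partial>lborel)"
      unfolding emeasure_overlap[symmetric] by (rule nn_integral_indicator[symmetric]) measurable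
    also have "\<dots> = (\<integral>\<^sup>+x. f x A \<partial>lborel)"
      by (intro nn_integral_cong) (auto simp: f_def indicator_def)
    finally show ?thesis .
  qed
  have "(\<lambda>A. \<integral>\<^sup>+x. f x A \<partial>lborel) \<in> borel_measurable lborel"
    by measurable
  then show "(\<lambda>A. ennreal (overlap T (A \<bullet> h))) \<in> borel_measurable borel"
    by (simp add: ov)
  have "(\<integral>\<^sup>+A. ennreal (overlap T (A \<bullet> h)) * indicator (unit_cube a) A \<partial>lborel)
     = (\<integral>\<^sup>+A. (\<integral>\<^sup>+x. f x A * indicator (unit_cube a) A \<partial>lborel) \<partial>lborel)"
    unfolding ov by (intro nn_integral_cong, subst nn_integral_multc) auto
  also have "\<dots> = (\<integral>\<^sup>+x. (\<integral>\<^sup>+A. f x A * indicator (unit_cube a) A \<partial>lborel) \<partial>lborel)"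
    by (rule lborel_pair.Fubini') measurable
  also have "\<dots> \<le> (\<integral>\<^sup>+x. ennreal (2 * T) * indicator (near_int T \<inter> {0..<1}) x \<partial>lborel)"
  proof (rule nn_integral_mono)
    fix x :: real
    have "(\<integral>\<^sup>+A. f x A * indicator (unit_cube a) A \<partial>lborel)
      = (\<integral>\<^sup>+A. indicator (near_int T \<inter> {0..<1}) x * indicator {A \<in> unit_cube a. A \<bullet> h + x \<in> near_int T} A \<partial>lborel)"
      by (intro nn_integral_cong) (auto simp: f_def indicator_def add.commute)
    also have "\<dots> = indicator (near_int T \<inter> {0..<1}) x * emeasure lborel {A \<in> unit_cube a. A \<bullet> h + x \<in> near_int T}"
      by (subst nn_integral_cmult) auto
    also have "\<dots> \<le> indicator (near_int T \<inter> {0..<1}) x * ennreal (2 * T)"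
      by (intro mult_left_mono emeasure_linear_form_near_int T h) auto
    finally show "(\<integral>\<^sup>+A. f x A * indicator (unit_cube a) A \<partial>lborel) \<le> ennreal (2 * T) * indicator (near_int T \<inter> {0..<1}) x"
      by (simp add: mult.commute)
  qed
  also have "\<dots> = ennreal (2 * T) * emeasure lborel (near_int T \<inter> {0..<1})"
    by (subst nn_integral_cmult) auto
  also have "\<dots> \<le> ennreal (2 * T) * ennreal (2 * T)"
    by (intro mult_left_mono emeasure_near_int_le T) auto
  also have "\<dots> = ennreal ((2 * T)\<^sup>2)" using T by (simp only: power2_eq_square ennreal_mult[symmetric] mult_nonneg_nonneg zero_le_numeral)
  finally show "(\<integral>\<^sup>+A. ennreal (overlap T (A \<bullet> h)) * indicator (unit_cube a) A \<partial>lborel) \<le> ennreal ((2 * T)\<^sup>2)" .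
qed

text \<open>The second moment, over \<open>x\<close> in the circle, of the number of
  \<open>i\<close> with \<open>x - u i\<close> within \<open>T\<close> of an integer.\<close>

definition pair_overlap :: "real \<Rightarrow> 'i set \<Rightarrow> ('i \<Rightarrow> real) \<Rightarrow> real" where
  "pair_overlap T I u = (\<Sum>i\<in>I. \<Sum>j\<in>I. overlap T (u i - u j))"

lemma pair_overlap_covered:
  fixes T c :: real
  assumes I: "finite I" and T: "0 \<le> T" "T < 1/2" and c: "0 \<le> c"
  shows "2 * c * (2 * T * card I) \<le> pair_overlap T I u + c\<^sup>2 * measure lborel {x \<in> {0..<1}. \<exists>i\<in>I. x - u i \<in> near_int T}"
proof -
  define E where "E i = {x \<in> {0..<1}. x - u i \<in> near_int T}" for i
  define U where "U = {x \<in> {0..<1}. \<exists>i\<in>I. x - u i \<in> near_int T}"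
  have E[measurable]: "E i \<in> sets borel" for i unfolding E_def by measurable
  have UE: "U = (\<Union>i\<in>I. E i)" by (auto simp: U_def E_def)
  have U[measurable]: "U \<in> sets borel" unfolding UE using I by auto
  have fin: "emeasure lborel X < \<infinity>" if "X \<subseteq> {0..<1::real}" for X
    using emeasure_mono[OF that, of lborel] by (auto simp: less_top[symmetric] top_unique)
  have int: "integrable lborel (indicator X :: real \<Rightarrow> real)" if "X \<subseteq> {0..<1::real}" "X \<in> sets borel" for X
    using that fin[of X] by (intro integrable_real_indicator) auto
  have EE: "E i \<inter> E j = {x \<in> {0..<1}. x - u i \<in> near_int T \<and> x - u j \<in> near_int T}" for i j
    by (auto simp: E_def)
  have "2 * c * (2 * T * card I) = 2 * c * (\<Sum>i\<in>I. measure lborel (E i))"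
    unfolding E_def measure_near_int_shift[OF T] by simp
  also have "\<dots> = (\<integral>x. 2 * c * (\<Sum>i\<in>I. indicator (E i) x) \<partial>lborel)"
    by (subst integral_mult_right_zero, subst Bochner_Integration.integral_sum)
       (auto intro!: int simp: E_def)
  also have "\<dots> \<le> (\<integral>x. (\<Sum>i\<in>I. \<Sum>j\<in>I. indicator (E i \<inter> E j) x) + c\<^sup>2 * indicator U x \<partial>lborel)"
  proof (rule integral_mono)
    show "integrable lborel (\<lambda>x. 2 * c * (\<Sum>i\<in>I. indicator (E i) x))"
      by (intro integrable_mult_right Bochner_Integration.integrable_sum int E) (auto simp: E_def)
    show "integrable lborel (\<lambda>x. (\<Sum>i\<in>I. \<Sum>j\<in>I. indicator (E i \<inter> E j) x) + c\<^sup>2 * indicator U x)"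
      by (intro Bochner_Integration.integrable_add integrable_mult_right Bochner_Integration.integrable_sum int U sets.Int E) (auto simp: E_def U_def)
    fix x
    define f :: real where "f = (\<Sum>i\<in>I. indicator (E i) x)"
    have ff: "(\<Sum>i\<in>I. \<Sum>j\<in>I. indicator (E i \<inter> E j) x) = f * f"
      unfolding f_def sum_product by (simp add: indicator_inter_arith)
    have "2 * c * f \<le> f * f + c\<^sup>2 * indicator U x"
    proof (cases "x \<in> U")
      case True
      then show ?thesis using sum_squares_bound[of f c] by (simp add: power2_eq_square algebra_simps)
    next
      case False
      then have "f = 0" unfolding f_def by (intro sum.neutral) (auto simp: UE)
      then show ?thesis by simp
    qed
    then show "2 * c * (\<Sum>i\<in>I. indicator (E i) x) \<le> (\<Sum>i\<in>I. \<Sum>j\<in>I. indicator (E i \<inter> E j) x) + c\<^sup>2 * indicator U x"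
      by (simp add: ff f_def)
  qed
  also have "\<dots> = (\<Sum>i\<in>I. \<Sum>j\<in>I. measure lborel (E i \<inter> E j)) + c\<^sup>2 * measure lborel U"
  proof -
    have 1: "integrable lborel (\<lambda>x. \<Sum>i\<in>I. \<Sum>j\<in>I. indicator (E i \<inter> E j) x :: real)"
      by (intro Bochner_Integration.integrable_sum int sets.Int E) (auto simp: E_def)
    have 2: "integrable lborel (\<lambda>x. c\<^sup>2 * indicator U x)"
      by (intro integrable_mult_right int U) (auto simp: U_def)
    have 3: "(\<integral>x. (\<Sum>i\<in>I. \<Sum>j\<in>I. indicator (E i \<inter> E j) x) \<partial>lborel) = (\<Sum>i\<in>I. \<Sum>j\<in>I. measure lborel (E i \<inter> E j))"
      by (subst Bochner_Integration.integral_sum; (intro Bochner_Integration.integrable_sum int sets.Int E sum.cong refl)?;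
          (subst Bochner_Integration.integral_sum)?; (intro int sets.Int E)?) (auto simp: E_def)
    show ?thesis by (subst Bochner_Integration.integral_add[OF 1 2]) (simp add: 3)
  qed
  also have "\<dots> = pair_overlap T I u + c\<^sup>2 * measure lborel U"
    unfolding pair_overlap_def EE measure_overlap ..
  finally show ?thesis by (simp add: U_def)
qed

text \<open>Jensen's inequality for the number of hits, whose mean is \<mu>. It makes the excess of
  the second moment over the squared mean nonnegative for every \<open>u\<close>, so that Markov's
  inequality applies to the excess itself.\<close>

lemma pair_overlap_ge:
  fixes T :: real
  assumes "finite I" "0 \<le> T" "T < 1/2"
  shows "(2 * T * card I)\<^sup>2 \<le> pair_overlap T I u"
proof -
  define \<mu> where "\<mu> = 2 * T * card I"
  have "measure lborel {x \<in> {0..<1::real}. \<exists>i\<in>I. x - u i \<in> near_int T} \<le> measure lborel {0..<1::real}"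
    by (intro measure_mono_fmeasurable) (use assms in \<open>auto simp: fmeasurable_def\<close>)
  then have "measure lborel {x \<in> {0..<1::real}. \<exists>i\<in>I. x - u i \<in> near_int T} \<le> 1"
    by simp
  then have "\<mu>\<^sup>2 * measure lborel {x \<in> {0..<1::real}. \<exists>i\<in>I. x - u i \<in> near_int T} \<le> \<mu>\<^sup>2 * 1"
    by (intro mult_left_mono) auto
  moreover have "0 \<le> \<mu>" using assms by (simp add: \<mu>_def)
  ultimately show ?thesis
    using pair_overlap_covered[OF assms, of \<mu> u] unfolding \<mu>_def[symmetric] by (simp add: power2_eq_square)
qed

text \<open>Averaging over \<open>A\<close> makes the off-diagonal pairs independent. As the overlap also averages over
  the target point, this includes pairs of parallel vectors and in particular the case \<open>d = 1\<close>.\<close>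
lemma emeasure_pair_overlap_large:
  fixes h :: "'i \<Rightarrow> 'a::euclidean_space" and T s :: real
  assumes I: "finite I" "inj_on h I" and h: "\<And>i b. i \<in> I \<Longrightarrow> b \<in> Basis \<Longrightarrow> h i \<bullet> b \<in> \<int>"
    and T: "0 \<le> T" "T < 1/2" and s: "0 < s"
  shows "{A \<in> unit_cube a. (2 * T * card I)\<^sup>2 + s \<le> pair_overlap T I (\<lambda>i. A \<bullet> h i)} \<in> sets borel" (is "?B \<in> _")
    and "emeasure lborel {A \<in> unit_cube a. (2 * T * card I)\<^sup>2 + s \<le> pair_overlap T I (\<lambda>i. A \<bullet> h i)}
       \<le> ennreal (2 * T * card I / s)"
proof -
  define \<mu> where "\<mu> = 2 * T * card I"
  have \<mu>: "0 \<le> \<mu>" using T by (simp add: \<mu>_def)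
  define M where "M A = pair_overlap T I (\<lambda>i. A \<bullet> h i)" for A
  have dint: "(h i - h j) \<bullet> b \<in> \<int>" if "i \<in> I" "j \<in> I" "b \<in> Basis" for i j b
    using h that by (simp add: inner_diff_left)
  have mo: "(\<lambda>A. ennreal (overlap T (A \<bullet> (h i - h j)))) \<in> borel_measurable borel" if "i \<in> I" "j \<in> I" for i j
  proof (cases "h i = h j")
    case False
    then show ?thesis using nn_integral_overlap(2)[OF T(1) dint[OF that]] by simp
  qed simp
  have M: "ennreal (M A) = (\<Sum>i\<in>I. \<Sum>j\<in>I. ennreal (overlap T (A \<bullet> (h i - h j))))" for A
    by (simp add: M_def pair_overlap_def sum_nonneg overlap_nonneg inner_diff_right flip: sum_ennreal)
  have M_nonneg: "0 \<le> M A" for A by (simp add: M_def pair_overlap_def sum_nonneg overlap_nonneg)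
  have "(\<lambda>A. ennreal (M A)) \<in> borel_measurable borel" unfolding M using mo by measurable
  then have "(\<lambda>A. enn2real (ennreal (M A))) \<in> borel_measurable borel" by measurable
  then have [measurable]: "M \<in> borel_measurable borel" using M_nonneg by simp
  show meas: "?B \<in> sets borel" unfolding M_def[symmetric] by measurable
  have ge: "\<mu>\<^sup>2 \<le> M A" for A unfolding \<mu>_def M_def by (rule pair_overlap_ge[OF I(1) T])
  let ?c = "indicator (unit_cube a) :: 'a \<Rightarrow> ennreal"
  have "(\<integral>\<^sup>+A. ennreal (M A) * ?c A \<partial>lborel) = (\<Sum>i\<in>I. \<Sum>j\<in>I. (\<integral>\<^sup>+A. ennreal (overlap T (A \<bullet> (h i - h j))) * ?c A \<partial>lborel))"
    unfolding M sum_distrib_right using mo by (subst nn_integral_sum; (intro sum.cong refl)?; (subst nn_integral_sum)?) auto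
  \<comment> \<open>The diagonal adds up to \<mu>; the off-diagonal pairs, being independent, stay
    below the squared mean.\<close>
  also have "\<dots> \<le> (\<Sum>i\<in>I. \<Sum>j\<in>I. ennreal (if i = j then 2 * T else (2 * T)\<^sup>2))"
  proof (intro sum_mono)
    fix i j assume ij: "i \<in> I" "j \<in> I"
    show "(\<integral>\<^sup>+A. ennreal (overlap T (A \<bullet> (h i - h j))) * ?c A \<partial>lborel) \<le> ennreal (if i = j then 2 * T else (2 * T)\<^sup>2)"
    proof (cases "i = j")
      case True
      then show ?thesis by (simp add: overlap_0[OF T] nn_integral_cmult emeasure_unit_cube)
    next
      case False
      then have "h i - h j \<noteq> 0" using I(2) ij by (auto dest: inj_onD)
      then show ?thesis using nn_integral_overlap(1)[OF T(1) dint[OF ij]] False by simp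
    qed
  qed
  also have "\<dots> = ennreal (\<Sum>i\<in>I. \<Sum>j\<in>I. (if i = j then 2 * T else (2 * T)\<^sup>2))"
    using T by (simp add: sum_nonneg)
  also have "\<dots> \<le> ennreal (\<mu> + \<mu>\<^sup>2)"
  proof (rule ennreal_leI)
    have "(\<Sum>i\<in>I. \<Sum>j\<in>I. (if i = j then 2 * T else (2 * T)\<^sup>2)) \<le> (\<Sum>i\<in>I. \<Sum>j\<in>I. (if i = j then 2 * T else 0) + (2 * T)\<^sup>2)"
      using T by (intro sum_mono) auto
    also have "\<dots> = \<mu> + \<mu>\<^sup>2"
      using I(1) by (simp add: sum.distrib \<mu>_def power2_eq_square algebra_simps)
    finally show "(\<Sum>i\<in>I. \<Sum>j\<in>I. (if i = j then 2 * T else (2 * T)\<^sup>2)) \<le> \<mu> + \<mu>\<^sup>2" .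
  qed
  finally have M1: "(\<integral>\<^sup>+A. ennreal (M A) * ?c A \<partial>lborel) \<le> ennreal (\<mu> + \<mu>\<^sup>2)" .
  have "(\<integral>\<^sup>+A. ennreal (M A) * ?c A \<partial>lborel) = (\<integral>\<^sup>+A. ennreal (M A - \<mu>\<^sup>2) * ?c A + ennreal (\<mu>\<^sup>2) * ?c A \<partial>lborel)"
    using ge by (intro nn_integral_cong) (auto simp: indicator_def simp flip: ennreal_plus)
  also have "\<dots> = (\<integral>\<^sup>+A. ennreal (M A - \<mu>\<^sup>2) * ?c A \<partial>lborel) + ennreal (\<mu>\<^sup>2)"
    by (subst nn_integral_add) (auto simp: nn_integral_cmult emeasure_unit_cube)
  finally have "(\<integral>\<^sup>+A. ennreal (M A - \<mu>\<^sup>2) * ?c A \<partial>lborel) + ennreal (\<mu>\<^sup>2) \<le> ennreal \<mu> + ennreal (\<mu>\<^sup>2)"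
    using M1 \<mu> by simp
  then have M2: "(\<integral>\<^sup>+A. ennreal (M A - \<mu>\<^sup>2) * ?c A \<partial>lborel) \<le> ennreal \<mu>"
    by (simp add: ennreal_add_left_cancel_le add.commute)
  \<comment> \<open>Markov's inequality for the excess, whose integral over the cube is at most
    \<mu>.\<close>
  have "emeasure lborel ?B \<le> emeasure lborel {A \<in> unit_cube a. 1 \<le> ennreal (1/s) * ennreal (M A - \<mu>\<^sup>2)}"
  proof (intro emeasure_mono)
    show "?B \<subseteq> {A \<in> unit_cube a. 1 \<le> ennreal (1/s) * ennreal (M A - \<mu>\<^sup>2)}"
    proof
      fix A assume A: "A \<in> ?B"
      then have "1 \<le> (1/s) * (M A - \<mu>\<^sup>2)" using s by (simp add: field_simps M_def \<mu>_def)
      then have "1 \<le> ennreal (1/s) * ennreal (M A - \<mu>\<^sup>2)"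
        using s ge[of A] by (simp flip: ennreal_mult ennreal_1)
      then show "A \<in> {A \<in> unit_cube a. 1 \<le> ennreal (1/s) * ennreal (M A - \<mu>\<^sup>2)}"
        using A by simp
    qed
  qed measurable
  also have "\<dots> \<le> ennreal (1/s) * (\<integral>\<^sup>+A. ennreal (M A - \<mu>\<^sup>2) * ?c A \<partial>lborel)"
    by (rule nn_integral_Markov_inequality) auto
  also have "\<dots> \<le> ennreal (1/s) * ennreal \<mu>" by (intro mult_left_mono M2) auto
  also have "\<dots> = ennreal (\<mu> / s)" using s \<mu> by (simp flip: ennreal_mult)
  finally show "emeasure lborel ?B \<le> ennreal (2 * T * card I / s)" by (simp add: \<mu>_def)
qed

section \<open>Generic linear forms\<close>

definition intvec :: "(real^'n) set" where
  "intvec = {v. \<forall>i. v $ i \<in> \<int>}"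

lemma intvec_add: "v \<in> intvec \<Longrightarrow> w \<in> intvec \<Longrightarrow> v + w \<in> intvec"
  and intvec_diff: "v \<in> intvec \<Longrightarrow> w \<in> intvec \<Longrightarrow> v - w \<in> intvec"
  and intvec_minus: "v \<in> intvec \<Longrightarrow> - v \<in> intvec"
  and intvec_0: "0 \<in> intvec"
  by (auto simp: intvec_def)

lemma bij_betw_vec_PiE: "bij_betw (\<lambda>f. \<chi> i. f i) (PiE UNIV S) {v. \<forall>i. v $ i \<in> S i}"
  by (rule bij_betwI[where g = "\<lambda>v i. v $ i"]) auto

lemma card_vec_box: "card {v :: 'a^'n. \<forall>i. v $ i \<in> S i} = (\<Prod>i\<in>UNIV. card (S i))"
  using bij_betw_same_card[OF bij_betw_vec_PiE[of S]] by (simp add: card_PiE)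

lemma finite_vec_box: "(\<And>i. finite (S i)) \<Longrightarrow> finite {v :: 'a^'n. \<forall>i. v $ i \<in> S i}"
  using bij_betw_finite[OF bij_betw_vec_PiE[of S]] by (simp add: finite_PiE)

lemma countable_intvec: "countable (intvec :: (real^'n) set)"
proof -
  have "countable (PiE (UNIV :: 'n set) (\<lambda>_. \<int> :: real set))"
    by (intro countable_PiE) (auto simp: Ints_def)
  then have "countable ((\<lambda>f. \<chi> i. f i) ` PiE (UNIV :: 'n set) (\<lambda>_. \<int> :: real set))" by simp
  then show ?thesis
    using bij_betw_imp_surj_on[OF bij_betw_vec_PiE[of "\<lambda>_::'n. \<int> :: real set"]] by (simp add: intvec_def)
qed

definition icube :: "nat \<Rightarrow> (real^'n) set" where
  "icube N = {v \<in> intvec. \<forall>i. 0 \<le> v $ i \<and> v $ i < real N}"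

definition ibox :: "real \<Rightarrow> (real^'n) set" where
  "ibox M = {v \<in> intvec. \<forall>i. \<bar>v $ i\<bar> \<le> M}"

lemma finite_Ints_abs_le: "finite {x \<in> \<int>. \<bar>x::real\<bar> \<le> M}"
proof -
  have "{x \<in> \<int>. \<bar>x::real\<bar> \<le> M} \<subseteq> of_int ` {-\<lceil>M\<rceil>..\<lceil>M\<rceil>}"
  proof
    fix x assume "x \<in> {x \<in> \<int>. \<bar>x::real\<bar> \<le> M}"
    then obtain k where k: "x = of_int k" "\<bar>real_of_int k\<bar> \<le> M" by (auto elim: Ints_cases)
    then have "k \<in> {-\<lceil>M\<rceil>..\<lceil>M\<rceil>}" by (auto simp: abs_le_iff) linarith+
    then show "x \<in> of_int ` {-\<lceil>M\<rceil>..\<lceil>M\<rceil>}" using k by blast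
  qed
  then show ?thesis by (rule finite_subset) auto
qed

lemma card_Ints_abs_le: "M \<ge> 0 \<Longrightarrow> real (card {x \<in> \<int>. \<bar>x::real\<bar> \<le> M}) \<le> 2 * M + 1"
proof -
  assume M: "M \<ge> 0"
  have "{x \<in> \<int>. \<bar>x::real\<bar> \<le> M} \<subseteq> of_int ` {-\<lfloor>M\<rfloor>..\<lfloor>M\<rfloor>}"
  proof
    fix x assume "x \<in> {x \<in> \<int>. \<bar>x::real\<bar> \<le> M}"
    then obtain k where k: "x = of_int k" "\<bar>real_of_int k\<bar> \<le> M" by (auto elim: Ints_cases)
    then have "k \<in> {-\<lfloor>M\<rfloor>..\<lfloor>M\<rfloor>}" by (auto simp: abs_le_iff) linarith+
    then show "x \<in> of_int ` {-\<lfloor>M\<rfloor>..\<lfloor>M\<rfloor>}" using k by blast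
  qed
  then have "card {x \<in> \<int>. \<bar>x::real\<bar> \<le> M} \<le> card (of_int ` {-\<lfloor>M\<rfloor>..\<lfloor>M\<rfloor>} :: real set)"
    by (intro card_mono) auto
  also have "\<dots> \<le> card {-\<lfloor>M\<rfloor>..\<lfloor>M\<rfloor>}" by (rule card_image_le) auto
  also have "\<dots> = nat (2 * \<lfloor>M\<rfloor> + 1)" by simp
  finally have "real (card {x \<in> \<int>. \<bar>x::real\<bar> \<le> M}) \<le> real (nat (2 * \<lfloor>M\<rfloor> + 1))" by linarith
  also have "\<dots> \<le> 2 * M + 1" using M by (simp add: of_nat_nat)
  finally show ?thesis .
qed

lemma Ints_half_open_eq: "{x \<in> \<int>. 0 \<le> (x::real) \<and> x < real N} = real ` {..<N}"
proof (safe, goal_cases)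
  case (1 x)
  then obtain k where k: "x = of_int k" by (auto elim: Ints_cases)
  then have "x = real (nat k)" "nat k < N" using 1 by auto linarith?
  then show ?case by blast
qed auto

lemma finite_ibox: "finite (ibox M)"
  using finite_vec_box[of "\<lambda>_. {x \<in> \<int>. \<bar>x::real\<bar> \<le> M}"] finite_Ints_abs_le
  by (simp add: ibox_def intvec_def all_conj_distrib Collect_conj_eq)

lemma icube_eq: "icube N = {v. \<forall>i. v $ i \<in> real ` {..<N}}"
  unfolding Ints_half_open_eq[symmetric] by (auto simp: icube_def intvec_def)

lemma finite_icube: "finite (icube N)"
  unfolding icube_eq by (rule finite_vec_box) auto

lemma card_icube: "card (icube N :: (real^'n) set) = N ^ CARD('n)"
  unfolding icube_eq by (subst card_vec_box) (simp add: card_image)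

lemma card_ibox_zero_coordinate:
  assumes "M \<ge> 1"
  shows "real (card {q \<in> ibox M :: (real^'n) set. q $ i = 0}) \<le> (3 * M) ^ (CARD('n) - 1)"
proof -
  let ?S = "\<lambda>k. if k = i then {0} else {x \<in> \<int>. \<bar>x::real\<bar> \<le> M}"
  have "{q \<in> ibox M :: (real^'n) set. q $ i = 0} = {v. \<forall>k. v $ k \<in> ?S k}"
  proof (intro set_eqI iffI)
    fix q :: "real^'n" assume q: "q \<in> {v. \<forall>k. v $ k \<in> ?S k}"
    have "q $ k \<in> \<int> \<and> \<bar>q $ k\<bar> \<le> M" for k
      using q assms by (cases "k = i") (auto dest: spec[of _ k])
    moreover have "q $ i = 0" using q by (auto dest: spec[of _ i])
    ultimately show "q \<in> {q \<in> ibox M. q $ i = 0}" by (auto simp: ibox_def intvec_def)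
  qed (auto simp: ibox_def intvec_def)
  then have "real (card {q \<in> ibox M :: (real^'n) set. q $ i = 0}) = (\<Prod>k\<in>UNIV. real (card (?S k)))"
    by (simp only: card_vec_box of_nat_prod)
  also have "\<dots> = (\<Prod>k\<in>UNIV - {i}. real (card (?S k)))"
    by (subst prod.remove[of _ i]) auto
  also have "\<dots> \<le> (\<Prod>k\<in>UNIV - {i}. 3 * M)"
    using card_Ints_abs_le[of M] assms by (intro prod_mono) auto
  also have "\<dots> = (3 * M) ^ (CARD('n) - 1)" by (simp add: card_Diff_singleton)
  finally show ?thesis .
qed

text \<open>A \<open>2^n\<close>-cube contains \<open>2^(n d)\<close> integer points, so their images under a linear form hit
  an interval of this width about \<open>n^(1 + \<epsilon>)\<close> times.\<close>
definition width :: "nat \<Rightarrow> real \<Rightarrow> nat \<Rightarrow> real" where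
  "width d \<epsilon> n = real n powr (1 + \<epsilon>) / 2 ^ (n * d)"

lemma width_nonneg: "0 \<le> width d \<epsilon> n" by (simp add: width_def)

lemma tendsto_width: assumes "d > 0" shows "width d \<epsilon> \<longlonglongrightarrow> 0"
proof -
  have 1: "(\<lambda>n. real n powr (1 + \<epsilon>) / 2 ^ n) \<longlonglongrightarrow> 0" by real_asymp
  have "norm (width d \<epsilon> n) \<le> real n powr (1 + \<epsilon>) / 2 ^ n" for n
    unfolding width_def using assms by (auto intro!: divide_left_mono power_increasing)
  then show ?thesis using 1 by (intro Lim_null_comparison[OF _ 1]) auto
qed

text \<open>Here \<mu> is the mean number of hits. The permitted excess is \<mu> times
  \<open>n^(1 + \<epsilon> / 2)\<close>: large enough for the failure probabilities to be summable,
  small enough not to exceed the squared mean.\<close>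

definition second_moment_ok :: "real \<Rightarrow> nat \<Rightarrow> (real^'d \<Rightarrow> real) \<Rightarrow> bool" where
  "second_moment_ok \<epsilon> n u \<longleftrightarrow> 
     (let T = width CARD('d) \<epsilon> n; \<mu> = 2 * real n powr (1 + \<epsilon>)
      in pair_overlap T (icube (2 ^ n)) u < \<mu>\<^sup>2 + real n powr (1 + \<epsilon> / 2) * \<mu>)"

text \<open>Vectors with a vanishing coordinate are the differences of points in a common layer.
  They are so few that the complete absence of hits can be demanded.\<close>

definition faces_ok :: "real \<Rightarrow> nat \<Rightarrow> (real^'d \<Rightarrow> real) \<Rightarrow> bool" where
  "faces_ok \<epsilon> n u \<longleftrightarrow> (\<forall>q \<in> ibox (2 ^ n). q \<noteq> 0 \<longrightarrow> (\<exists>i. q $ i = 0) \<longrightarrow> u q \<notin> near_int (width CARD('d) \<epsilon> n))"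

text \<open>The rank one coefficient matrix that makes \<open>(A *v q) \<bullet> c\<close> an
  integer linear form in the entries of \<open>A\<close>.\<close>

definition outer_vec :: "real^'e \<Rightarrow> real^'d \<Rightarrow> real^'d^'e" where
  "outer_vec c q = (\<chi> j i. c $ j * q $ i)"

lemma inner_outer_vec: "A \<bullet> outer_vec c q = (A *v q) \<bullet> c"
  by (simp add: inner_vec_def outer_vec_def matrix_vector_mult_def sum_distrib_left sum_distrib_right mult_ac)

lemma outer_vec_Basis:
  assumes "c \<in> intvec" "q \<in> intvec" "b \<in> Basis"
  shows "outer_vec c q \<bullet> b \<in> \<int>"
proof -
  obtain j i where b: "b = axis j (axis i 1)" using assms(3) by (auto simp: Basis_vec_def)
  then have "outer_vec c q \<bullet> b = c $ j * q $ i"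
    by (simp add: inner_axis outer_vec_def)
  then show ?thesis using assms by (simp add: intvec_def)
qed

lemma outer_vec_inj: "c \<noteq> 0 \<Longrightarrow> outer_vec c q = outer_vec c q' \<Longrightarrow> q = q'"
  by (simp add: outer_vec_def vec_eq_iff) fastforce

lemma outer_vec_0: "outer_vec c 0 = 0"
  by (simp add: outer_vec_def vec_eq_iff)

text \<open>The averaging estimates live on sets of measure one; countably many unit cubes with
  integer corners exhaust the space.\<close>

lemma AE_by_unit_cubes:
  fixes P :: "'a::euclidean_space \<Rightarrow> bool"
  assumes "\<And>a. AE A in lborel. A \<in> unit_cube a \<longrightarrow> P A"
  shows "AE A in lborel. P A"
proof -
  define C where "C = (\<lambda>f. \<Sum>b\<in>Basis. f b *\<^sub>R b :: 'a) ` PiE Basis (\<lambda>_. \<int>)"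
  have "countable C" unfolding C_def by (intro countable_image countable_PiE) (auto simp: Ints_def)
  then have "AE A in lborel. \<forall>a\<in>C. A \<in> unit_cube a \<longrightarrow> P A"
    using assms by (subst AE_ball_countable) auto
  then show ?thesis
  proof (rule AE_mp, intro AE_I2 impI)
    fix A :: 'a assume *: "\<forall>a\<in>C. A \<in> unit_cube a \<longrightarrow> P A"
    define f where "f = restrict (\<lambda>b. of_int \<lfloor>A \<bullet> b\<rfloor> :: real) Basis"
    have "(\<Sum>b\<in>Basis. f b *\<^sub>R b) \<in> C" unfolding C_def by (rule imageI) (auto simp: f_def)
    moreover have "A \<in> unit_cube (\<Sum>b\<in>Basis. f b *\<^sub>R b)"
      unfolding unit_cube_def by (auto simp: f_def inner_sum_left_Basis)
    ultimately show "P A" using * by blast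
  qed
qed

section \<open>Borel--Cantelli over the dyadic scales\<close>

lemma AE_eventually_second_moment_ok:
  fixes c :: "real^'e"
  assumes c: "c \<in> intvec" "c \<noteq> 0" and \<epsilon>: "\<epsilon> > 0"
  shows "AE A in lborel. \<forall>\<^sub>F n in sequentially. second_moment_ok \<epsilon> n (\<lambda>q::real^'d. (A *v q) \<bullet> c)"
proof (rule AE_by_unit_cubes)
  fix a :: "real^'d^'e"
  let ?d = "CARD('d)"
  let ?W = "width ?d \<epsilon>"
  have "\<forall>\<^sub>F n in sequentially. ?W n < 1/2"
    using tendsto_width[of ?d \<epsilon>] by (intro order_tendstoD) auto
  then obtain m0 where m0: "\<And>n. n \<ge> m0 \<Longrightarrow> ?W n < 1/2"
    unfolding eventually_sequentially by blast
  define n0 where "n0 = Suc m0"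
  have n0: "\<And>n. n \<ge> n0 \<Longrightarrow> ?W n < 1/2" "n0 > 0" using m0 by (auto simp: n0_def)
  \<comment> \<open>The probability estimate requires a width below one half and a positive mean.
    The finitely many scales before that are simply not tested.\<close>
  define B where "B n = (if n < n0 then {} else {A \<in> unit_cube a. \<not> second_moment_ok \<epsilon> n (\<lambda>q::real^'d. (A *v q) \<bullet> c)})" for n
  have B: "B n \<in> sets lborel" "emeasure lborel (B n) \<le> ennreal (1 / real n powr (1 + \<epsilon>/2))" for n
  proof -
    have "B n \<in> sets borel \<and> emeasure lborel (B n) \<le> ennreal (1 / real n powr (1 + \<epsilon>/2))"
    proof (cases "n < n0")
      case False
      define T where "T = ?W n"
      define \<mu> where "\<mu> = 2 * real n powr (1 + \<epsilon>)"
      have n: "n > 0" using False n0 by auto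
      have T: "0 \<le> T" "T < 1/2" using n0 False by (auto simp: T_def width_nonneg)
      have \<mu>: "2 * T * real (card (icube (2^n) :: (real^'d) set)) = \<mu>"
        by (simp add: card_icube T_def width_def \<mu>_def flip: power_mult)
      have \<mu>_pos: "\<mu> > 0" using n by (simp add: \<mu>_def)
      have Beq: "B n = {A \<in> unit_cube a. (2 * T * real (card (icube (2^n) :: (real^'d) set)))\<^sup>2 + real n powr (1 + \<epsilon>/2) * \<mu>
           \<le> pair_overlap T (icube (2^n)) (\<lambda>q. A \<bullet> outer_vec c q)}"
        unfolding \<mu> using False by (auto simp: B_def second_moment_ok_def Let_def T_def \<mu>_def inner_outer_vec)
      note L = emeasure_pair_overlap_large[where I = "icube (2^n)" and h = "outer_vec c" and T = T and a = a
          and s = "real n powr (1 + \<epsilon>/2) * \<mu>", OF finite_icube _ _ T, unfolded \<mu>]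
      have inj: "inj_on (outer_vec c) (icube (2^n) :: (real^'d) set)"
        using outer_vec_inj[OF c(2)] by (auto intro!: inj_onI)
      have int: "outer_vec c q \<bullet> b \<in> \<int>" if "q \<in> icube (2^n)" "b \<in> Basis" for q :: "real^'d" and b
        using that c by (intro outer_vec_Basis) (auto simp: icube_def)
      have s: "0 < real n powr (1 + \<epsilon>/2) * \<mu>" using n \<mu>_pos by simp
      have eq: "\<mu> / (real n powr (1 + \<epsilon>/2) * \<mu>) = 1 / real n powr (1 + \<epsilon>/2)" using \<mu>_pos by simp
      have "B n \<in> sets borel" unfolding Beq \<mu> by (rule L(1)[OF inj int s])
      moreover have "emeasure lborel (B n) \<le> ennreal (\<mu> / (real n powr (1 + \<epsilon>/2) * \<mu>))"
        unfolding Beq \<mu> by (rule L(2)[OF inj int s])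
      ultimately show ?thesis unfolding eq by (rule conjI)
    qed (simp add: B_def)
    then show "B n \<in> sets lborel" "emeasure lborel (B n) \<le> ennreal (1 / real n powr (1 + \<epsilon>/2))" by auto
  qed
  have fin: "emeasure lborel (B n) < \<infinity>" for n using B(2)[of n] by (auto simp: less_top[symmetric] top_unique)
  have "summable (\<lambda>n. 1 / real n powr (1 + \<epsilon>/2))"
    using summable_real_powr_iff[of "-(1 + \<epsilon>/2)"] \<epsilon> by (simp add: powr_minus field_simps)
  moreover have "norm (measure lborel (B n)) \<le> 1 / real n powr (1 + \<epsilon>/2)" for n
    using B(2)[of n] by (simp add: measure_def enn2real_leI)
  ultimately have sum: "summable (\<lambda>n. measure lborel (B n))"
    by (rule summable_comparison_test'[where N = 0])
  have "AE A in lborel. \<forall>\<^sub>F n in sequentially. A \<in> space lborel - B n"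
    by (rule borel_cantelli_AE1[OF B(1) fin sum])
  then show "AE A in lborel. A \<in> unit_cube a \<longrightarrow> (\<forall>\<^sub>F n in sequentially. second_moment_ok \<epsilon> n (\<lambda>q::real^'d. (A *v q) \<bullet> c))"
  proof (rule AE_mp, intro AE_I2 impI)
    fix A assume A: "\<forall>\<^sub>F n in sequentially. A \<in> space lborel - B n" "A \<in> unit_cube a"
    show "\<forall>\<^sub>F n in sequentially. second_moment_ok \<epsilon> n (\<lambda>q::real^'d. (A *v q) \<bullet> c)"
      using A(1) eventually_ge_at_top[of n0]
      by eventually_elim (use A(2) in \<open>auto simp: B_def split: if_splits\<close>)
  qed
qed

text \<open>A first moment suffices: about \<open>2^(n (d - 1))\<close> vectors, each hitting with
  probability at most twice the width, give a summable bound of order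
  \<open>n^(1 + \<epsilon>) / 2^n\<close>.\<close>

lemma AE_eventually_faces_ok:
  fixes c :: "real^'e"
  assumes c: "c \<in> intvec" "c \<noteq> 0"
  shows "AE A in lborel. \<forall>\<^sub>F n in sequentially. faces_ok \<epsilon> n (\<lambda>q::real^'d. (A *v q) \<bullet> c)"
proof (rule AE_by_unit_cubes)
  fix a :: "real^'d^'e"
  let ?d = "CARD('d)"
  let ?W = "width ?d \<epsilon>"
  define F where "F n = {q \<in> ibox (2^n) :: (real^'d) set. q \<noteq> 0 \<and> (\<exists>i. q $ i = 0)}" for n
  define B where "B n = (\<Union>q\<in>F n. {A \<in> unit_cube a. A \<bullet> outer_vec c q + 0 \<in> near_int (?W n)})" for n
  define K where "K = 2 * real ?d * 3 ^ (?d - 1)"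
  have finF: "finite (F n)" for n unfolding F_def by (rule finite_subset[OF _ finite_ibox]) auto
  have cardF: "real (card (F n)) \<le> real ?d * (3 * 2^n) ^ (?d - 1)" for n
  proof -
    have "card (F n) \<le> card (\<Union>i. {q \<in> ibox (2^n) :: (real^'d) set. q $ i = 0})"
      unfolding F_def by (intro card_mono finite_subset[OF _ finite_ibox]) auto
    also have "\<dots> \<le> (\<Sum>i\<in>UNIV. card {q \<in> ibox (2^n) :: (real^'d) set. q $ i = 0})"
      by (rule card_UN_le) simp
    finally have "real (card (F n)) \<le> (\<Sum>i\<in>UNIV. real (card {q \<in> ibox (2^n) :: (real^'d) set. q $ i = 0}))"
      unfolding of_nat_sum[symmetric] of_nat_le_iff .
    also have "\<dots> \<le> (\<Sum>i\<in>(UNIV::'d set). (3 * 2^n) ^ (?d - 1))"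
      by (intro sum_mono card_ibox_zero_coordinate) simp
    finally show ?thesis by simp
  qed
  have meas: "{A \<in> unit_cube a. A \<bullet> outer_vec c q + 0 \<in> near_int (?W n)} \<in> sets lborel" for q n
    by measurable
  have B: "B n \<in> sets lborel" for n unfolding B_def using finF meas by (intro sets.finite_UN) auto
  have Bm: "emeasure lborel (B n) \<le> ennreal (K * (real n powr (1 + \<epsilon>) / 2 ^ n))" for n
  proof -
    have "emeasure lborel (B n) \<le> (\<Sum>q\<in>F n. emeasure lborel {A \<in> unit_cube a. A \<bullet> outer_vec c q + 0 \<in> near_int (?W n)})"
      unfolding B_def using finF meas by (intro emeasure_subadditive_finite) auto
    also have "\<dots> \<le> (\<Sum>q\<in>F n. ennreal (2 * ?W n))"
    proof (intro sum_mono emeasure_linear_form_near_int)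
      fix q assume q: "q \<in> F n"
      show "outer_vec c q \<bullet> b \<in> \<int>" if "b \<in> Basis" for b
        using q that c by (intro outer_vec_Basis) (auto simp: F_def ibox_def)
      show "outer_vec c q \<noteq> 0" using q outer_vec_inj[OF c(2), of q 0] by (auto simp: outer_vec_0 F_def)
    qed (simp add: width_nonneg)
    also have "\<dots> = ennreal (real (card (F n)) * (2 * ?W n))"
      by (simp add: width_nonneg ennreal_mult ennreal_of_nat_eq_real_of_nat)
    also have "\<dots> \<le> ennreal (K * (real n powr (1 + \<epsilon>) / 2 ^ n))"
    proof (rule ennreal_leI)
      have "real (card (F n)) * (2 * ?W n) \<le> (real ?d * (3 * 2^n) ^ (?d - 1)) * (2 * ?W n)"
        using cardF by (intro mult_right_mono) (auto simp: width_nonneg)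
      also have "\<dots> = K * ((2^n) ^ (?d - 1) * ?W n)" by (simp add: K_def power_mult_distrib)
      also have "(2^n) ^ (?d - 1) * ?W n = real n powr (1 + \<epsilon>) / 2 ^ n"
      proof -
        obtain d' where d': "?d = Suc d'" by (metis Suc_pred' zero_less_card_finite)
        show ?thesis unfolding width_def d' by (simp add: power_add flip: power_mult)
      qed
      finally show "real (card (F n)) * (2 * ?W n) \<le> K * (real n powr (1 + \<epsilon>) / 2 ^ n)" .
    qed
    finally show ?thesis .
  qed
  have fin: "emeasure lborel (B n) < \<infinity>" for n using Bm[of n] by (auto simp: less_top[symmetric] top_unique)
  have K: "K \<ge> 0" by (simp add: K_def)
  have bo: "(\<lambda>n. K * (real n powr (1 + \<epsilon>) / 2 ^ n)) \<in> O(\<lambda>n. 1 / real n ^ 2)" by real_asymp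
  have "summable (\<lambda>n. K * (real n powr (1 + \<epsilon>) / 2 ^ n))"
    by (rule summable_comparison_test_bigo[OF _ bo]) (use inverse_power_summable[of 2, where 'a=real] in \<open>simp add: field_simps\<close>)
  moreover have "norm (measure lborel (B n)) \<le> K * (real n powr (1 + \<epsilon>) / 2 ^ n)" for n
    using Bm[of n] K by (simp add: measure_def enn2real_leI)
  ultimately have sum: "summable (\<lambda>n. measure lborel (B n))"
    by (rule summable_comparison_test'[where N = 0])
  have "AE A in lborel. \<forall>\<^sub>F n in sequentially. A \<in> space lborel - B n"
    by (rule borel_cantelli_AE1[OF B fin sum])
  then show "AE A in lborel. A \<in> unit_cube a \<longrightarrow> (\<forall>\<^sub>F n in sequentially. faces_ok \<epsilon> n (\<lambda>q::real^'d. (A *v q) \<bullet> c))"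
  proof (rule AE_mp, intro AE_I2 impI)
    fix A assume A: "\<forall>\<^sub>F n in sequentially. A \<in> space lborel - B n" "A \<in> unit_cube a"
    show "\<forall>\<^sub>F n in sequentially. faces_ok \<epsilon> n (\<lambda>q::real^'d. (A *v q) \<bullet> c)"
      using A(1) by eventually_elim (use A(2) in \<open>auto simp: B_def F_def faces_ok_def inner_outer_vec\<close>)
  qed
qed

lemma AE_linear_form_not_integer:
  fixes c :: "real^'e" and q :: "real^'d"
  assumes c: "c \<in> intvec" "c \<noteq> 0" and q: "q \<in> intvec" "q \<noteq> 0"
  shows "AE A in lborel. (A *v q) \<bullet> c \<notin> \<int>"
proof (rule AE_by_unit_cubes)
  fix a :: "real^'d^'e"
  \<comment> \<open>At width zero \<open>near_int\<close> is the set of integers, and the general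
    estimate says that this event is null.\<close>
  let ?N = "{A \<in> unit_cube a. A \<bullet> outer_vec c q + 0 \<in> near_int 0}"
  have "outer_vec c q \<noteq> 0" using q outer_vec_inj[OF c(2), of q 0] by (auto simp: outer_vec_0)
  then have "emeasure lborel ?N \<le> ennreal (2 * 0)"
    using outer_vec_Basis[OF c(1) q(1)] by (intro emeasure_linear_form_near_int) auto
  moreover have "?N \<in> sets lborel" by measurable
  ultimately have "?N \<in> null_sets lborel" by auto
  then have "AE A in lborel. A \<notin> ?N" by (rule AE_not_in)
  then show "AE A in lborel. A \<in> unit_cube a \<longrightarrow> (A *v q) \<bullet> c \<notin> \<int>"
    by (rule AE_mp) (auto intro!: AE_I2 simp: inner_outer_vec near_int_def elim!: Ints_cases)
qed

text \<open>Restricting \<epsilon> to \<open>1 / real (Suc k)\<close> leaves countably many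
  conditions, which share one null set; every positive \<epsilon> has such values below it. The
  first clause provides density of the projected lattice, the second the counting.\<close>

definition generic_form :: "(real^'d \<Rightarrow> real) \<Rightarrow> bool" where
  "generic_form u \<longleftrightarrow> (\<forall>q\<in>intvec. q \<noteq> 0 \<longrightarrow> u q \<notin> \<int>) \<and>
     (\<forall>k::nat. \<forall>\<^sub>F n in sequentially. second_moment_ok (1 / real (Suc k)) n u \<and> faces_ok (1 / real (Suc k)) n u)"

lemma AE_generic_form:
  "AE A :: real^'d^'e in lborel. \<forall>c\<in>intvec - {0}. generic_form (\<lambda>q. (A *v q) \<bullet> c)"
proof (subst AE_ball_countable)
  show "countable (intvec - {0} :: (real^'e) set)" using countable_intvec by blast
  show "\<forall>c\<in>intvec - {0}. AE A :: real^'d^'e in lborel. generic_form (\<lambda>q. (A *v q) \<bullet> c)"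
  proof
    fix c :: "real^'e" assume c: "c \<in> intvec - {0}"
    have "AE A :: real^'d^'e in lborel. \<forall>q\<in>intvec - {0}. (A *v q) \<bullet> c \<notin> \<int>"
      using c AE_linear_form_not_integer by (subst AE_ball_countable) (auto intro: countable_intvec countable_Diff)
    moreover have "AE A :: real^'d^'e in lborel. \<forall>k::nat. \<forall>\<^sub>F n in sequentially. 
        second_moment_ok (1 / real (Suc k)) n (\<lambda>q. (A *v q) \<bullet> c) \<and> faces_ok (1 / real (Suc k)) n (\<lambda>q. (A *v q) \<bullet> c)"
      unfolding eventually_conj_iff AE_all_countable AE_conj_iff
      using c AE_eventually_second_moment_ok[of c "1 / real (Suc _)"] AE_eventually_faces_ok[of c "1 / real (Suc _)"] by auto
    ultimately show "AE A :: real^'d^'e in lborel. generic_form (\<lambda>q. (A *v q) \<bullet> c)"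
      by eventually_elim (auto simp: generic_form_def)
  qed
qed

section \<open>Covering and counting at one scale\<close>

lemma measure_gt_half_intersect:
  fixes U V :: "real set"
  assumes "U \<subseteq> {0..<1}" "V \<subseteq> {0..<1}" "U \<in> sets borel" "V \<in> sets borel"
    and "measure lborel U > 1/2" "measure lborel V > 1/2"
  shows "U \<inter> V \<noteq> {}"
proof
  assume "U \<inter> V = {}"
  have fin: "X \<in> fmeasurable lborel" if "X \<subseteq> {0..<1}" "X \<in> sets borel" for X :: "real set"
    using that emeasure_mono[OF that(1), of lborel] by (auto simp: fmeasurable_def less_top[symmetric] top_unique)
  have "measure lborel U + measure lborel V = measure lborel (U \<union> V)"
    using assms fin \<open>U \<inter> V = {}\<close> by (subst measure_Un2) (auto simp: Diff_triv Int_commute)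
  also have "\<dots> \<le> measure lborel {0..<1::real}"
    using assms fin by (intro measure_mono_fmeasurable) auto
  finally show False using assms by simp
qed

text \<open>The set \<open>U\<close> of points close to some \<open>u i\<close> and its reflection \<open>x - U\<close> both have measure greater
  than one half, hence they meet; this upgrades a statement about most points to all points.\<close>
lemma pair_overlap_cover:
  fixes T :: real
  assumes I: "finite I" and T: "0 \<le> T" "T < 1/2"
    and small: "pair_overlap T I u < 2 * (2 * T * card I)\<^sup>2"
  shows "\<exists>i\<in>I. \<exists>j\<in>I. x - u i - u j \<in> near_int (2 * T)"
proof -
  define \<mu> where "\<mu> = 2 * T * card I"
  have half: "measure lborel {y \<in> {0..<1}. \<exists>i\<in>I. y - v i \<in> near_int T} > 1/2"
    if "pair_overlap T I v = pair_overlap T I u" for v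
  proof -
    let ?m = "measure lborel {y \<in> {0..<1}. \<exists>i\<in>I. y - v i \<in> near_int T}"
    have "0 \<le> \<mu>" using T by (simp add: \<mu>_def)
    \<comment> \<open>Twice the mean is the choice of \<open>c\<close> for which a second moment
      below twice the squared mean forces the covered part to have measure above one half.\<close>
    then have "2 * (2 * \<mu>) * \<mu> \<le> pair_overlap T I u + (2 * \<mu>)\<^sup>2 * ?m"
      using pair_overlap_covered[OF I T, of "2 * \<mu>" v] that by (simp add: \<mu>_def)
    also have "\<dots> < 2 * \<mu>\<^sup>2 + (2 * \<mu>)\<^sup>2 * ?m" using small by (simp add: \<mu>_def)
    finally have "\<mu>\<^sup>2 * 1 < \<mu>\<^sup>2 * (2 * ?m)" by (simp add: power2_eq_square)
    then show ?thesis by (subst (asm) mult_less_cancel_left) (auto simp: not_less)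
  qed
  define V where "V v = {y \<in> {0..<1}. \<exists>i\<in>I. y - v i \<in> near_int T}" for v
  have V: "V v \<subseteq> {0..<1}" "V v \<in> sets borel" for v
  proof -
    have "V v = (\<Union>i\<in>I. {y \<in> {0..<1}. y - v i \<in> near_int T})" by (auto simp: V_def)
    moreover have "{y \<in> {0..<1}. y - v i \<in> near_int T} \<in> sets borel" for i by measurable
    ultimately show "V v \<in> sets borel" using I by auto
  qed (auto simp: V_def)
  \<comment> \<open>Reflection merely exchanges the members of each pair, so the second moment is
    the same.\<close>
  have "pair_overlap T I (\<lambda>i. x - u i) = pair_overlap T I u"
    unfolding pair_overlap_def by (subst sum.swap) simp
  then have "V u \<inter> V (\<lambda>i. x - u i) \<noteq> {}"
    using half[of u] half[of "\<lambda>i. x - u i"] V by (intro measure_gt_half_intersect) (auto simp: V_def)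
  then obtain y i j where "i \<in> I" "j \<in> I" "y - u i \<in> near_int T" "y - (x - u j) \<in> near_int T"
    by (auto simp: V_def)
  moreover then have "(y - u i) + - (y - (x - u j)) \<in> near_int (T + T)"
    by (intro near_int_add) (simp_all only: near_int_minus)
  ultimately show ?thesis by (auto simp: algebra_simps intro!: bexI)
qed

text \<open>Every \<open>h\<close> in the box with \<open>u h\<close> near an integer is the
  difference of \<open>M^d\<close> pairs in the cube of side \<open>2 * M\<close>, and each of these
  pairs contributes at least \<open>T\<close> to the second moment. An upper bound for the second
  moment therefore bounds the number of such \<open>h\<close>.\<close>

lemma pair_overlap_ge_count:
  fixes u :: "real^'d \<Rightarrow> real"
  assumes u: "linear u" and T: "0 \<le> T" "T < 1/2"
  shows "T * real M ^ CARD('d) * real (card {h \<in> ibox (real M). u h \<in> near_int T}) \<le> pair_overlap T (icube (2 * M)) u"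
proof -
  define H where "H = {h \<in> ibox (real M) :: (real^'d) set. u h \<in> near_int T}"
  define G where "G = (icube M :: (real^'d) set)"
  have fin: "finite H" "finite G" unfolding H_def G_def by (auto intro: finite_subset[OF _ finite_ibox] finite_icube)
  \<comment> \<open>The negative part of \<open>h\<close>: shifting by it makes both members of the
    pair nonnegative, with coordinates still below \<open>2 * M\<close>.\<close>
  define m where "m h = (\<chi> k. max 0 (- h $ k))" for h :: "real^'d"
  define \<phi> where "\<phi> = (\<lambda>(g, h). (g + m h + h, g + m h))"
  have m_int: "m h \<in> intvec" if "h \<in> intvec" for h using that by (auto simp: m_def intvec_def max_def)
  have inj: "inj_on \<phi> (G \<times> H)"
    by (auto simp: inj_on_def \<phi>_def)
  have sub: "\<phi> ` (G \<times> H) \<subseteq> icube (2 * M) \<times> icube (2 * M)"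
  proof (clarsimp simp: \<phi>_def)
    fix g h assume gh: "g \<in> G" "h \<in> H"
    then have gi: "g \<in> intvec" "h \<in> intvec" by (auto simp: G_def H_def icube_def ibox_def)
    have b: "0 \<le> g $ k" "g $ k < real M" "\<bar>h $ k\<bar> \<le> real M" for k
      using gh by (auto simp: G_def H_def icube_def ibox_def)
    have "0 \<le> g $ k + m h $ k + h $ k" "g $ k + m h $ k + h $ k < 2 * real M" 
      "0 \<le> g $ k + m h $ k" "g $ k + m h $ k < 2 * real M" for k
      using b[of k] by (auto simp: m_def max_def abs_le_iff)
    then show "g + m h + h \<in> icube (2 * M) \<and> g + m h \<in> icube (2 * M)"
      using gi m_int by (auto simp: icube_def intro!: intvec_add)
  qed
  have "T * real M ^ CARD('d) * real (card H) = (\<Sum>p\<in>G \<times> H. T)"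
    by (simp add: card_cartesian_product G_def card_icube)
  also have "\<dots> \<le> (\<Sum>p\<in>G \<times> H. overlap T (u (fst (\<phi> p)) - u (snd (\<phi> p))))"
  proof (rule sum_mono)
    fix p assume p: "p \<in> G \<times> H"
    have "u (fst (\<phi> p)) - u (snd (\<phi> p)) = u (snd p)"
      by (simp add: \<phi>_def case_prod_beta linear_add[OF u])
    then show "T \<le> overlap T (u (fst (\<phi> p)) - u (snd (\<phi> p)))"
      using p T by (auto simp: H_def intro!: overlap_ge)
  qed
  also have "\<dots> = (\<Sum>p\<in>\<phi> ` (G \<times> H). overlap T (u (fst p) - u (snd p)))"
    by (subst sum.reindex[OF inj]) simp
  also have "\<dots> \<le> (\<Sum>p\<in>icube (2 * M) \<times> icube (2 * M). overlap T (u (fst p) - u (snd p)))"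
    using sub by (intro sum_mono2) (auto simp: finite_icube overlap_nonneg)
  also have "\<dots> = pair_overlap T (icube (2 * M)) u"
    by (simp add: pair_overlap_def sum.cartesian_product case_prod_beta)
  finally show ?thesis by (simp add: H_def)
qed

lemma second_moment_ok_bound:
  fixes u :: "real^'d \<Rightarrow> real"
  assumes "second_moment_ok \<epsilon> n u" "n \<ge> 1" "\<epsilon> > 0"
  shows "pair_overlap (width CARD('d) \<epsilon> n) (icube (2 ^ n)) u < 2 * (2 * real n powr (1 + \<epsilon>))\<^sup>2"
proof -
  let ?\<mu> = "2 * real n powr (1 + \<epsilon>)"
  have "real n powr (1 + \<epsilon>/2) \<le> real n powr (1 + \<epsilon>)" using assms by (intro powr_mono) auto
  then have "real n powr (1 + \<epsilon>/2) \<le> ?\<mu>" using powr_ge_zero[of "real n" "1 + \<epsilon>"] by linarith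
  then have "real n powr (1 + \<epsilon>/2) * ?\<mu> \<le> ?\<mu> * ?\<mu>" by (intro mult_right_mono) auto
  then have "?\<mu>\<^sup>2 + real n powr (1 + \<epsilon>/2) * ?\<mu> \<le> 2 * ?\<mu>\<^sup>2" unfolding power2_eq_square by linarith
  then show ?thesis using assms(1) unfolding second_moment_ok_def Let_def by (rule less_le_trans[rotated])
qed

text \<open>The target is approached by a sum of two points of the cube, which doubles both the box
  and the width.\<close>

lemma second_moment_ok_cover:
  fixes u :: "real^'d \<Rightarrow> real"
  assumes ok: "second_moment_ok \<epsilon> n u" "n \<ge> 1" "\<epsilon> > 0" and u: "linear u" and w: "width CARD('d) \<epsilon> n < 1/2"
  shows "\<exists>q\<in>intvec. (\<forall>i. \<bar>q $ i\<bar> \<le> 2 * 2 ^ n) \<and> x - u q \<in> near_int (2 * width CARD('d) \<epsilon> n)"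
proof -
  let ?T = "width CARD('d) \<epsilon> n"
  have "2 * ?T * real (card (icube (2 ^ n) :: (real^'d) set)) = 2 * real n powr (1 + \<epsilon>)"
    by (simp add: card_icube width_def flip: power_mult)
  then have "pair_overlap ?T (icube (2 ^ n)) u < 2 * (2 * ?T * real (card (icube (2 ^ n) :: (real^'d) set)))\<^sup>2"
    using second_moment_ok_bound[OF ok] by (simp only:)
  from pair_overlap_cover[OF finite_icube width_nonneg w this, of x]
  obtain i j where ij: "i \<in> icube (2 ^ n)" "j \<in> icube (2 ^ n)" "x - u i - u j \<in> near_int (2 * ?T)" by blast
  have "\<bar>(i + j) $ k\<bar> \<le> 2 * 2 ^ n" for k
  proof -
    have "0 \<le> i $ k" "i $ k < 2 ^ n" "0 \<le> j $ k" "j $ k < 2 ^ n" using ij by (auto simp: icube_def)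
    then show ?thesis by simp
  qed
  moreover have "i + j \<in> intvec" using ij by (auto simp: icube_def intro: intvec_add)
  moreover have "x - u (i + j) \<in> near_int (2 * ?T)" using ij by (simp add: linear_add[OF u] algebra_simps)
  ultimately show ?thesis by blast
qed

text \<open>Vectors in the box of radius \<open>2^n\<close> are differences inside a cube of twice
  that side, so the second moment of the next scale is the one that counts them.\<close>

lemma second_moment_ok_count:
  fixes u :: "real^'d \<Rightarrow> real"
  assumes ok: "second_moment_ok \<epsilon> (Suc n) u" "\<epsilon> > 0" and u: "linear u" and w: "width CARD('d) \<epsilon> (Suc n) < 1/2"
  shows "real (card {h \<in> ibox (2 ^ n). u h \<in> near_int (width CARD('d) \<epsilon> (Suc n))}) \<le> 8 * 2 ^ CARD('d) * real (Suc n) powr (1 + \<epsilon>)"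
proof -
  let ?T = "width CARD('d) \<epsilon> (Suc n)" and ?d = "CARD('d)"
  let ?p = "real (Suc n) powr (1 + \<epsilon>)"
  let ?c = "real (card {h \<in> ibox (2 ^ n). u h \<in> near_int ?T})"
  have p: "?p > 0" by simp
  have "?T * real (2 ^ n) ^ ?d * ?c \<le> pair_overlap ?T (icube (2 ^ Suc n)) u"
    using pair_overlap_ge_count[OF u width_nonneg w, of "2 ^ n"] by simp
  also have "\<dots> < 2 * (2 * ?p)\<^sup>2" by (rule second_moment_ok_bound[OF ok(1) _ ok(2)]) simp
  also have "?T * real (2 ^ n) ^ ?d = ?p / 2 ^ ?d"
    by (simp add: width_def power_add flip: power_mult)
  finally have "?p * (?c / 2 ^ ?d) < ?p * (8 * ?p)" by (simp add: power2_eq_square)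
  then have "?c / 2 ^ ?d < 8 * ?p" using p by (subst (asm) mult_less_cancel_left_pos) auto
  then show ?thesis by (simp add: field_simps)
qed

text \<open>The larger exponent pays for everything: moving from scale \<open>n\<close> to
  \<open>n + c\<close> costs the fixed factor \<open>2^(c * d)\<close>, and any constant is
  eventually below \<open>n^(b - a)\<close>.\<close>

lemma eventually_scaled_width_le:
  assumes "0 < a" "a < b" "K > 0"
  shows "\<forall>\<^sub>F n in sequentially. K * width d a n \<le> width d b (n + c)"
proof -
  have "filterlim (\<lambda>n. real n powr (b - a)) at_top sequentially" using assms by real_asymp
  then have "\<forall>\<^sub>F n in sequentially. K * 2 ^ (c * d) \<le> real n powr (b - a)"
    by (auto simp: filterlim_at_top)
  then show ?thesis
  proof eventually_elim
    case (elim n)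
    have "K * 2 ^ (c * d) * real n powr (1 + a) \<le> real n powr (b - a) * real n powr (1 + a)"
      using elim by (intro mult_right_mono) auto
    also have "\<dots> = real n powr (1 + b)" by (simp add: add.commute flip: powr_add)
    also have "\<dots> \<le> real (n + c) powr (1 + b)" using assms by (intro powr_mono2) auto
    finally have "K * real n powr (1 + a) * 2 ^ (c * d) \<le> real (n + c) powr (1 + b)" by (simp add: mult_ac)
    then have "K * real n powr (1 + a) \<le> real (n + c) powr (1 + b) / 2 ^ (c * d)" by (simp add: pos_le_divide_eq)
    then have "K * real n powr (1 + a) / 2 ^ (n * d) \<le> real (n + c) powr (1 + b) / 2 ^ (c * d) / 2 ^ (n * d)"
      by (intro divide_right_mono) auto
    then show ?case by (simp add: width_def algebra_simps power_add)
  qed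
qed

lemma ibox_mono: "M \<le> M' \<Longrightarrow> ibox M \<subseteq> ibox M'"
  by (auto simp: ibox_def intro: order_trans)

lemma not_near_int_mono: "y \<notin> near_int T' \<Longrightarrow> T \<le> T' \<Longrightarrow> y \<notin> near_int T"
  using near_int_mono by blast

text \<open>A single \<tau> has to serve covering and counting. It is the covering width of exponent
  \<open>a\<close> at scale \<open>n\<close>; hits and faces are controlled with the larger exponent
  \<open>b\<close> at a later scale, whose width dominates \<open>K3 * \<tau>\<close>.
  \<open>K1\<close> sets the radius of the covering vectors, \<open>K2\<close> the box in which hits
  are counted.\<close>

lemma generic_form_scales:
  fixes u :: "real^'d \<Rightarrow> real"
  assumes u: "linear u" "generic_form u" and \<epsilon>: "\<epsilon> > 0" and K: "K1 > 0" "K2 > 0" "K3 > 0" "K4 > 0"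
  shows "\<exists>C. \<forall>\<^sub>F r in at_top. \<exists>\<tau>>0. K3 * \<tau> < K4 \<and> 
     (\<forall>x. \<exists>q\<in>intvec. (\<forall>i. \<bar>q $ i\<bar> \<le> r / K1) \<and> x - u q \<in> near_int \<tau>) \<and>
     real (card {h \<in> ibox (K2 * r). u h \<in> near_int (K3 * \<tau>)}) \<le> C * ln r powr (1 + \<epsilon>) \<and>
     (\<forall>h \<in> ibox (K2 * r). h \<noteq> 0 \<longrightarrow> (\<exists>i. h $ i = 0) \<longrightarrow> u h \<notin> near_int (K3 * \<tau>))"
proof -
  let ?d = "CARD('d)"
  obtain k where k: "inverse (real (Suc k)) < \<epsilon>" using reals_Archimedean[OF \<epsilon>] by blast
  define b where "b = 1 / real (Suc k)"
  define a where "a = 1 / real (Suc (Suc k))"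
  have ab: "0 < a" "a < b" "b \<le> \<epsilon>" using k by (auto simp: a_def b_def field_simps)
  \<comment> \<open>The scale will satisfy \<open>r < 4 * K1 * 2^n\<close>, so \<open>c\<close>
    further doublings reach the radius \<open>K2 * r\<close>; the additional \<open>Suc\<close> is
    the next scale required for counting.\<close>
  obtain c :: nat where c: "4 * K1 * K2 < 2 ^ c" using real_arch_pow[of 2 "4 * K1 * K2"] by auto
  define P where "P n \<longleftrightarrow> n \<ge> 1 \<and> second_moment_ok a n u \<and> second_moment_ok b (n + Suc c) u \<and> faces_ok b (n + Suc c) u
     \<and> width ?d a n < 1/2 \<and> width ?d b (n + Suc c) < 1/2 \<and> 2 * K3 * width ?d a n < K4
     \<and> 2 * K3 * width ?d a n \<le> width ?d b (n + Suc c)" for n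
  have "\<forall>\<^sub>F n in sequentially. P n"
    unfolding P_def
  proof (intro eventually_conj)
    show "\<forall>\<^sub>F n in sequentially. n \<ge> 1" by (rule eventually_ge_at_top)
    show "\<forall>\<^sub>F n in sequentially. second_moment_ok a n u"
      using u(2) unfolding generic_form_def a_def eventually_conj_iff by blast
    have B: "\<forall>\<^sub>F n in sequentially. second_moment_ok b n u" "\<forall>\<^sub>F n in sequentially. faces_ok b n u"
      using u(2) unfolding generic_form_def b_def eventually_conj_iff by blast+
    show "\<forall>\<^sub>F n in sequentially. second_moment_ok b (n + Suc c) u" "\<forall>\<^sub>F n in sequentially. faces_ok b (n + Suc c) u"
      using B eventually_sequentially_seg[of "\<lambda>n. second_moment_ok b n u" "Suc c"]
        eventually_sequentially_seg[of "\<lambda>n. faces_ok b n u" "Suc c"] by simp_all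
    show "\<forall>\<^sub>F n in sequentially. width ?d a n < 1/2"
      using tendsto_width[of ?d a] by (intro order_tendstoD) auto
    have "\<forall>\<^sub>F n in sequentially. width ?d b n < 1/2"
      using tendsto_width[of ?d b] by (intro order_tendstoD) auto
    then show "\<forall>\<^sub>F n in sequentially. width ?d b (n + Suc c) < 1/2" 
      using eventually_sequentially_seg[of "\<lambda>n. width ?d b n < 1/2" "Suc c"] by simp
    have "(\<lambda>n. 2 * K3 * width ?d a n) \<longlonglongrightarrow> 2 * K3 * 0"
      using tendsto_width[of ?d a] by (intro tendsto_intros) auto
    then show "\<forall>\<^sub>F n in sequentially. 2 * K3 * width ?d a n < K4"
      using K by (intro order_tendstoD) auto
    show "\<forall>\<^sub>F n in sequentially. 2 * K3 * width ?d a n \<le> width ?d b (n + Suc c)"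
      using K ab by (intro eventually_scaled_width_le) auto
  qed
  \<comment> \<open>The largest scale at which the covering vectors, of size at most
    \<open>2 * 2^n\<close>, stay within \<open>r / K1\<close>.\<close>
  define N where "N r = nat \<lfloor>log 2 (r / (2 * K1))\<rfloor>" for r
  have "filterlim N at_top at_top"
    unfolding N_def using K(1) by real_asymp
  then have ev: "\<forall>\<^sub>F r in at_top. P (N r)"
    using \<open>\<forall>\<^sub>F n in sequentially. P n\<close> by (simp add: filterlim_iff)
  \<comment> \<open>This converts the scale index into \<open>ln r\<close>; the factor 3 absorbs
    \<open>1 / ln 2\<close> and the additive constants.\<close>
  have ln3: "\<forall>\<^sub>F r in at_top. log 2 (r / (2 * K1)) + real (Suc c) \<le> 3 * ln r"
  proof -
    have "\<forall>\<^sub>F r in at_top. 2 * ln r - 2 * ln (2 * K1) + real (Suc c) \<le> 3 * ln r"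
      using K(1) by real_asymp
    then show ?thesis
      using eventually_ge_at_top[of "2 * K1"]
    proof eventually_elim
      case (elim r)
      have q: "r / (2 * K1) \<ge> 1" using elim(2) K by simp
      have "log 2 (r / (2 * K1)) = ln (r / (2 * K1)) / ln 2" by (simp add: log_def)
      also have "\<dots> \<le> ln (r / (2 * K1)) / (1/2)"
        using q ln2_ge_two_thirds by (intro divide_left_mono) auto
      also have "\<dots> = 2 * ln r - 2 * ln (2 * K1)" using elim(2) K by (simp add: ln_div)
      finally show ?case using elim(1) by linarith
    qed
  qed
  define C where "C = 8 * 2 ^ ?d * 3 powr (1 + b)"
  have "\<forall>\<^sub>F r in at_top. \<exists>\<tau>>0. K3 * \<tau> < K4 \<and> 
     (\<forall>x. \<exists>q\<in>intvec. (\<forall>i. \<bar>q $ i\<bar> \<le> r / K1) \<and> x - u q \<in> near_int \<tau>) \<and>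
     real (card {h \<in> ibox (K2 * r). u h \<in> near_int (K3 * \<tau>)}) \<le> C * ln r powr (1 + \<epsilon>) \<and>
     (\<forall>h \<in> ibox (K2 * r). h \<noteq> 0 \<longrightarrow> (\<exists>i. h $ i = 0) \<longrightarrow> u h \<notin> near_int (K3 * \<tau>))"
    using ev ln3 eventually_ge_at_top[of "2 * K1"] eventually_ge_at_top[of "exp 1"]
  proof eventually_elim
    case (elim r)
    define n where "n = N r"
    have Pn: "n \<ge> 1" "second_moment_ok a n u" "second_moment_ok b (Suc (n + c)) u" "faces_ok b (Suc (n + c)) u"
     "width ?d a n < 1/2" "width ?d b (Suc (n + c)) < 1/2" "2 * K3 * width ?d a n < K4"
     "2 * K3 * width ?d a n \<le> width ?d b (Suc (n + c))"
      using elim(1) by (auto simp: P_def n_def)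
    have r: "r \<ge> 2 * K1" "ln r \<ge> 1" using elim ln_ge_iff[of r 1] by (auto intro: less_le_trans[OF exp_gt_zero])
    have q1: "r / (2 * K1) \<ge> 1" using r(1) K by simp
    then have log_nn: "log 2 (r / (2 * K1)) \<ge> 0" by simp
    then have nfl: "real n = of_int \<lfloor>log 2 (r / (2 * K1))\<rfloor>" by (simp add: n_def N_def)
    then have nle: "real n \<le> log 2 (r / (2 * K1))" "log 2 (r / (2 * K1)) < real n + 1" by linarith+
    have lo: "2 ^ n \<le> r / (2 * K1)"
      using nle(1) q1 by (simp add: le_log_iff powr_realpow)
    have hi: "r / (2 * K1) < 2 * 2 ^ n"
    proof -
      have "r / (2 * K1) < 2 powr (real n + 1)" using nle(2) q1 by (simp add: log_less_iff)
      then show ?thesis by (simp add: powr_add powr_realpow)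
    qed
    define \<tau> where "\<tau> = 2 * width ?d a n"
    have \<tau>: "\<tau> > 0" using Pn(1) by (simp add: \<tau>_def width_def)
    have \<tau>le: "K3 * \<tau> \<le> width ?d b (Suc (n + c))" using Pn(8) by (simp add: \<tau>_def)
    have box: "K2 * r \<le> 2 ^ (n + c)"
    proof -
      have "r < 4 * K1 * 2 ^ n" using hi K by (simp add: field_simps)
      then have "K2 * r \<le> (4 * K1 * K2) * 2 ^ n" using K by (simp add: field_simps)
      also have "\<dots> \<le> 2 ^ c * 2 ^ n" using c by (intro mult_right_mono) auto
      finally show ?thesis by (simp add: power_add mult.commute)
    qed
    have sub: "ibox (K2 * r) \<subseteq> (ibox (2 ^ (n + c)) :: (real^'d) set)" using box by (auto simp: ibox_def intro: order_trans)
    show ?case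
    proof (intro exI[of _ \<tau>] conjI \<tau>)
      show "K3 * \<tau> < K4" using Pn(7) by (simp add: \<tau>_def)
      show "\<forall>x. \<exists>q\<in>intvec. (\<forall>i. \<bar>q $ i\<bar> \<le> r / K1) \<and> x - u q \<in> near_int \<tau>"
      proof
        fix x
        obtain q where q: "q\<in>intvec" "\<forall>i. \<bar>q $ i\<bar> \<le> 2 * 2 ^ n" "x - u q \<in> near_int \<tau>"
          using second_moment_ok_cover[OF Pn(2,1) ab(1) u(1) Pn(5), of x] by (auto simp: \<tau>_def)
        have "2 * 2 ^ n \<le> r / K1" using lo K by (simp add: field_simps)
        then show "\<exists>q\<in>intvec. (\<forall>i. \<bar>q $ i\<bar> \<le> r / K1) \<and> x - u q \<in> near_int \<tau>"
          using q by (meson order_trans)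
      qed
      have "card {h \<in> ibox (K2 * r). u h \<in> near_int (K3 * \<tau>)} \<le> card {h \<in> ibox (2 ^ (n + c)). u h \<in> near_int (width ?d b (Suc (n + c)))}"
        using sub near_int_mono[OF \<tau>le] by (intro card_mono finite_subset[OF _ finite_ibox]) auto
      then have "real (card {h \<in> ibox (K2 * r). u h \<in> near_int (K3 * \<tau>)}) \<le> 8 * 2 ^ ?d * real (Suc (n + c)) powr (1 + b)"
        using second_moment_ok_count[OF Pn(3) _ u(1) Pn(6)] ab by linarith
      also have "\<dots> \<le> 8 * 2 ^ ?d * (3 * ln r) powr (1 + b)"
        using nle elim(2) ab by (intro mult_left_mono powr_mono2) auto
      also have "\<dots> = C * ln r powr (1 + b)" using r by (simp add: C_def powr_mult)
      also have "\<dots> \<le> C * ln r powr (1 + \<epsilon>)"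
        using r ab by (intro mult_left_mono powr_mono) (auto simp: C_def)
      finally show "real (card {h \<in> ibox (K2 * r). u h \<in> near_int (K3 * \<tau>)}) \<le> C * ln r powr (1 + \<epsilon>)" .
      show "\<forall>h \<in> ibox (K2 * r). h \<noteq> 0 \<longrightarrow> (\<exists>i. h $ i = 0) \<longrightarrow> u h \<notin> near_int (K3 * \<tau>)"
      proof (intro ballI impI)
        fix h :: "real^'d" assume h: "h \<in> ibox (K2 * r)" "h \<noteq> 0" "\<exists>i. h $ i = 0"
        have "(2::real) ^ (n + c) \<le> 2 ^ Suc (n + c)" by simp
        then have "h \<in> ibox (2 ^ Suc (n + c))" using h(1) sub ibox_mono by blast
        then have "u h \<notin> near_int (width ?d b (Suc (n + c)))" using Pn(4) h by (auto simp: faces_ok_def)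
        then show "u h \<notin> near_int (K3 * \<tau>)" using \<tau>le by (rule not_near_int_mono)
      qed
    qed
  qed
  then show ?thesis by blast
qed

section \<open>Density of the projected lattice\<close>

text \<open>Kronecker's theorem for multiples of one basis vector \<open>q\<close>. The
  corresponding column of \<open>A\<close> together with 1 is linearly independent over the
  integers, since a relation with coefficient vector \<open>c\<close> would make
  \<open>(A *v q) \<bullet> c\<close> an integer.\<close>

lemma generic_dense:
  fixes A :: "real^'d^'e"
  assumes gen: "\<And>c q. c \<in> intvec - {0} \<Longrightarrow> q \<in> intvec \<Longrightarrow> q \<noteq> 0 \<Longrightarrow> (A *v q) \<bullet> c \<notin> \<int>" and \<delta>: "\<delta> > 0"
  shows "\<exists>n\<in>intvec. \<exists>m\<in>intvec. norm (m - A *v n - y) < \<delta>"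
proof -
  define N where "N = CARD('e)"
  obtain e where e: "bij_betw e {..<N} (UNIV :: 'e set)"
    using ex_bij_betw_nat_finite[of "UNIV :: 'e set"] by (auto simp: N_def atLeast0LessThan)
  obtain i0 :: 'd where True by blast
  \<comment> \<open>The value 1 at index \<open>N\<close> accounts for the reduction modulo
    one.\<close>
  define \<theta> where "\<theta> i = (if i < N then A $ (e i) $ i0 else 1)" for i
  define q :: "real^'d" where "q = axis i0 1"
  have Aq: "A *v q = (\<chi> j. A $ j $ i0)"
    by (simp add: q_def matrix_vector_mult_basis column_def)
  have q: "q \<in> intvec" "q \<noteq> 0" by (auto simp: q_def intvec_def axis_def vec_eq_iff)
  have key: "c = 0" if "c \<in> intvec" "(\<Sum>i<N. \<theta> i * c $ e i) \<in> \<int>" for c :: "real^'e"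
  proof (rule ccontr)
    assume "c \<noteq> 0"
    have "(A *v q) \<bullet> c = (\<Sum>j\<in>UNIV. A $ j $ i0 * c $ j)" by (simp add: Aq inner_vec_def)
    also have "\<dots> = (\<Sum>i<N. A $ e i $ i0 * c $ e i)"
      by (rule sum.reindex_bij_betw[OF e, symmetric])
    also have "\<dots> = (\<Sum>i<N. \<theta> i * c $ e i)" by (simp add: \<theta>_def)
    finally show False using gen[of c q] that \<open>c \<noteq> 0\<close> q by auto
  qed
  define ie where "ie = inv_into {..<N} e"
  have ie: "e (ie j) = j" "ie j < N" for j
    using e by (auto simp: ie_def bij_betw_def intro: f_inv_into_f) (metis UNIV_I inv_into_into lessThan_iff)
  have ie': "ie (e i) = i" if "i < N" for i
    using that e by (auto simp: ie_def bij_betw_def)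
  interpret Modules.module "(\<lambda>r x. real_of_int r * x)"
    by (simp add: Modules.module.intro distrib_left mult.commute)
  have coef: "\<forall>i<N. a i = 0" if "(\<Sum>i<N. \<theta> i * of_int (a i)) \<in> \<int>" for a :: "nat \<Rightarrow> int"
  proof -
    define c :: "real^'e" where "c = (\<chi> j. of_int (a (ie j)))"
    have "(\<Sum>i<N. \<theta> i * c $ e i) = (\<Sum>i<N. \<theta> i * of_int (a i))"
      by (intro sum.cong) (auto simp: c_def ie')
    then have "c = 0" using that by (intro key) (auto simp: c_def intvec_def)
    then show ?thesis using ie' by (auto simp: c_def vec_eq_iff) (metis)
  qed
  have sum_single: "(\<Sum>i<N. \<theta> i * of_int (if i = k then b else 0)) = \<theta> k * of_int b" if "k < N" for k b
    using that by (simp add: if_distrib cong: if_cong)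
  \<comment> \<open>Independence is a property of the set of values, so coincidences between indices
    have to be excluded first; a coincidence would itself be an integer relation.\<close>
  have inj: "inj_on \<theta> {..N}"
  proof (rule linorder_inj_onI)
    fix i j assume ij: "i < j" "i \<in> {..N}" "j \<in> {..N}"
    show "\<theta> i \<noteq> \<theta> j"
    proof
      assume eq: "\<theta> i = \<theta> j"
      show False
      proof (cases "j = N")
        case True
        then have "\<theta> i = 1" using eq by (simp add: \<theta>_def)
        then have "(\<Sum>k<N. \<theta> k * of_int (if k = i then 1 else 0)) \<in> \<int>" using ij True by (subst sum_single) auto
        from coef[OF this] show False using ij True by auto
      next
        case False
        then have "j < N" using ij by auto
        have "(\<Sum>k<N. \<theta> k * of_int ((if k = i then 1 else 0) - (if k = j then 1 else 0))) 
           = (\<Sum>k<N. \<theta> k * of_int (if k = i then 1 else 0)) - (\<Sum>k<N. \<theta> k * of_int (if k = j then 1 else 0))"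
          by (simp add: right_diff_distrib sum_subtractf)
        also have "\<dots> = 0" using ij \<open>j < N\<close> eq by (subst (1 2) sum_single) auto
        finally have "(\<Sum>k<N. \<theta> k * of_int ((if k = i then 1 else 0) - (if k = j then 1 else 0))) \<in> \<int>" by simp
        from coef[OF this] show False using ij \<open>j < N\<close> by auto
      qed
    qed
  qed auto
  have indep: "independent (\<theta> ` {..N})"
  proof
    assume "dependent (\<theta> ` {..N})"
    then obtain t u where t: "finite t" "t \<subseteq> \<theta> ` {..N}" "(\<Sum>v\<in>t. of_int (u v) * v) = 0" "\<exists>v\<in>t. u v \<noteq> 0"
      unfolding dependent_explicit by blast
    define a where "a i = (if \<theta> i \<in> t then u (\<theta> i) else 0)" for i
    have "(\<Sum>i\<le>N. \<theta> i * of_int (a i)) = (\<Sum>v\<in>\<theta> ` {..N}. v * of_int (if v \<in> t then u v else 0))"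
      by (simp only: sum.reindex[OF inj] o_def a_def)
    also have "\<dots> = (\<Sum>v\<in>t. v * of_int (if v \<in> t then u v else 0))"
      using t by (intro sum.mono_neutral_right) auto
    also have "\<dots> = (\<Sum>v\<in>t. of_int (u v) * v)" by (intro sum.cong) auto
    finally have s0: "(\<Sum>i<N. \<theta> i * of_int (a i)) + of_int (a N) = 0"
      using t(3) by (simp add: lessThan_Suc_atMost[symmetric] \<theta>_def)
    then have "(\<Sum>i<N. \<theta> i * of_int (a i)) = of_int (- a N)" by simp
    then have "(\<Sum>i<N. \<theta> i * of_int (a i)) \<in> \<int>" by (metis Ints_of_int)
    from coef[OF this] have z: "a i = 0" if "i < N" for i using that by blast
    then have "a N = 0" using s0 by simp
    then have "a i = 0" if "i \<le> N" for i using z that by (cases "i = N") auto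
    moreover obtain w where w: "w \<in> t" "u w \<noteq> 0" using t(4) by blast
    moreover obtain i where "i \<le> N" "w = \<theta> i" using w(1) t(2) by blast
    ultimately show False unfolding a_def by metis
  qed
  define \<eta> where "\<eta> = \<delta> / (2 * real N)"
  have N: "N > 0" by (simp add: N_def)
  have \<eta>: "\<eta> > 0" using \<delta> N by (simp add: \<eta>_def)
  obtain k m where km: "\<And>i. i < N \<Longrightarrow> \<bar>of_int k * \<theta> i - of_int (m i) - y $ e i\<bar> < \<eta>"
    using Kronecker_thm_2[of \<theta> N \<eta> "\<lambda>i. y $ e i"] indep inj \<eta> by (auto simp: \<theta>_def)
  \<comment> \<open>Kronecker approximates \<open>y\<close> by multiples of the column minus
    integers, while the goal has \<open>A *v n\<close> with a minus sign; hence both signs are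
    reversed.\<close>
  define n where "n = - (of_int k *\<^sub>R q)"
  define m' :: "real^'e" where "m' = (\<chi> j. - of_int (m (ie j)))"
  have comp: "\<bar>(m' - A *v n - y) $ j\<bar> < \<eta>" for j
    using km[of "ie j"] ie[of j] 
    by (simp add: m'_def n_def matrix_vector_mult_scaleR Aq \<theta>_def linear_neg[OF matrix_vector_mul_linear])
  have "norm (m' - A *v n - y) \<le> (\<Sum>j\<in>UNIV. \<bar>(m' - A *v n - y) $ j\<bar>)" by (rule norm_le_l1_cart)
  also have "\<dots> \<le> (\<Sum>j\<in>(UNIV::'e set). \<eta>)" using comp by (intro sum_mono less_imp_le) auto
  also have "\<dots> < \<delta>" using N \<delta> by (simp add: \<eta>_def N_def)
  finally have "norm (m' - A *v n - y) < \<delta>" .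
  moreover have "n \<in> intvec" "m' \<in> intvec" using q by (auto simp: n_def m'_def intvec_def)
  ultimately show ?thesis by blast
qed

text \<open>Modulo \<open>E\<close> a point is represented by its projection to \<open>F\<close>,
  where \<open>Zk\<close> becomes the set of all \<open>m - A *v n\<close>.\<close>

lemma totally_irrational_generic:
  fixes A :: "real^'d^'e"
  assumes gen: "\<And>c q. c \<in> intvec - {0} \<Longrightarrow> q \<in> intvec \<Longrightarrow> q \<noteq> 0 \<Longrightarrow> (A *v q) \<bullet> c \<notin> \<int>"
  shows "totally_irrational A"
  unfolding totally_irrational_def
proof (intro set_eqI iffI)
  fix p :: "('d, 'e) pt"
  show "p \<in> closure {u + z |u z. u \<in> graphE A \<and> z \<in> Zk}"
    unfolding closure_approachable
  proof (intro allI impI)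
    fix \<delta> :: real assume "\<delta> > 0"
    then obtain n m where nm: "n \<in> intvec" "m \<in> intvec" "norm (m - A *v n - (snd p - A *v fst p)) < \<delta>"
      using generic_dense[OF gen] by blast
    define z where "z = ((fst p - n, A *v (fst p - n)) + (n, m) :: ('d, 'e) pt)"
    have "z \<in> {u + z |u z. u \<in> graphE A \<and> z \<in> Zk}"
      using nm unfolding z_def graphE_def Zk_def intvec_def by fastforce
    moreover have "z - p = (0, m - A *v n - (snd p - A *v fst p))"
      by (simp add: z_def prod_eq_iff matrix_vector_mult_diff_distrib)
    then have "dist z p < \<delta>" using nm by (simp add: dist_norm norm_Pair)
    ultimately show "\<exists>y\<in>{u + z |u z. u \<in> graphE A \<and> z \<in> Zk}. dist y p < \<delta>" by blast
  qed
qed auto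

section \<open>Window coordinates\<close>

lemma subspace_graphE: "subspace (graphE A)"
proof -
  have "graphE A = range (\<lambda>x. (x, A *v x))" by (auto simp: graphE_def)
  moreover have "linear (\<lambda>x. (x, A *v x))"
    by (auto intro!: linearI simp: matrix_vector_right_distrib matrix_vector_mult_scaleR)
  ultimately show ?thesis by (metis linear_subspace_image subspace_UNIV)
qed

lemma subspace_Fsp: "subspace Fsp"
  by (auto simp: subspace_def Fsp_def)

lemma proj_along_unique:
  assumes U: "subspace U" and V: "subspace V" and UV: "U \<inter> V = {0}" and u: "u \<in> U" "z - u \<in> V"
  shows "proj_along U V z = u"
  unfolding proj_along_def
proof (rule the_equality)
  fix u' assume u': "u' \<in> U \<and> z - u' \<in> V"
  have "u - u' \<in> U" using u u' U by (auto intro: subspace_diff)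
  moreover have "(z - u') - (z - u) \<in> V" using subspace_diff[OF V _ u(2)] u' by blast
  then have "u - u' \<in> V" by simp
  ultimately have "u - u' \<in> {0}" unfolding UV[symmetric] by (rule IntI)
  then show "u' = u" by simp
qed (use u in auto)

lemma graphE_Int_Fsp: "graphE A \<inter> Fsp = {0}"
  by (auto simp: graphE_def Fsp_def zero_prod_def)

lemma proj_along_Fsp_graphE: "proj_along Fsp (graphE A) z = (0, snd z - A *v fst z)"
  using graphE_Int_Fsp[of A]
  by (intro proj_along_unique subspace_Fsp subspace_graphE) (auto simp: Fsp_def graphE_def prod_eq_iff)

lemma proj_along_graphE_Fsp: "proj_along (graphE A) Fsp z = (fst z, A *v fst z)"
  using graphE_Int_Fsp[of A]
  by (intro proj_along_unique subspace_Fsp subspace_graphE) (auto simp: Fsp_def graphE_def prod_eq_iff)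

lemma Zk_iff: "z \<in> Zk \<longleftrightarrow> fst z \<in> intvec \<and> snd z \<in> intvec"
  by (auto simp: Zk_def intvec_def)

lemma Zk_add: "y \<in> Zk \<Longrightarrow> z \<in> Zk \<Longrightarrow> y + z \<in> Zk"
  and Zk_diff: "y \<in> Zk \<Longrightarrow> z \<in> Zk \<Longrightarrow> y - z \<in> Zk"
  and Zk_minus: "z \<in> Zk \<Longrightarrow> - z \<in> Zk"
  by (auto simp: Zk_iff intvec_add intvec_diff intvec_minus)

lemma Zk_sum: "(\<And>i. i \<in> I \<Longrightarrow> f i \<in> Zk) \<Longrightarrow> sum f I \<in> Zk"
proof (induction I rule: infinite_finite_induct)
  case (insert x F)
  then show ?case by (simp add: Zk_add)
qed (auto simp: Zk_iff intvec_0)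

lemma shifted_lattice_add: "z \<in> shifted_lattice s \<Longrightarrow> u \<in> Zk \<Longrightarrow> z + u \<in> shifted_lattice s"
  unfolding shifted_lattice_def by (auto intro!: image_eqI[of _ _ "_ + u"] Zk_add)

lemma shifted_lattice_diff: "z \<in> shifted_lattice s \<Longrightarrow> y \<in> shifted_lattice s \<Longrightarrow> z - y \<in> Zk"
proof -
  assume "z \<in> shifted_lattice s" "y \<in> shifted_lattice s"
  then obtain z' y' where "z = z' + s" "z' \<in> Zk" "y = y' + s" "y' \<in> Zk"
    unfolding shifted_lattice_def by (elim imageE)
  moreover have "(z' + s) - (y' + s) = z' - y'" by (rule add_diff_cancel_right)
  ultimately show ?thesis using Zk_diff[of z' y'] by (simp only:)
qed

lemma det_Ints: 
  fixes M :: "real^'n^'n"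
  assumes "\<And>i j. M $ i $ j \<in> \<int>" shows "det M \<in> \<int>"
  unfolding det_def using assms by (intro Ints_sum Ints_mult Ints_prod) auto

text \<open>Density of the projected lattice is assumed in the form in which genericity of
  \<open>A\<close> delivers it, which separates the study of frequencies from measure
  theory.\<close>

locale cut_project =
  fixes A :: "real^'d::finite^'e::finite" and F0 :: "('d, 'e) pt set" and v :: "'e \<Rightarrow> real^'e" and s :: "('d, 'e) pt"
  assumes F0: "admissible_F0 A F0"
    and v_int: "v j \<in> intvec" and v_inj: "inj v" and v_indep: "independent (range v)"
    and dense: "\<delta> > 0 \<Longrightarrow> \<exists>n\<in>intvec. \<exists>m\<in>intvec. norm (m - A *v n - y) < \<delta>"
    and reg: "regular A {(0, \<Sum>j\<in>UNIV. t j *\<^sub>R v j) | t. \<forall>j. 0 \<le> t j \<and> t j \<le> (1::real)} s"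
begin

definition "W = {(0 :: real^'d, \<Sum>j\<in>UNIV. t j *\<^sub>R v j) | t. \<forall>j. 0 \<le> t j \<and> t j \<le> (1::real)}"

definition "V = (\<chi> i j. v j $ i)"

definition "coord y = matrix_inv V *v y"

text \<open>The projection to \<open>F\<close> along \<open>E\<close> in the basis of the
  generators: the window becomes the unit cube, and translation by a generator becomes an integer
  shift.\<close>

definition "ell z = coord (snd z - A *v fst z)"

definition "\<pi>1 = proj_along (graphE A) F0"

lemma V_mult: "V *v t = (\<Sum>j\<in>UNIV. t $ j *\<^sub>R v j)"
  by (simp add: V_def matrix_vector_mult_def vec_eq_iff sum_component mult.commute)

lemma invertible_V: "invertible V"
proof -
  have "x = 0" if "V *v x = 0" for x
  proof -
    have "(\<Sum>w\<in>range v. x $ (inv v w) *\<^sub>R w) = (\<Sum>j\<in>UNIV. x $ j *\<^sub>R v j)"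
      by (subst sum.reindex[OF v_inj]) (simp add: inv_f_f[OF v_inj])
    then have "(\<Sum>w\<in>range v. x $ (inv v w) *\<^sub>R w) = 0" using that by (simp add: V_mult)
    then have "\<forall>w\<in>range v. x $ (inv v w) = 0" 
      by (intro ballI independentD[OF v_indep finite_imageI[OF finite] subset_refl]) auto
    then show ?thesis by (auto simp: vec_eq_iff inv_f_f[OF v_inj])
  qed
  then show ?thesis
    unfolding invertible_left_inverse matrix_left_invertible_ker by blast
qed

lemma matrix_inv_V: "matrix_inv V ** V = mat 1" "V ** matrix_inv V = mat 1"
  using someI_ex[OF invertible_V[unfolded invertible_def]] by (auto simp: matrix_inv_def)

lemma coord_V [simp]: "coord (V *v t) = t"
  using matrix_inv_V by (simp add: coord_def matrix_vector_mul_assoc)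

lemma V_coord [simp]: "V *v coord y = y"
  using matrix_inv_V by (simp add: coord_def matrix_vector_mul_assoc)

lemma linear_coord: "linear coord"
  unfolding coord_def by (rule matrix_vector_mul_linear)

lemma linear_ell: "linear ell"
proof -
  have "linear (\<lambda>z :: ('d, 'e) pt. snd z - A *v fst z)"
    by (auto intro!: linearI simp: matrix_vector_right_distrib matrix_vector_mult_scaleR algebra_simps)
  then have "linear (coord \<circ> (\<lambda>z. snd z - A *v fst z))" by (rule linear_compose[OF _ linear_coord])
  then show ?thesis by (simp add: ell_def[abs_def] o_def)
qed

lemmas ell_add = linear_add[OF linear_ell] and ell_diff = linear_diff[OF linear_ell]

definition "period j = (0 :: real^'d, v j)"

lemma period_Zk: "period j \<in> Zk"
  using v_int by (simp add: period_def Zk_iff intvec_0)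

lemma ell_V: "ell (0, V *v t) = t"
  by (simp add: ell_def)

lemma ell_period: "ell (period j) = axis j 1"
proof -
  have "v j = V *v axis j 1" 
    by (simp add: V_def matrix_vector_mult_basis column_def vec_eq_iff)
  then show ?thesis by (simp add: period_def ell_V)
qed

definition "shift g = (\<Sum>j\<in>UNIV. of_int (g j) *\<^sub>R period j)" for g :: "'e \<Rightarrow> int"

text \<open>The tiling of \<open>F\<close> by the window: by a suitable choice of \<open>g\<close>
  every lattice point is moved into the window without changing its first component.\<close>

lemma shift: "shift g \<in> Zk" "fst (shift g) = 0" "ell (shift g) = (\<chi> j. of_int (g j))"
proof -
  have "of_int k *\<^sub>R period j \<in> Zk" for k :: int and j
    using period_Zk[of j] by (auto simp: Zk_def)
  then show "shift g \<in> Zk" unfolding shift_def by (intro Zk_sum) auto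
  show "fst (shift g) = 0" by (simp add: shift_def period_def fst_sum)
  have "ell (shift g) = (\<Sum>j\<in>UNIV. of_int (g j) *\<^sub>R axis j 1)"
    unfolding shift_def by (simp add: linear_sum[OF linear_ell] linear_scale[OF linear_ell] ell_period)
  then show "ell (shift g) = (\<chi> j. of_int (g j))"
    by (simp add: vec_eq_iff sum_component axis_def if_distrib cong: if_cong)
qed

lemma strip_iff: "z \<in> strip A W \<longleftrightarrow> (\<forall>j. 0 \<le> ell z $ j \<and> ell z $ j \<le> 1)"
proof -
  have "z \<in> strip A W \<longleftrightarrow> (\<exists>t. snd z - A *v fst z = V *v t \<and> (\<forall>j. 0 \<le> t $ j \<and> t $ j \<le> 1))"
  proof -
    have "(\<exists>t. snd z - A *v fst z = (\<Sum>j\<in>UNIV. t j *\<^sub>R v j) \<and> (\<forall>j. 0 \<le> t j \<and> t j \<le> 1)) \<longleftrightarrow>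
      (\<exists>t. snd z - A *v fst z = V *v t \<and> (\<forall>j. 0 \<le> t $ j \<and> t $ j \<le> 1))" (is "?l = ?r")
    proof
      assume ?l
      then obtain t where "snd z - A *v fst z = (\<Sum>j\<in>UNIV. t j *\<^sub>R v j)" "\<forall>j. 0 \<le> t j \<and> t j \<le> 1" by blast
      then show ?r by (intro exI[of _ "\<chi> j. t j"]) (simp add: V_mult)
    qed (auto simp: V_mult)
    then show ?thesis by (auto simp: strip_def W_def proj_along_Fsp_graphE)
  qed
  also have "\<dots> \<longleftrightarrow> (\<forall>j. 0 \<le> ell z $ j \<and> ell z $ j \<le> 1)"
    by (metis ell_def coord_V V_coord)
  finally show ?thesis .
qed

text \<open>A displacement along period \<open>j\<close>, downwards at coordinate 0 and upwards at
  coordinate 1, leaves the strip however short it is.\<close>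

lemma ell_boundary_frontier:
  assumes z: "z \<in> strip A W" and j: "ell z $ j = 0 \<or> ell z $ j = 1"
  shows "z \<in> frontier (strip A W)"
proof -
  have "z \<notin> interior (strip A W)"
  proof
    assume "z \<in> interior (strip A W)"
    then obtain e where e: "e > 0" "ball z e \<subseteq> strip A W" by (meson mem_interior)
    define \<sigma> :: real where "\<sigma> = (if ell z $ j = 0 then -1 else 1)"
    define w where "w = (\<sigma> * (e / (2 * (norm (period j) + 1)))) *\<^sub>R period j"
    have np: "norm (period j) + 1 > 0" by (smt (verit) norm_ge_zero)
    have "norm w = e * (norm (period j) / (2 * (norm (period j) + 1)))"
      using e np by (simp add: w_def abs_mult \<sigma>_def)
    also have "\<dots> < e * 1" using e np by (intro mult_strict_left_mono) (auto simp: field_simps)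
    finally have "z + w \<in> ball z e" by (simp add: dist_norm)
    then have "z + w \<in> strip A W" using e by blast
    then have "0 \<le> ell (z + w) $ j" "ell (z + w) $ j \<le> 1" by (auto simp: strip_iff)
    moreover have "ell (z + w) $ j = ell z $ j + \<sigma> * (e / (2 * (norm (period j) + 1)))"
      by (simp add: ell_add w_def linear_scale[OF linear_ell] ell_period)
    moreover have "e / (2 * (norm (period j) + 1)) > 0" using e np by simp
    ultimately show False using j by (auto simp: \<sigma>_def split: if_splits)
  qed
  then show ?thesis using z closure_subset by (auto simp: frontier_def)
qed

text \<open>Regularity speaks only about the boundary of the strip. Periods bring any lattice point
  into the strip with fractional parts as coordinates, and a vanishing coordinate would then be a
  boundary point.\<close>

lemma ell_regular:
  assumes z: "z \<in> shifted_lattice s"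
  shows "ell z $ j \<noteq> 0"
proof
  assume *: "ell z $ j = 0"
  define g where "g k = - \<lfloor>ell z $ k\<rfloor>" for k
  define y where "y = z + shift g"
  have y: "ell y $ k = frac (ell z $ k)" for k
    by (simp add: y_def ell_add shift g_def frac_def)
  have "y \<in> strip A W" by (auto simp: strip_iff y less_imp_le[OF frac_lt_1])
  moreover have "ell y $ j = 0" by (simp add: y *)
  ultimately have "y \<in> frontier (strip A W)" using ell_boundary_frontier by blast
  moreover have "y \<in> shifted_lattice s" unfolding y_def by (intro shifted_lattice_add z shift)
  ultimately show False using reg by (auto simp: regular_def W_def)
qed

text \<open>By Cramer's rule \<open>det V\<close> is a common denominator of the inverse of
  \<open>V\<close>. Up to the factor \<open>D\<close>, each coordinate is thus given by an integer
  vector \<open>c\<close>, to which genericity of \<open>A\<close> applies.\<close>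

lemma ell_integral_form:
  "\<exists>D::nat. D > 0 \<and> (\<forall>j. \<exists>c\<in>intvec - {0}. \<forall>z. real D * ell z $ j = c \<bullet> snd z - (A *v fst z) \<bullet> c)"
proof -
  have Vint: "V $ i $ j \<in> \<int>" for i j using v_int[of j] by (simp add: V_def intvec_def)
  have det0: "det V \<noteq> 0" using invertible_V invertible_det_nz by blast
  have "\<bar>det V\<bar> \<in> \<nat>" using det_Ints[OF Vint] by (metis Ints_cases Nats_altdef2 abs_ge_zero Ints_abs mem_Collect_eq)
  then obtain D :: nat where D: "\<bar>det V\<bar> = real D" by (auto elim: Nats_cases)
  have "D > 0" using D det0 by (cases "D = 0") auto
  moreover have "\<exists>c\<in>intvec - {0}. \<forall>z. real D * ell z $ j = c \<bullet> snd z - (A *v fst z) \<bullet> c" for j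
  proof -
    define c where "c = (\<chi> k. real D * coord (axis k 1) $ j)"
    have cform: "real D * coord y $ j = c \<bullet> y" for y
    proof -
      have "y = (\<Sum>k\<in>UNIV. y $ k *\<^sub>R axis k 1)"
        by (simp add: vec_eq_iff sum_component axis_def if_distrib cong: if_cong)
      then have "coord y $ j = (\<Sum>k\<in>UNIV. y $ k *\<^sub>R coord (axis k 1)) $ j"
        by (metis (no_types, lifting) linear_coord linear_sum linear_scale sum.cong)
      also have "\<dots> = (\<Sum>k\<in>UNIV. y $ k * coord (axis k 1) $ j)" by (simp add: sum_component)
      finally show ?thesis by (simp add: c_def inner_vec_def sum_distrib_left mult_ac)
    qed
    have "c $ k \<in> \<int>" for k
    proof -
      let ?B = "\<chi> a b. if b = j then axis k 1 $ a else V $ a $ b"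
      have "coord (axis k 1) = (\<chi> j. det (\<chi> a b. if b = j then axis k 1 $ a else V $ a $ b) / det V)"
        using cramer[OF det0, of "coord (axis k 1)" "axis k 1"] by simp
      then have "coord (axis k 1) $ j = det ?B / det V" by simp
      then have "c $ k = \<bar>det V\<bar> * (det ?B / det V)" by (simp add: c_def D)
      also have "\<dots> = sgn (det V) * det ?B" using det0 by (simp add: sgn_if)
      also have "\<dots> \<in> \<int>" using Vint by (intro Ints_mult det_Ints) (auto simp: sgn_if axis_def)
      finally show ?thesis .
    qed
    then have "c \<in> intvec" by (simp add: intvec_def)
    moreover have "c \<noteq> 0"
    proof
      assume "c = 0"
      then have "real D * coord (V *v axis j 1) $ j = 0"
        using cform[of "V *v axis j 1"] by (simp del: coord_V)
      then have "real D * axis j 1 $ j = (0 :: real)" unfolding coord_V .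
      then show False using \<open>D > 0\<close> by simp
    qed
    moreover have "real D * ell z $ j = c \<bullet> snd z - (A *v fst z) \<bullet> c" for z
      by (simp add: ell_def cform inner_diff_right inner_commute)
    ultimately show ?thesis by blast
  qed
  ultimately show ?thesis by blast
qed

section \<open>The projection along \<open>F0\<close>\<close>

lemma F0_facts: "subspace F0" "graphE A \<inter> F0 = {0}" "F0 \<inter> Zk = {0}" 
  "\<exists>u v. u \<in> graphE A \<and> v \<in> F0 \<and> z = u + v"
proof -
  note F = F0[unfolded admissible_F0_def]
  show "subspace F0" using F by (rule conjunct1)
  show "graphE A \<inter> F0 = {0}" using F[THEN conjunct2] by (rule conjunct1)
  show "F0 \<inter> Zk = {0}" using F[THEN conjunct2, THEN conjunct2, THEN conjunct2] .
  show "\<exists>u v. u \<in> graphE A \<and> v \<in> F0 \<and> z = u + v"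
    using F[THEN conjunct2, THEN conjunct2, THEN conjunct1] by (rule spec)
qed

lemma \<pi>1_unique: "u \<in> graphE A \<Longrightarrow> z - u \<in> F0 \<Longrightarrow> \<pi>1 z = u"
  unfolding \<pi>1_def by (intro proj_along_unique subspace_graphE F0_facts)

lemma \<pi>1: "\<pi>1 z \<in> graphE A" "z - \<pi>1 z \<in> F0"
proof -
  obtain u w where uw: "u \<in> graphE A" "w \<in> F0" "z = u + w" using F0_facts(4)[of z] by blast
  then have "z - u \<in> F0" by (simp only: add_diff_cancel_left')
  with uw(1) have eq: "\<pi>1 z = u" by (rule \<pi>1_unique)
  show "\<pi>1 z \<in> graphE A" unfolding eq by (rule uw(1))
  show "z - \<pi>1 z \<in> F0" unfolding eq by fact
qed

lemma linear_\<pi>1: "linear \<pi>1"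
proof (rule linearI)
  fix x y :: "('d, 'e) pt" and c :: real
  note E = subspace_graphE[of A]
  have "(x - \<pi>1 x) + (y - \<pi>1 y) \<in> F0" by (rule subspace_add[OF F0_facts(1) \<pi>1(2) \<pi>1(2)])
  also have "(x - \<pi>1 x) + (y - \<pi>1 y) = (x + y) - (\<pi>1 x + \<pi>1 y)" by simp
  finally show "\<pi>1 (x + y) = \<pi>1 x + \<pi>1 y"
    by (rule \<pi>1_unique[OF subspace_add[OF E \<pi>1(1) \<pi>1(1)]])
  have "c *\<^sub>R (x - \<pi>1 x) \<in> F0" by (rule subspace_scale[OF F0_facts(1) \<pi>1(2)])
  then have "c *\<^sub>R x - c *\<^sub>R \<pi>1 x \<in> F0" by (simp only: scaleR_diff_right)
  then show "\<pi>1 (c *\<^sub>R x) = c *\<^sub>R \<pi>1 x"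
    by (rule \<pi>1_unique[OF subspace_scale[OF E \<pi>1(1)]])
qed

text \<open>Here the condition on \<open>F0 \<inter> Zk\<close> enters. It allows patches to be
  replaced by sets of lattice displacements.\<close>

lemma \<pi>1_inj: "inj_on \<pi>1 Zk"
proof (rule inj_onI)
  fix x y :: "('d, 'e) pt" assume *: "x \<in> Zk" "y \<in> Zk" "\<pi>1 x = \<pi>1 y"
  have "(x - \<pi>1 x) - (y - \<pi>1 y) \<in> F0" by (rule subspace_diff[OF F0_facts(1) \<pi>1(2) \<pi>1(2)])
  also have "(x - \<pi>1 x) - (y - \<pi>1 y) = x - y" using * by simp
  finally have "x - y \<in> F0 \<inter> Zk" by (rule IntI[OF _ Zk_diff[OF *(1,2)]])
  then have "x - y = 0" unfolding F0_facts(3) by (rule singletonD)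
  then show "x = y" by simp
qed

lemma \<pi>1_inj_shifted: "inj_on \<pi>1 (shifted_lattice s)"
proof (rule inj_onI)
  fix x y :: "('d, 'e) pt" assume *: "x \<in> shifted_lattice s" "y \<in> shifted_lattice s" "\<pi>1 x = \<pi>1 y"
  have "\<pi>1 (x - y) = \<pi>1 0" using *(3) by (simp add: linear_diff[OF linear_\<pi>1] linear_0[OF linear_\<pi>1])
  then have "x - y = 0" 
    by (rule inj_onD[OF \<pi>1_inj _ shifted_lattice_diff[OF *(1,2)]]) (simp add: Zk_iff intvec_0)
  then show "x = y" by simp
qed

text \<open>The first component of the discrepancy between the projections to \<open>E\<close> along
  \<open>F0\<close> and along \<open>F\<close>. It depends linearly on \<open>ell\<close> alone,
  hence is bounded on the strip.\<close>

definition "drift t = fst (\<pi>1 (0, V *v t))"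

lemma linear_drift: "linear drift"
proof -
  have "linear (\<lambda>t. (0 :: real^'d, V *v t))"
    by (auto intro!: linearI simp: matrix_vector_right_distrib matrix_vector_mult_scaleR)
  from linear_compose[OF linear_compose[OF this linear_\<pi>1] linear_fst] show ?thesis
    by (simp only: o_def drift_def[abs_def])
qed

lemma \<pi>1_eq: "\<pi>1 z = (fst z + drift (ell z), A *v (fst z + drift (ell z)))"
proof -
  have "z = (fst z, A *v fst z) + (0, V *v ell z)" by (simp add: ell_def prod_eq_iff)
  then have "\<pi>1 z = \<pi>1 ((fst z, A *v fst z) + (0, V *v ell z))" by (rule arg_cong)
  also have "\<dots> = \<pi>1 (fst z, A *v fst z) + \<pi>1 (0, V *v ell z)" by (rule linear_add[OF linear_\<pi>1])
  also have "\<pi>1 (fst z, A *v fst z) = (fst z, A *v fst z)"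
    by (rule \<pi>1_unique) (simp_all add: graphE_def subspace_0[OF F0_facts(1)])
  also have "\<pi>1 (0, V *v ell z) = (drift (ell z), A *v drift (ell z))"
    unfolding drift_def using \<pi>1(1)[of "(0, V *v ell z)"] by (auto simp: graphE_def)
  finally show ?thesis by (simp add: matrix_vector_right_distrib)
qed

end

section \<open>Counting points of a shifted lattice\<close>

lemma unit_cubes_disjoint:
  fixes x y :: "real^'n"
  assumes "x - y \<in> intvec" "x \<noteq> y"
  shows "unit_cube x \<inter> unit_cube y = {}"
proof (rule ccontr)
  assume "unit_cube x \<inter> unit_cube y \<noteq> {}"
  then obtain z where z: "z \<in> unit_cube x" "z \<in> unit_cube y" by blast
  have "x $ i = y $ i" for i
  proof -
    have "axis i 1 \<in> (Basis :: (real^'n) set)" by (simp add: axis_in_Basis_iff)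
    then have "x \<bullet> axis i 1 \<le> z \<bullet> axis i 1" "z \<bullet> axis i 1 < x \<bullet> axis i 1 + 1"
       "y \<bullet> axis i 1 \<le> z \<bullet> axis i 1" "z \<bullet> axis i 1 < y \<bullet> axis i 1 + 1"
      using z unfolding unit_cube_def by blast+
    then have "x $ i \<le> z $ i" "z $ i < x $ i + 1" "y $ i \<le> z $ i" "z $ i < y $ i + 1"
      by (simp_all add: inner_axis)
    then have "\<bar>x $ i - y $ i\<bar> < 1" by linarith
    moreover have "x $ i - y $ i \<in> \<int>" using assms(1) by (simp add: intvec_def)
    ultimately show ?thesis using Ints_nonzero_abs_less1 by fastforce
  qed
  then show False using assms(2) by (simp add: vec_eq_iff)
qed

lemma measure_union_unit_cubes:
  fixes X :: "(real^'n) set"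
  assumes X: "finite X" "\<And>x y. x \<in> X \<Longrightarrow> y \<in> X \<Longrightarrow> x - y \<in> intvec"
  shows "(\<Union>x\<in>X. unit_cube x) \<in> lmeasurable" "measure lebesgue (\<Union>x\<in>X. unit_cube x) = real (card X)"
proof -
  have 1: "unit_cube x \<in> lmeasurable" "measure lebesgue (unit_cube x) = 1" for x :: "real^'n"
    using emeasure_unit_cube[of x] by (auto simp: fmeasurable_def measure_def)
  show "(\<Union>x\<in>X. unit_cube x) \<in> lmeasurable" using X(1) 1 by (intro fmeasurable.finite_UN) auto
  have "measure lebesgue (\<Union>x\<in>X. unit_cube x) = (\<Sum>x\<in>X. measure lebesgue (unit_cube x))"
  proof (rule measure_negligible_finite_Union_image[OF X(1)])
    show "pairwise (\<lambda>x y. negligible (unit_cube x \<inter> unit_cube y)) X"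
      using X(2) by (auto simp: pairwise_def unit_cubes_disjoint)
  qed (use 1 in auto)
  then show "measure lebesgue (\<Union>x\<in>X. unit_cube x) = real (card X)" by (simp add: 1)
qed

lemma exists_unit_cube:
  fixes y \<sigma> :: "real^'n"
  obtains x where "x - \<sigma> \<in> intvec" "y \<in> unit_cube x"
proof -
  define x where "x = (\<chi> i. \<sigma> $ i + of_int \<lfloor>y $ i - \<sigma> $ i\<rfloor>)"
  have "x - \<sigma> \<in> intvec" by (simp add: x_def intvec_def)
  moreover have "x \<bullet> b \<le> y \<bullet> b \<and> y \<bullet> b < x \<bullet> b + 1" if b: "b \<in> Basis" for b
  proof -
    obtain i where "b = axis i 1" using b by (auto simp: Basis_vec_def Basis_real_def)
    moreover have "x $ i \<le> y $ i" "y $ i < x $ i + 1" unfolding x_def by (simp; linarith)+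
    ultimately show ?thesis by (simp add: inner_axis)
  qed
  then have "y \<in> unit_cube x" by (simp add: unit_cube_def)
  ultimately show thesis by (rule that)
qed

lemma unit_cube_norm:
  fixes x :: "real^'n"
  assumes "y \<in> unit_cube x"
  shows "norm (y - x) \<le> real CARD('n)"
proof -
  have "\<bar>(y - x) $ i\<bar> \<le> 1" for i
  proof -
    have "axis i 1 \<in> (Basis :: (real^'n) set)" by (simp add: axis_in_Basis_iff)
    then have "x \<bullet> axis i 1 \<le> y \<bullet> axis i 1" "y \<bullet> axis i 1 < x \<bullet> axis i 1 + 1"
      using assms unfolding unit_cube_def by blast+
    then show ?thesis by (simp add: inner_axis)
  qed
  then have "(\<Sum>i\<in>UNIV. \<bar>(y - x) $ i\<bar>) \<le> (\<Sum>i\<in>(UNIV::'n set). 1)" by (intro sum_mono)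
  then show ?thesis using norm_le_l1_cart[of "y - x"] by simp
qed

locale seminorm_ball =
  fixes f :: "real^'n \<Rightarrow> real" and k c :: real and \<sigma> :: "real^'n"
  assumes f_add: "f (x + y) \<le> f x + f y" and f_scale: "f (t *\<^sub>R x) = \<bar>t\<bar> * f x"
    and f_cont: "continuous_on UNIV f"
    and k: "k > 0" "k * norm x \<le> f x" and c: "f x \<le> c * norm x"
begin

definition "\<Sigma> = {x. x - \<sigma> \<in> intvec}"
definition "K R = {x. f x \<le> R}"
definition "\<omega> = measure lebesgue (K 1)"
definition "\<gamma> = c * real CARD('n)"

lemma f_nonneg: "0 \<le> f x"
  using k(2)[of x] k(1) by (smt (verit) mult_nonneg_nonneg norm_ge_zero)

lemma c_nonneg: "0 \<le> c"
proof -
  obtain x :: "real^'n" where "norm x = 1" by (meson vector_choose_size zero_le_one)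
  then show ?thesis using c[of x] f_nonneg[of x] by simp
qed

lemma \<gamma>_nonneg: "0 \<le> \<gamma>" using c_nonneg by (simp add: \<gamma>_def)

lemma f_unit_cube: 
  assumes "y \<in> unit_cube x" shows "f y \<le> f x + \<gamma>" "f x \<le> f y + \<gamma>"
proof -
  have *: "f z \<le> \<gamma>" if "norm z \<le> real CARD('n)" for z
    using c[of z] mult_left_mono[OF that c_nonneg] by (simp add: \<gamma>_def)
  show "f y \<le> f x + \<gamma>" using f_add[of x "y - x"] *[of "y - x"] unit_cube_norm[OF assms] by simp
  show "f x \<le> f y + \<gamma>" using f_add[of y "x - y"] *[of "x - y"] unit_cube_norm[OF assms] by (simp add: norm_minus_commute)
qed

lemma K_measurable: "K R \<in> lmeasurable"
proof -
  have "closed (K R)" unfolding K_def by (intro closed_Collect_le f_cont continuous_intros)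
  moreover have "bounded (K R)"
  proof (rule boundedI)
    fix x assume "x \<in> K R"
    then have "k * norm x \<le> R" using k(2)[of x] by (simp add: K_def)
    then show "norm x \<le> R / k" using k(1) by (simp add: field_simps)
  qed
  ultimately show ?thesis by (intro lmeasurable_compact) (simp add: compact_eq_bounded_closed)
qed

lemma measure_K: "R > 0 \<Longrightarrow> measure lebesgue (K R) = R ^ CARD('n) * \<omega>"
proof -
  assume R: "R > 0"
  have "K R = (\<lambda>x. R *\<^sub>R x + 0) ` K 1"
  proof (intro set_eqI iffI)
    fix x assume "x \<in> K R"
    then have "f ((1/R) *\<^sub>R x) \<le> 1" using R by (simp only: f_scale) (simp add: K_def field_simps)
    then show "x \<in> (\<lambda>x. R *\<^sub>R x + 0) ` K 1"
      using R by (intro image_eqI[of _ _ "(1/R) *\<^sub>R x"]) (auto simp: K_def)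
  next
    fix x assume "x \<in> (\<lambda>x. R *\<^sub>R x + 0) ` K 1"
    then show "x \<in> K R" using R by (auto simp: K_def f_scale)
  qed
  then show ?thesis using measure_lebesgue_affine[of R 0 "K 1"] R by (simp add: \<omega>_def)
qed

lemma \<omega>_pos: "\<omega> > 0"
proof -
  have "ball 0 (1 / (c + 1)) \<subseteq> K 1"
  proof
    fix x :: "real^'n" assume "x \<in> ball 0 (1 / (c + 1))"
    then have "norm x * (c + 1) \<le> 1" using c_nonneg by (simp add: field_simps)
    moreover have "c * norm x \<le> norm x * (c + 1)" by (simp add: algebra_simps)
    ultimately show "x \<in> K 1" using c[of x] by (simp add: K_def)
  qed
  then have "measure lebesgue (ball (0 :: real^'n) (1 / (c + 1))) \<le> \<omega>"
    unfolding \<omega>_def by (intro measure_mono_fmeasurable K_measurable) auto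
  moreover have "measure lebesgue (ball (0 :: real^'n) (1 / (c + 1))) > 0"
    using c_nonneg by (simp add: content_ball_pos)
  ultimately show ?thesis by linarith
qed

lemma \<Sigma>_diff: "x \<in> \<Sigma> \<Longrightarrow> y \<in> \<Sigma> \<Longrightarrow> x - y \<in> intvec"
  using intvec_diff[of "x - \<sigma>" "y - \<sigma>"] by (simp add: \<Sigma>_def)

lemma finite_\<Sigma>: "finite {x \<in> \<Sigma>. f x \<le> R}"
proof -
  have "{x \<in> \<Sigma>. f x \<le> R} \<subseteq> (+) \<sigma> ` ibox (R / k + norm \<sigma>)"
  proof
    fix x assume x: "x \<in> {x \<in> \<Sigma>. f x \<le> R}"
    have "norm x \<le> R / k" using k(1) k(2)[of x] x by (simp add: pos_le_divide_eq mult.commute)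
    then have "norm (x - \<sigma>) \<le> R / k + norm \<sigma>" using norm_triangle_ineq4[of x \<sigma>] by linarith
    then have "\<bar>(x - \<sigma>) $ i\<bar> \<le> R / k + norm \<sigma>" for i using component_le_norm_cart[of "x - \<sigma>" i] by linarith
    then have "x - \<sigma> \<in> ibox (R / k + norm \<sigma>)" using x by (auto simp: ibox_def \<Sigma>_def)
    then show "x \<in> (+) \<sigma> ` ibox (R / k + norm \<sigma>)" by (intro image_eqI[of _ _ "x - \<sigma>"]) auto
  qed
  then show ?thesis using finite_ibox finite_subset by blast
qed

lemma card_ball_ge: 
  assumes "R > \<gamma>" shows "(R - \<gamma>) ^ CARD('n) * \<omega> \<le> real (card {x \<in> \<Sigma>. f x \<le> R})"
proof -
  let ?X = "{x \<in> \<Sigma>. f x \<le> R}"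
  have "K (R - \<gamma>) \<subseteq> (\<Union>x\<in>?X. unit_cube x)"
  proof
    fix y assume y: "y \<in> K (R - \<gamma>)"
    obtain x where x: "x - \<sigma> \<in> intvec" "y \<in> unit_cube x" by (rule exists_unit_cube)
    then have "f x \<le> R" using y f_unit_cube(2)[OF x(2)] by (simp add: K_def)
    then show "y \<in> (\<Union>x\<in>?X. unit_cube x)" using x by (auto simp: \<Sigma>_def)
  qed
  then have "measure lebesgue (K (R - \<gamma>)) \<le> measure lebesgue (\<Union>x\<in>?X. unit_cube x)"
    using finite_\<Sigma> \<Sigma>_diff K_measurable by (intro measure_mono_fmeasurable measure_union_unit_cubes) auto
  then show ?thesis using measure_K[of "R - \<gamma>"] assms measure_union_unit_cubes(2)[OF finite_\<Sigma>, of R] \<Sigma>_diff by auto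
qed

lemma card_annulus_le:
  assumes "R1 > \<gamma>" "R1 \<le> R2" 
  shows "real (card {x \<in> \<Sigma>. R1 < f x \<and> f x \<le> R2}) \<le> ((R2 + \<gamma>) ^ CARD('n) - (R1 - \<gamma>) ^ CARD('n)) * \<omega>"
proof -
  let ?X = "{x \<in> \<Sigma>. R1 < f x \<and> f x \<le> R2}"
  have fin: "finite ?X" by (rule finite_subset[OF _ finite_\<Sigma>[of R2]]) auto
  have sub: "(\<Union>x\<in>?X. unit_cube x) \<subseteq> K (R2 + \<gamma>) - K (R1 - \<gamma>)"
    using f_unit_cube by (fastforce simp: K_def)
  have KK: "K (R1 - \<gamma>) \<subseteq> K (R2 + \<gamma>)" using \<gamma>_nonneg assms by (auto simp: K_def)
  have "real (card ?X) = measure lebesgue (\<Union>x\<in>?X. unit_cube x)"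
    using measure_union_unit_cubes(2)[OF fin] \<Sigma>_diff by auto
  also have "\<dots> \<le> measure lebesgue (K (R2 + \<gamma>) - K (R1 - \<gamma>))"
    using sub fin \<Sigma>_diff measure_union_unit_cubes(1)[OF fin] K_measurable by (intro measure_mono_fmeasurable) auto
  also have "\<dots> = measure lebesgue (K (R2 + \<gamma>)) - measure lebesgue (K (R1 - \<gamma>))"
    using KK K_measurable by (intro measurable_measure_Diff) auto
  also have "\<dots> = ((R2 + \<gamma>) ^ CARD('n) - (R1 - \<gamma>) ^ CARD('n)) * \<omega>"
    using assms \<gamma>_nonneg by (simp add: measure_K algebra_simps)
  finally show ?thesis .
qed

text \<open>Volumes are homogeneous in the radius, so the outer and the inner ball have the same
  ratio 1 in the limit. The separate \<open>b'\<close> permits comparison with a ball whose radius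
  is shifted by an unrelated constant.\<close>

lemma annulus_ratio:
  assumes "b \<ge> 0"
  shows "((\<lambda>R. real (card {x \<in> \<Sigma>. R - b < f x \<and> f x \<le> R + b}) / real (card {x \<in> \<Sigma>. f x \<le> R - b'})) \<longlongrightarrow> 0) at_top"
proof -
  let ?d = "CARD('n)"
  define g where "g R = ((R + b + \<gamma>) / (R - b' - \<gamma>)) ^ ?d - ((R - b - \<gamma>) / (R - b' - \<gamma>)) ^ ?d" for R
  have "((\<lambda>R. (R + b + \<gamma>) / (R - b' - \<gamma>)) \<longlongrightarrow> 1) at_top" "((\<lambda>R. (R - b - \<gamma>) / (R - b' - \<gamma>)) \<longlongrightarrow> 1) at_top"
    by real_asymp+
  then have "(g \<longlongrightarrow> 1 ^ ?d - 1 ^ ?d) at_top" unfolding g_def by (intro tendsto_intros)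
  then have g: "(g \<longlongrightarrow> 0) at_top" by simp
  have "\<forall>\<^sub>F R in at_top. norm (real (card {x \<in> \<Sigma>. R - b < f x \<and> f x \<le> R + b}) / real (card {x \<in> \<Sigma>. f x \<le> R - b'})) \<le> g R"
    using eventually_gt_at_top[of "b + \<gamma>"] eventually_gt_at_top[of "b' + \<gamma>"]
  proof eventually_elim
    case (elim R)
    have den: "0 < (R - b' - \<gamma>) ^ ?d * \<omega>" using elim \<omega>_pos by simp
    have den': "(R - b' - \<gamma>) ^ ?d * \<omega> \<le> real (card {x \<in> \<Sigma>. f x \<le> R - b'})"
      using card_ball_ge[of "R - b'"] elim by simp
    have "real (card {x \<in> \<Sigma>. R - b < f x \<and> f x \<le> R + b}) \<le> ((R + b + \<gamma>) ^ ?d - (R - b - \<gamma>) ^ ?d) * \<omega>"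
      using card_annulus_le[of "R - b" "R + b"] elim assms by simp
    then have "real (card {x \<in> \<Sigma>. R - b < f x \<and> f x \<le> R + b}) / real (card {x \<in> \<Sigma>. f x \<le> R - b'})
       \<le> ((R + b + \<gamma>) ^ ?d - (R - b - \<gamma>) ^ ?d) * \<omega> / ((R - b' - \<gamma>) ^ ?d * \<omega>)"
      using den den' by (intro frac_le) (auto intro: order_trans[OF of_nat_0_le_iff])
    also have "\<dots> = g R" using \<omega>_pos by (simp add: g_def power_divide flip: diff_divide_distrib)
    finally show ?case by simp
  qed
  then show ?thesis using g by (rule Lim_null_comparison)
qed

lemma ball_eventually_nonempty: "\<forall>\<^sub>F R in at_top. 0 < card {x \<in> \<Sigma>. f x \<le> R - b'}"
  using eventually_gt_at_top[of "b' + \<gamma>"]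
proof eventually_elim
  case (elim R)
  have "0 < (R - b' - \<gamma>) ^ CARD('n) * \<omega>" using elim \<omega>_pos by simp
  also have "\<dots> \<le> real (card {x \<in> \<Sigma>. f x \<le> R - b'})" using card_ball_ge[of "R - b'"] elim by simp
  finally show ?case by simp
qed

end

section \<open>Translation invariance of frequencies\<close>

definition tbox :: "real \<Rightarrow> (real^'e) set" where
  "tbox B = {t. \<forall>j. \<bar>t $ j\<bar> \<le> B}"

definition unit_box :: "(real^'e) set" where
  "unit_box = {t. \<forall>j. 0 \<le> t $ j \<and> t $ j \<le> 1}"

lemma unit_box_tbox: "unit_box \<subseteq> tbox 1"
  by (auto simp: unit_box_def tbox_def abs_le_iff intro: order_trans[of _ 0])

lemma tbox_norm: "(t :: real^'e) \<in> tbox B \<Longrightarrow> norm t \<le> real CARD('e) * B"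
proof -
  assume "t \<in> tbox B"
  then have "(\<Sum>j\<in>UNIV. \<bar>t $ j\<bar>) \<le> (\<Sum>j\<in>(UNIV::'e set). B)" by (intro sum_mono) (auto simp: tbox_def)
  then show ?thesis using norm_le_l1_cart[of t] by simp
qed

lemma linear_tbox_bound:
  assumes "linear (g :: real^'e \<Rightarrow> 'b::euclidean_space)"
  shows "\<exists>b\<ge>0. \<forall>t\<in>tbox B. norm (g t) \<le> b"
proof -
  have bl: "bounded_linear g" using assms by (simp add: linear_conv_bounded_linear)
  have "norm (g t) \<le> onorm g * \<bar>real CARD('e) * B\<bar>" if "t \<in> tbox B" for t
  proof -
    have "norm (g t) \<le> onorm g * norm t" by (rule onorm[OF bl])
    also have "\<dots> \<le> onorm g * \<bar>real CARD('e) * B\<bar>"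
      using tbox_norm[OF that] by (intro mult_left_mono onorm_pos_le[OF bl]) linarith
    finally show ?thesis .
  qed
  then show ?thesis using onorm_pos_le[OF bl] by (intro exI[of _ "onorm g * \<bar>real CARD('e) * B\<bar>"]) simp
qed

context cut_project
begin

definition "f x = infnorm ((x, A *v x) :: ('d, 'e) pt)"

sublocale ball: seminorm_ball f "1 / sqrt (real DIM(('d, 'e) pt))" "1 + onorm ((*v) A)" "fst s"
proof
  fix x y :: "real^'d" and t :: real
  have "((x + y, A *v (x + y)) :: ('d, 'e) pt) = (x, A *v x) + (y, A *v y)" by (simp add: matrix_vector_right_distrib)
  then show "f (x + y) \<le> f x + f y" unfolding f_def by (metis infnorm_triangle)
  have "((t *\<^sub>R x, A *v (t *\<^sub>R x)) :: ('d, 'e) pt) = t *\<^sub>R (x, A *v x)" by (simp add: matrix_vector_mult_scaleR)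
  then show "f (t *\<^sub>R x) = \<bar>t\<bar> * f x" unfolding f_def by (metis infnorm_mul)
  show "continuous_on UNIV f" unfolding f_def 
    by (intro continuous_intros linear_continuous_on) (simp add: linear_conv_bounded_linear[symmetric])
  show "0 < 1 / sqrt (real DIM(('d, 'e) pt))" by (simp add: add_pos_pos)
  have "norm x \<le> norm ((x, A *v x) :: ('d, 'e) pt)" by (simp add: norm_Pair)
  also have "\<dots> \<le> sqrt DIM(('d, 'e) pt) * f x" unfolding f_def by (rule norm_le_infnorm)
  finally show "1 / sqrt (real DIM(('d, 'e) pt)) * norm x \<le> f x"
    by (simp add: pos_divide_le_eq add_pos_pos mult.commute)
  have "f x \<le> norm ((x, A *v x) :: ('d, 'e) pt)" unfolding f_def by (rule infnorm_le_norm)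
  also have "\<dots> \<le> norm x + norm (A *v x)" by (rule norm_Pair_le)
  also have "norm (A *v x) \<le> onorm ((*v) A) * norm x"
    by (intro onorm) (simp add: linear_conv_bounded_linear[symmetric])
  finally show "f x \<le> (1 + onorm ((*v) A)) * norm x" by (simp add: algebra_simps)
qed

lemma fst_shifted_lattice: "z \<in> shifted_lattice s \<Longrightarrow> fst z \<in> ball.\<Sigma>"
  by (auto simp: shifted_lattice_def ball.\<Sigma>_def Zk_iff)

lemma infnorm_\<pi>1: "infnorm (\<pi>1 z) = f (fst z + drift (ell z))"
  by (simp add: \<pi>1_eq f_def)

lemma infnorm_\<pi>1_bound:
  "\<exists>b\<ge>0. \<forall>z. ell z \<in> tbox B \<longrightarrow> infnorm (\<pi>1 z) \<le> f (fst z) + b \<and> f (fst z) \<le> infnorm (\<pi>1 z) + b"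
proof -
  obtain b0 where b0: "b0 \<ge> 0" "\<And>t. t \<in> tbox B \<Longrightarrow> norm (drift t) \<le> b0" 
    using linear_tbox_bound[OF linear_drift] by blast
  define b where "b = (1 + onorm ((*v) A)) * b0"
  have fb: "f x \<le> b" if "norm x \<le> b0" for x
    using ball.c[of x] mult_left_mono[OF that ball.c_nonneg] by (simp add: b_def)
  show ?thesis
  proof (intro exI[of _ b] conjI allI impI)
    show "0 \<le> b" using fb[of 0] ball.f_nonneg[of 0] b0 by simp
    fix z assume z: "ell z \<in> tbox B"
    show "infnorm (\<pi>1 z) \<le> f (fst z) + b" 
      using ball.f_add[of "fst z" "drift (ell z)"] fb[OF b0(2)[OF z]] by (simp add: infnorm_\<pi>1)
    have "f (fst z) \<le> f (fst z + drift (ell z)) + f (- drift (ell z))"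
      using ball.f_add[of "fst z + drift (ell z)" "- drift (ell z)"] by simp
    then show "f (fst z) \<le> infnorm (\<pi>1 z) + b"
      using fb[of "- drift (ell z)"] b0(2)[OF z] by (simp add: infnorm_\<pi>1)
  qed
qed

text \<open>Lattice points with the same first component differ by some \<open>(0, m)\<close> with
  \<open>m\<close> integral, and bounded \<open>ell\<close> bounds \<open>m\<close>. This reduces
  counts in the strip to counts of first components.\<close>

lemma fibre_bound:
  "\<exists>\<kappa>::nat. \<forall>X. X \<subseteq> ball.\<Sigma> \<longrightarrow> finite X \<longrightarrow> 
     finite {z \<in> shifted_lattice s. fst z \<in> X \<and> ell z \<in> tbox B} \<and>
     card {z \<in> shifted_lattice s. fst z \<in> X \<and> ell z \<in> tbox B} \<le> \<kappa> * card X"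
proof -
  obtain b where b: "b \<ge> 0" "\<And>t. t \<in> tbox (2 * B) \<Longrightarrow> norm (V *v t) \<le> b" 
    using linear_tbox_bound[OF matrix_vector_mul_linear] by blast
  define F where "F x = {z \<in> shifted_lattice s. fst z = x \<and> ell z \<in> tbox B}" for x
  have F: "finite (F x) \<and> card (F x) \<le> card (ibox b :: (real^'e) set)" for x
  proof (cases "F x = {}")
    case False
    then obtain z0 where z0: "z0 \<in> F x" by blast
    have "F x \<subseteq> (\<lambda>m. z0 + (0, m)) ` ibox b"
    proof
      fix z assume z: "z \<in> F x"
      define m where "m = snd (z - z0)"
      have "z - z0 \<in> Zk" using z z0 by (auto simp: F_def intro: shifted_lattice_diff)
      then have "m \<in> intvec" by (simp add: m_def Zk_iff)
      have eq: "z - z0 = (0, m)" using z z0 by (simp add: F_def m_def prod_eq_iff)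
      have "m = V *v ell (z - z0)" by (simp add: eq ell_def)
      moreover have "ell (z - z0) \<in> tbox (2 * B)"
        unfolding tbox_def mem_Collect_eq
      proof
        fix j
        have "\<bar>ell z $ j\<bar> \<le> B" "\<bar>ell z0 $ j\<bar> \<le> B" using z z0 by (auto simp: F_def tbox_def)
        then show "\<bar>ell (z - z0) $ j\<bar> \<le> 2 * B" by (simp add: ell_diff)
      qed
      ultimately have "norm m \<le> b" using b by metis
      then have "\<bar>m $ i\<bar> \<le> b" for i using component_le_norm_cart[of m i] by linarith
      then have "m \<in> ibox b" using \<open>m \<in> intvec\<close> by (simp add: ibox_def)
      moreover have "z = z0 + (0, m)" using eq by (metis add_diff_cancel_left' diff_add_cancel add.commute)
      ultimately show "z \<in> (\<lambda>m. z0 + (0, m)) ` ibox b" by blast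
    qed
    then show ?thesis using finite_ibox by (meson card_image_le card_mono finite_imageI finite_subset le_trans)
  qed simp
  show ?thesis
  proof (intro exI[of _ "card (ibox b :: (real^'e) set)"] allI impI)
    fix X assume X: "X \<subseteq> ball.\<Sigma>" "finite X"
    have eq: "{z \<in> shifted_lattice s. fst z \<in> X \<and> ell z \<in> tbox B} = (\<Union>x\<in>X. F x)" by (auto simp: F_def)
    have "card (\<Union>x\<in>X. F x) \<le> (\<Sum>x\<in>X. card (F x))" by (rule card_UN_le[OF X(2)])
    also have "\<dots> \<le> (\<Sum>x\<in>X. card (ibox b :: (real^'e) set))" using F by (intro sum_mono) auto
    finally show "finite {z \<in> shifted_lattice s. fst z \<in> X \<and> ell z \<in> tbox B} \<and>
      card {z \<in> shifted_lattice s. fst z \<in> X \<and> ell z \<in> tbox B} \<le> card (ibox b :: (real^'e) set) * card X"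
      unfolding eq using F X(2) by (simp add: mult.commute)
  qed
qed

definition "pts C R = {z \<in> shifted_lattice s. infnorm (\<pi>1 z) \<le> R \<and> ell z \<in> C}"

definition "full_count R = real (card (pts unit_box R))"

lemma finite_pts: 
  assumes "C \<subseteq> tbox B" shows "finite (pts C R)"
proof -
  obtain b where b: "\<And>z. ell z \<in> tbox B \<Longrightarrow> f (fst z) \<le> infnorm (\<pi>1 z) + b" using infnorm_\<pi>1_bound by blast
  have "finite {z \<in> shifted_lattice s. fst z \<in> {x \<in> ball.\<Sigma>. f x \<le> R + b} \<and> ell z \<in> tbox B}"
  proof -
    have "{x \<in> ball.\<Sigma>. f x \<le> R + b} \<subseteq> ball.\<Sigma>" by auto
    with fibre_bound[of B] ball.finite_\<Sigma>[of "R + b"] show ?thesis by (elim exE allE impE) auto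
  qed
  moreover have "pts C R \<subseteq> {z \<in> shifted_lattice s. fst z \<in> {x \<in> ball.\<Sigma>. f x \<le> R + b} \<and> ell z \<in> tbox B}"
    using assms fst_shifted_lattice by (fastforce simp: pts_def dest: b)
  ultimately show ?thesis by (rule finite_subset[rotated])
qed

text \<open>By the tiling, every first component carries a lattice point of the strip. The bound
  keeps the denominators of the frequencies of full order.\<close>

lemma full_count_ge: "\<exists>b. \<forall>R. real (card {x \<in> ball.\<Sigma>. f x \<le> R - b}) \<le> full_count R"
proof -
  obtain b where b: "\<And>z. ell z \<in> tbox 1 \<Longrightarrow> infnorm (\<pi>1 z) \<le> f (fst z) + b" using infnorm_\<pi>1_bound by blast
  have "card {x \<in> ball.\<Sigma>. f x \<le> R - b} \<le> card (fst ` pts unit_box R)" for R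
  proof (intro card_mono finite_imageI finite_pts[OF unit_box_tbox] subsetI)
    fix x assume x: "x \<in> {x \<in> ball.\<Sigma>. f x \<le> R - b}"
    define z0 where "z0 = (x - fst s, 0) + s"
    have "(x - fst s, 0) \<in> Zk" using x by (simp add: ball.\<Sigma>_def Zk_iff intvec_0)
    then have z0: "z0 \<in> shifted_lattice s" unfolding z0_def shifted_lattice_def by (rule imageI)
    define z where "z = z0 + shift (\<lambda>j. - \<lfloor>ell z0 $ j\<rfloor>)"
    have z: "z \<in> shifted_lattice s" unfolding z_def by (intro shifted_lattice_add z0 shift)
    have "ell z $ j = frac (ell z0 $ j)" for j by (simp add: z_def ell_add shift frac_def)
    then have u: "ell z \<in> unit_box" by (auto simp: unit_box_def less_imp_le[OF frac_lt_1])
    have "fst z = x" by (simp add: z_def z0_def shift)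
    moreover have "infnorm (\<pi>1 z) \<le> R" using b[of z] u unit_box_tbox x \<open>fst z = x\<close> by auto
    ultimately show "x \<in> fst ` pts unit_box R" using z u by (auto simp: pts_def intro!: image_eqI[of _ _ z])
  qed
  also have "card (fst ` pts unit_box R) \<le> card (pts unit_box R)" for R
    by (intro card_image_le finite_pts[OF unit_box_tbox])
  finally show ?thesis by (auto simp: full_count_def)
qed

lemma full_count_pos: "\<forall>\<^sub>F R in at_top. 0 < full_count R"
proof -
  obtain b where b: "\<And>R. real (card {x \<in> ball.\<Sigma>. f x \<le> R - b}) \<le> full_count R" using full_count_ge by blast
  show ?thesis using ball.ball_eventually_nonempty[of b]
  proof eventually_elim
    case (elim R)
    then have "0 < real (card {x \<in> ball.\<Sigma>. f x \<le> R - b})" by simp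
    then show ?case using b[of R] by linarith
  qed
qed

text \<open>The points that can be gained or lost at radius \<open>R\<close> when
  \<open>infnorm (\<pi>1 z)\<close> changes by less than \<open>b\<close>.\<close>

definition "shell B b R = {z \<in> shifted_lattice s. ell z \<in> tbox B \<and> R - b < infnorm (\<pi>1 z) \<and> infnorm (\<pi>1 z) \<le> R + b}"

lemma finite_shell: "finite (shell B b R)"
  by (rule finite_subset[OF _ finite_pts[of "tbox B" B "R + b"]]) (auto simp: shell_def pts_def)

lemma shell_negligible: "((\<lambda>R. real (card (shell B b R)) / full_count R) \<longlongrightarrow> 0) at_top"
proof -
  obtain b1 where b1: "b1 \<ge> 0" "\<And>z. ell z \<in> tbox B \<Longrightarrow> infnorm (\<pi>1 z) \<le> f (fst z) + b1 \<and> f (fst z) \<le> infnorm (\<pi>1 z) + b1" 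
    using infnorm_\<pi>1_bound by blast
  obtain b2 where b2: "\<And>R. real (card {x \<in> ball.\<Sigma>. f x \<le> R - b2}) \<le> full_count R" using full_count_ge by blast
  obtain \<kappa> where \<kappa>: "\<And>X. X \<subseteq> ball.\<Sigma> \<Longrightarrow> finite X \<Longrightarrow> finite {z \<in> shifted_lattice s. fst z \<in> X \<and> ell z \<in> tbox B} \<and>
     card {z \<in> shifted_lattice s. fst z \<in> X \<and> ell z \<in> tbox B} \<le> \<kappa> * card X" using fibre_bound by blast
  define b3 where "b3 = \<bar>b\<bar> + b1"
  let ?X = "\<lambda>R. {x \<in> ball.\<Sigma>. R - b3 < f x \<and> f x \<le> R + b3}"
  let ?Y = "\<lambda>R. {x \<in> ball.\<Sigma>. f x \<le> R - b2}"
  have "((\<lambda>R. real \<kappa> * (real (card (?X R)) / real (card (?Y R)))) \<longlongrightarrow> real \<kappa> * 0) at_top"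
    using b1(1) by (intro tendsto_mult_left ball.annulus_ratio) (simp add: b3_def)
  then have lim: "((\<lambda>R. real \<kappa> * (real (card (?X R)) / real (card (?Y R)))) \<longlongrightarrow> 0) at_top" by simp
  have "\<forall>\<^sub>F R in at_top. norm (real (card (shell B b R)) / full_count R) \<le> real \<kappa> * (real (card (?X R)) / real (card (?Y R)))"
    using ball.ball_eventually_nonempty[of b2]
  proof eventually_elim
    case (elim R)
    have fin: "finite (?X R)" by (rule finite_subset[OF _ ball.finite_\<Sigma>[of "R + b3"]]) auto
    have XS: "?X R \<subseteq> ball.\<Sigma>" by auto
    note k = \<kappa>[OF XS fin]
    have "shell B b R \<subseteq> {z \<in> shifted_lattice s. fst z \<in> ?X R \<and> ell z \<in> tbox B}"
    proof
      fix z assume z: "z \<in> shell B b R"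
      then have "ell z \<in> tbox B" "R - b < infnorm (\<pi>1 z)" "infnorm (\<pi>1 z) \<le> R + b" "z \<in> shifted_lattice s" by (auto simp: shell_def)
      moreover then have "fst z \<in> ball.\<Sigma>" "R - b3 < f (fst z)" "f (fst z) \<le> R + b3"
        using b1(2)[of z] fst_shifted_lattice by (auto simp: b3_def)
      ultimately show "z \<in> {z \<in> shifted_lattice s. fst z \<in> ?X R \<and> ell z \<in> tbox B}" by simp
    qed
    from card_mono[OF k[THEN conjunct1] this] k[THEN conjunct2] have "card (shell B b R) \<le> \<kappa> * card (?X R)" by (rule le_trans)
    then have "real (card (shell B b R)) \<le> real \<kappa> * real (card (?X R))" 
      unfolding of_nat_mult[symmetric] of_nat_le_iff .
    then have "real (card (shell B b R)) / full_count R \<le> real \<kappa> * real (card (?X R)) / real (card (?Y R))"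
      using elim b2[of R] by (intro frac_le) auto
    moreover have "0 \<le> full_count R" by (simp add: full_count_def)
    ultimately show ?case by simp
  qed
  then show ?thesis using lim by (rule Lim_null_comparison)
qed

lemma eventually_shell_le: "\<eta> > 0 \<Longrightarrow> \<forall>\<^sub>F R in at_top. real (card (shell B b R)) \<le> \<eta> * full_count R"
proof -
  assume "\<eta> > 0"
  with shell_negligible have "\<forall>\<^sub>F R in at_top. real (card (shell B b R)) / full_count R < \<eta>" by (rule order_tendstoD)
  then show ?thesis using full_count_pos by eventually_elim (simp add: field_simps)
qed

lemma pts_bound: "\<exists>C0>0. \<forall>\<^sub>F R in at_top. real (card (pts (tbox B) R)) \<le> C0 * full_count R"
proof -
  obtain b1 where b1: "b1 \<ge> 0" "\<And>z. ell z \<in> tbox B \<Longrightarrow> f (fst z) \<le> infnorm (\<pi>1 z) + b1" 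
    using infnorm_\<pi>1_bound by blast
  obtain b2 where b2: "\<And>R. real (card {x \<in> ball.\<Sigma>. f x \<le> R - b2}) \<le> full_count R" using full_count_ge by blast
  obtain \<kappa> where \<kappa>: "\<And>X. X \<subseteq> ball.\<Sigma> \<Longrightarrow> finite X \<Longrightarrow> finite {z \<in> shifted_lattice s. fst z \<in> X \<and> ell z \<in> tbox B} \<and>
     card {z \<in> shifted_lattice s. fst z \<in> X \<and> ell z \<in> tbox B} \<le> \<kappa> * card X" using fibre_bound by blast
  define b3 where "b3 = \<bar>b2\<bar> + b1 + 1"
  let ?X = "\<lambda>R. {x \<in> ball.\<Sigma>. R - b3 < f x \<and> f x \<le> R + b3}"
  let ?Y = "\<lambda>R. {x \<in> ball.\<Sigma>. f x \<le> R - b2}"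
  have "((\<lambda>R. real (card (?X R)) / real (card (?Y R))) \<longlongrightarrow> 0) at_top"
    using b1(1) by (intro ball.annulus_ratio) (simp add: b3_def)
  then have "\<forall>\<^sub>F R in at_top. real (card (?X R)) / real (card (?Y R)) < 1" by (rule order_tendstoD) simp
  then have "\<forall>\<^sub>F R in at_top. real (card (pts (tbox B) R)) \<le> (2 * real \<kappa> + 1) * full_count R"
    using ball.ball_eventually_nonempty[of b2]
  proof eventually_elim
    case (elim R)
    let ?Z = "{x \<in> ball.\<Sigma>. f x \<le> R + b1}"
    have ZS: "?Z \<subseteq> ball.\<Sigma>" by auto
    note k = \<kappa>[OF ZS ball.finite_\<Sigma>]
    have "pts (tbox B) R \<subseteq> {z \<in> shifted_lattice s. fst z \<in> ?Z \<and> ell z \<in> tbox B}"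
      using b1(2) fst_shifted_lattice by (fastforce simp: pts_def)
    from card_mono[OF k[THEN conjunct1] this] k[THEN conjunct2] have "card (pts (tbox B) R) \<le> \<kappa> * card ?Z" by (rule le_trans)
    \<comment> \<open>The slightly larger ball is the smaller one together with an annulus, which
      eventually has fewer points than the smaller ball.\<close>
    also have "card ?Z \<le> card (?Y R \<union> ?X R)"
      by (intro card_mono finite_UnI ball.finite_\<Sigma> finite_subset[OF _ ball.finite_\<Sigma>[of "R + b3"]])
        (use b1(1) in \<open>auto simp: b3_def\<close>)
    also have "\<dots> \<le> card (?Y R) + card (?X R)" by (rule card_Un_le)
    finally have "card (pts (tbox B) R) \<le> \<kappa> * (card (?Y R) + card (?X R))" by simp
    then have "real (card (pts (tbox B) R)) \<le> real \<kappa> * (real (card (?Y R)) + real (card (?X R)))"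
      unfolding of_nat_mult[symmetric] of_nat_add[symmetric] of_nat_le_iff .
    also have "\<dots> \<le> real \<kappa> * (full_count R + full_count R)"
      using elim b2[of R] by (intro mult_left_mono add_mono) (auto simp: field_simps)
    also have "\<dots> \<le> (2 * real \<kappa> + 1) * full_count R" by (simp add: algebra_simps full_count_def)
    finally show ?case .
  qed
  then show ?thesis by (intro exI[of _ "2 * real \<kappa> + 1"]) simp
qed

text \<open>Translation by a lattice vector permutes the shifted lattice and moves
  \<open>\<pi>1\<close> by a fixed vector, so the counts differ only near the boundary of the
  ball.\<close>

lemma pts_lattice_shift:
  assumes u: "u \<in> Zk" and C: "C \<subseteq> tbox B"
  shows "\<bar>real (card (pts ((+) (ell u) ` C) R)) - real (card (pts C R))\<bar> \<le> real (card (shell B (infnorm (\<pi>1 u)) R))"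
proof -
  let ?b = "infnorm (\<pi>1 u)" and ?S = "shell B (infnorm (\<pi>1 u)) R"
  define P where "P = {z \<in> shifted_lattice s. infnorm (\<pi>1 (z + u)) \<le> R \<and> ell z \<in> C}"
  have "bij_betw (\<lambda>z. z + u) P (pts ((+) (ell u) ` C) R)"
  proof (rule bij_betwI[where g = "\<lambda>z. z - u"]; (intro Pi_I)?)
    fix z assume z: "z \<in> P"
    then have "ell (z + u) \<in> (+) (ell u) ` C" by (intro image_eqI[of _ _ "ell z"]) (simp_all add: P_def ell_add)
    then show "z + u \<in> pts ((+) (ell u) ` C) R"
      using z shifted_lattice_add[OF _ u, of z] by (simp add: P_def pts_def)
  next
    fix z assume z: "z \<in> pts ((+) (ell u) ` C) R"
    then obtain w where "w \<in> C" "ell z = ell u + w" unfolding pts_def by blast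
    then have "ell (z - u) \<in> C" by (simp add: ell_diff)
    then show "z - u \<in> P"
      using z shifted_lattice_add[OF _ Zk_minus[OF u], of z] by (simp add: P_def pts_def)
  qed simp_all
  then have c: "card (pts ((+) (ell u) ` C) R) = card P" by (simp add: bij_betw_same_card)
  have near: "\<bar>infnorm (\<pi>1 (z + u)) - infnorm (\<pi>1 z)\<bar> \<le> ?b" for z
    using absdiff_infnorm[of "\<pi>1 (z + u)" "\<pi>1 z"] by (simp add: linear_add[OF linear_\<pi>1])
  have 1: "P \<subseteq> pts C R \<union> ?S"
  proof
    fix z assume z: "z \<in> P"
    then show "z \<in> pts C R \<union> ?S" using near[of z] C by (auto simp: P_def pts_def shell_def)
  qed
  have 2: "pts C R \<subseteq> P \<union> ?S"
  proof
    fix z assume z: "z \<in> pts C R"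
    then show "z \<in> P \<union> ?S" using near[of z] C by (auto simp: P_def pts_def shell_def)
  qed
  have fin: "finite (pts C R)" "finite ?S" using finite_pts[OF C] finite_shell by auto
  then have "finite P" using 1 finite_subset by blast
  have "card P \<le> card (pts C R) + card ?S" using card_mono[OF _ 1] card_Un_le[of "pts C R" ?S] fin by force
  moreover have "card (pts C R) \<le> card P + card ?S" using card_mono[OF _ 2] card_Un_le[of P ?S] fin \<open>finite P\<close> by force
  ultimately show ?thesis unfolding c by linarith
qed

lemma ell_dense:
  assumes "\<delta> > 0" shows "\<exists>u\<in>Zk. \<forall>j. \<bar>ell u $ j - t $ j\<bar> < \<delta>"
proof -
  have bl: "bounded_linear coord" using linear_coord by (simp add: linear_conv_bounded_linear)
  define \<delta>' where "\<delta>' = \<delta> / (onorm coord + 1)"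
  have o: "onorm coord \<ge> 0" by (rule onorm_pos_le[OF bl])
  have "\<delta>' > 0" using assms o by (simp add: \<delta>'_def)
  then obtain n m where nm: "n \<in> intvec" "m \<in> intvec" "norm (m - A *v n - V *v t) < \<delta>'" using dense by blast
  have "ell (n, m) - t = coord (m - A *v n - V *v t)"
    by (simp add: ell_def linear_diff[OF linear_coord])
  then have "norm (ell (n, m) - t) \<le> onorm coord * norm (m - A *v n - V *v t)" by (simp add: onorm[OF bl])
  also have "\<dots> \<le> (onorm coord + 1) * norm (m - A *v n - V *v t)" by (intro mult_right_mono) auto
  also have "\<dots> < (onorm coord + 1) * \<delta>'" using nm(3) o by (intro mult_strict_left_mono) auto
  also have "\<dots> = \<delta>" using o by (simp add: \<delta>'_def)
  finally have "norm (ell (n, m) - t) < \<delta>" .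
  then have "\<bar>ell (n, m) $ j - t $ j\<bar> < \<delta>" for j
    using component_le_norm_cart[of "ell (n, m) - t" j] by simp
  moreover have "(n, m) \<in> Zk" using nm by (simp add: Zk_iff)
  ultimately show ?thesis by blast
qed

section \<open>Packing of thin slabs\<close>

definition "slab j x \<delta> B = {t \<in> tbox B. \<bar>t $ j - x\<bar> \<le> \<delta>}"

text \<open>\<open>K\<close> disjoint lattice translates of the slab fit into one fixed box and have
  asymptotically equal counts, so each receives at most a share of order \<open>1 / K\<close>.
  Density of the projected lattice takes the place of equidistribution.\<close>

lemma slab_negligible:
  assumes \<eta>: "\<eta> > 0"
  shows "\<exists>\<delta>>0. \<forall>\<^sub>F R in at_top. real (card (pts (slab j x \<delta> B) R)) \<le> \<eta> * full_count R"
proof -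
  obtain C0 where C0: "C0 > 0" "\<forall>\<^sub>F R in at_top. real (card (pts (tbox (B + 1)) R)) \<le> C0 * full_count R"
    using pts_bound by blast
  define K where "K = nat \<lceil>2 * C0 / \<eta>\<rceil> + 1"
  have "2 * C0 / \<eta> \<le> real K" unfolding K_def by linarith
  moreover have Kpos: "real K > 0" by (simp add: K_def)
  ultimately have K: "real K > 0" "C0 / real K \<le> \<eta> / 2"
    using \<eta> C0(1) by (auto simp: field_simps)
  \<comment> \<open>Midpoints of \<open>K\<close> equal subintervals of the unit interval; an error
    of a quarter of the spacing keeps the translations between 0 and 1.\<close>
  define t where "t k = ((\<chi> i. (real k + 1/2) / real K) :: real^'e)" for k :: nat
  have "\<exists>u\<in>Zk. \<forall>i. \<bar>ell u $ i - t k $ i\<bar> < 1 / (4 * real K)" for k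
    using K by (intro ell_dense) simp
  then obtain u where u: "\<And>k. u k \<in> Zk" "\<And>k i. \<bar>ell (u k) $ i - t k $ i\<bar> < 1 / (4 * real K)" by metis
  \<comment> \<open>The ideal centres are at least \<open>8 * \<delta>\<close> apart and each is
    missed by less than \<open>2 * \<delta>\<close>, which leaves more than the thickness
    \<open>2 * \<delta>\<close> of a slab.\<close>
  define \<delta> where "\<delta> = 1 / (8 * real K)"
  define S where "S = slab j x \<delta> B"
  have \<delta>: "\<delta> > 0" using K by (simp add: \<delta>_def)
  have S: "S \<subseteq> tbox B" by (auto simp: S_def slab_def)
  have uk: "0 \<le> ell (u k) $ i" "ell (u k) $ i \<le> 1" if "k < K" for k i
  proof -
    have "\<bar>ell (u k) $ i - (real k + 1/2) / real K\<bar> < (1/4) / real K" using u(2)[of k i] by (simp add: t_def)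
    then have lt: "(real k + 1/2) / real K - (1/4) / real K < ell (u k) $ i" "ell (u k) $ i < (real k + 1/2) / real K + (1/4) / real K"
      by linarith+
    have eq: "(real k + 1/2) / real K - (1/4) / real K = (real k + 1/4) / real K"
      "(real k + 1/2) / real K + (1/4) / real K = (real k + 3/4) / real K"
      by (subst diff_divide_distrib[symmetric] add_divide_distrib[symmetric], simp)+
    have "0 \<le> (real k + 1/4) / real K" "(real k + 3/4) / real K \<le> 1" using \<open>k < K\<close> by (auto simp: field_simps)
    with lt[unfolded eq] show "0 \<le> ell (u k) $ i" "ell (u k) $ i \<le> 1" by (meson less_imp_le order_trans)+
  qed
  have sub: "(+) (ell (u k)) ` S \<subseteq> tbox (B + 1)" if "k < K" for k
  proof
    fix y assume "y \<in> (+) (ell (u k)) ` S"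
    then obtain w where w: "w \<in> S" "y = ell (u k) + w" by blast
    have "\<bar>y $ i\<bar> \<le> B + 1" for i
    proof -
      have "\<bar>w $ i\<bar> \<le> B" using w S by (auto simp: tbox_def)
      then show ?thesis using uk[OF that, of i] w by (auto simp: abs_le_iff)
    qed
    then show "y \<in> tbox (B + 1)" by (simp add: tbox_def)
  qed
  have disj: "pts ((+) (ell (u k)) ` S) R \<inter> pts ((+) (ell (u l)) ` S) R = {}" if "k \<noteq> l" for k l R
  proof (rule ccontr)
    assume "\<not> ?thesis"
    then obtain w w' where w: "w \<in> S" "w' \<in> S" "ell (u k) + w = ell (u l) + w'" by (fastforce simp: pts_def)
    then have "ell (u k) $ j + w $ j = ell (u l) $ j + w' $ j" by (metis vector_add_component)
    moreover have "\<bar>w $ j - x\<bar> \<le> \<delta>" "\<bar>w' $ j - x\<bar> \<le> \<delta>" using w by (auto simp: S_def slab_def)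
    ultimately have 1: "\<bar>ell (u k) $ j - ell (u l) $ j\<bar> \<le> 2 * \<delta>" by linarith
    have 2: "\<bar>t k $ j - t l $ j\<bar> \<ge> 1 / real K"
    proof -
      have "t k $ j - t l $ j = (real k - real l) / real K" by (simp add: t_def flip: diff_divide_distrib)
      moreover have "\<bar>real k - real l\<bar> \<ge> 1" using that by linarith
      ultimately show ?thesis using K by (simp add: divide_right_mono)
    qed
    have "1 / (4 * real K) = 2 * \<delta>" "1 / real K = 8 * \<delta>" by (simp_all add: \<delta>_def)
    then show False using 1 2 u(2)[of k j] u(2)[of l j] \<delta> by linarith
  qed
  have "\<forall>\<^sub>F R in at_top. \<forall>k\<in>{..<K}. real (card (shell B (infnorm (\<pi>1 (u k))) R)) \<le> \<eta> / 2 * full_count R"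
    using \<eta> by (intro eventually_ball_finite ballI eventually_shell_le) auto
  then have "\<forall>\<^sub>F R in at_top. real (card (pts S R)) \<le> \<eta> * full_count R"
    using C0(2)
  proof eventually_elim
    case (elim R)
    have "real K * real (card (pts S R)) = (\<Sum>k<K. real (card (pts S R)))" by simp
    also have "\<dots> \<le> (\<Sum>k<K. real (card (pts ((+) (ell (u k)) ` S) R)) + \<eta> / 2 * full_count R)"
    proof (rule sum_mono)
      fix k assume "k \<in> {..<K}"
      then show "real (card (pts S R)) \<le> real (card (pts ((+) (ell (u k)) ` S) R)) + \<eta> / 2 * full_count R"
        using pts_lattice_shift[OF u(1)[of k] S, of R] elim(1) by force
    qed
    also have "\<dots> = real (\<Sum>k<K. card (pts ((+) (ell (u k)) ` S) R)) + real K * (\<eta> / 2 * full_count R)"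
      by (simp add: sum.distrib)
    also have "(\<Sum>k<K. card (pts ((+) (ell (u k)) ` S) R)) = card (\<Union>k<K. pts ((+) (ell (u k)) ` S) R)"
      using sub disj by (intro card_UN_disjoint[symmetric]) (auto intro: finite_pts)
    also have "real \<dots> \<le> real (card (pts (tbox (B + 1)) R))"
      using sub by (intro of_nat_mono card_mono finite_pts[OF order_refl]) (fastforce simp: pts_def)
    also have "\<dots> \<le> C0 * full_count R" by (rule elim(2))
    finally have "real (card (pts S R)) \<le> (C0 / real K + \<eta> / 2) * full_count R" using K(1) by (simp add: field_simps)
    also have "\<dots> \<le> (\<eta> / 2 + \<eta> / 2) * full_count R" 
      by (rule mult_right_mono[OF add_right_mono[OF K(2)]]) (simp add: full_count_def)
    finally show ?case by simp
  qed
  then show ?thesis using \<delta> unfolding S_def by blast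
qed

text \<open>For finite \<open>X\<close> these are the finite unions of boxes, open or closed on each
  side, with faces on the hyperplanes \<open>t $ j = x\<close>. Comparisons are used because cells
  are given by conditions and not as explicit unions.\<close>

definition threshold_set :: "real set \<Rightarrow> (real^'e) set \<Rightarrow> bool" where
  "threshold_set X C \<longleftrightarrow> (\<forall>t t'. (\<forall>j. \<forall>x\<in>X. (t $ j < x \<longleftrightarrow> t' $ j < x) \<and> (t $ j \<le> x \<longleftrightarrow> t' $ j \<le> x)) \<longrightarrow> (t \<in> C \<longleftrightarrow> t' \<in> C))"

text \<open>For a lattice vector \<open>u\<close> with \<open>ell u\<close> close to \<tau>,
  translation by \<open>ell u\<close> changes counts negligibly. Replacing \<tau> by
  \<open>ell u\<close> affects only points close to one of finitely many hyperplanes, that is,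
  points in negligible slabs.\<close>

lemma pts_translate:
  assumes X: "finite X" "threshold_set X C" and C: "C \<subseteq> tbox B"
  shows "((\<lambda>R. (real (card (pts ((+) \<tau> ` C) R)) - real (card (pts C R))) / full_count R) \<longlongrightarrow> 0) at_top"
proof (rule tendstoI)
  fix \<epsilon> :: real assume \<epsilon>: "\<epsilon> > 0"
  \<comment> \<open>The summand 1 keeps \<open>M\<close> positive when \<open>X\<close> is
    empty.\<close>
  define M where "M = real (card (UNIV :: 'e set) * card X) + 1"
  have M: "M > 0" by (simp add: M_def add_nonneg_pos)
  define B' where "B' = B + (\<Sum>j\<in>UNIV. \<bar>\<tau> $ j\<bar>) + 1"
  have "\<exists>\<delta>>0. \<forall>\<^sub>F R in at_top. real (card (pts (slab j (x + \<tau> $ j) \<delta> B') R)) \<le> (\<epsilon> / (4 * M)) * full_count R" for j x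
    using \<epsilon> M by (intro slab_negligible) simp
  then obtain \<delta> where \<delta>: "\<And>j x. \<delta> j x > 0" 
    "\<And>j x. \<forall>\<^sub>F R in at_top. real (card (pts (slab j (x + \<tau> $ j) (\<delta> j x) B') R)) \<le> (\<epsilon> / (4 * M)) * full_count R" by metis
  define \<delta>0 where "\<delta>0 = Min (insert 1 ((\<lambda>(j, x). \<delta> j x) ` (UNIV \<times> X)))"
  have fin: "finite (insert 1 ((\<lambda>(j, x). \<delta> j x) ` (UNIV \<times> X)))" using X(1) by simp
  have \<delta>0: "\<delta>0 > 0" "\<delta>0 \<le> 1" "\<And>j x. x \<in> X \<Longrightarrow> \<delta>0 \<le> \<delta> j x"
  proof -
    show "\<delta>0 > 0" unfolding \<delta>0_def using \<delta>(1) fin by (subst Min_gr_iff) auto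
    show "\<delta>0 \<le> 1" unfolding \<delta>0_def using fin by (intro Min_le) auto
    show "\<delta>0 \<le> \<delta> j x" if "x \<in> X" for j x unfolding \<delta>0_def using fin that by (intro Min_le) auto
  qed
  obtain u where u: "u \<in> Zk" "\<And>j. \<bar>ell u $ j - \<tau> $ j\<bar> < \<delta>0" using ell_dense[OF \<delta>0(1)] by blast
  define Sl where "Sl R = (\<Union>p\<in>UNIV \<times> X. pts (slab (fst p) (snd p + \<tau> $ fst p) (\<delta> (fst p) (snd p)) B') R)" for R
  have finSl: "finite (Sl R)" for R
    unfolding Sl_def using X(1) by (auto intro!: finite_pts[of _ B'] simp: slab_def)
  have inB': "w \<in> tbox B'" if "c \<in> C" "w = \<tau> + c \<or> w = ell u + c" for w c
  proof -
    have "\<bar>w $ j\<bar> \<le> B'" for j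
    proof -
      have "\<bar>c $ j\<bar> \<le> B" using that C by (auto simp: tbox_def)
      moreover have "\<bar>\<tau> $ j\<bar> \<le> (\<Sum>j\<in>UNIV. \<bar>\<tau> $ j\<bar>)" by (intro member_le_sum) auto
      ultimately show ?thesis using that(2) u(2)[of j] \<delta>0(2) by (auto simp: B'_def abs_le_iff)
    qed
    then show ?thesis by (simp add: tbox_def)
  qed
  have diff: "z \<in> Sl R" if z: "z \<in> pts ((+) a ` C) R" "z \<notin> pts ((+) b ` C) R" and ab: "a = \<tau> \<and> b = ell u \<or> a = ell u \<and> b = \<tau>" for z a b R
  proof -
    define w where "w = ell z"
    have "w - a \<in> C" using z by (auto simp: pts_def w_def)
    moreover have "w - b \<notin> C"
    proof
      assume "w - b \<in> C"
      then have "ell z \<in> (+) b ` C" by (intro image_eqI[of _ _ "w - b"]) (auto simp: w_def)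
      then show False using z by (auto simp: pts_def)
    qed
    ultimately obtain j x where jx: "x \<in> X" 
      "\<not> (((w - a) $ j < x \<longleftrightarrow> (w - b) $ j < x) \<and> ((w - a) $ j \<le> x \<longleftrightarrow> (w - b) $ j \<le> x))"
      using X(2) unfolding threshold_set_def by blast
    then have "\<bar>w $ j - (x + \<tau> $ j)\<bar> \<le> \<delta>0" using ab u(2)[of j] by (auto split: if_splits)
    then have "\<bar>w $ j - (x + \<tau> $ j)\<bar> \<le> \<delta> j x" using \<delta>0(3)[OF jx(1)] by (meson order_trans)
    moreover have "w \<in> tbox B'" using inB'[OF \<open>w - a \<in> C\<close>, of w] ab by auto
    ultimately have "z \<in> pts (slab j (x + \<tau> $ j) (\<delta> j x) B') R" using z(1) by (auto simp: pts_def slab_def w_def)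
    then show ?thesis unfolding Sl_def using jx(1) by force
  qed
  have fins: "finite (pts ((+) a ` C) R)" if "a = \<tau> \<or> a = ell u" for a R
    using inB' that by (intro finite_pts[of _ B']) auto
  have close: "\<bar>real (card (pts ((+) \<tau> ` C) R)) - real (card (pts ((+) (ell u) ` C) R))\<bar> \<le> real (card (Sl R))" for R
  proof -
    have "card (pts ((+) a ` C) R) \<le> card (pts ((+) b ` C) R) + card (Sl R)" 
      if ab: "a = \<tau> \<and> b = ell u \<or> a = ell u \<and> b = \<tau>" for a b
    proof -
      have "card (pts ((+) a ` C) R) \<le> card (pts ((+) b ` C) R \<union> Sl R)"
        using diff[OF _ _ ab] fins ab finSl by (intro card_mono) auto
      also have "\<dots> \<le> card (pts ((+) b ` C) R) + card (Sl R)" by (rule card_Un_le)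
      finally show ?thesis .
    qed
    then have "card (pts ((+) \<tau> ` C) R) \<le> card (pts ((+) (ell u) ` C) R) + card (Sl R)"
      "card (pts ((+) (ell u) ` C) R) \<le> card (pts ((+) \<tau> ` C) R) + card (Sl R)" by simp_all
    then show ?thesis by linarith
  qed
  have "\<forall>\<^sub>F R in at_top. \<forall>p\<in>UNIV \<times> X. real (card (pts (slab (fst p) (snd p + \<tau> $ fst p) (\<delta> (fst p) (snd p)) B') R)) \<le> (\<epsilon> / (4 * M)) * full_count R"
    using X(1) \<delta>(2) by (intro eventually_ball_finite ballI) auto
  moreover have "\<forall>\<^sub>F R in at_top. real (card (shell B (infnorm (\<pi>1 u)) R)) \<le> \<epsilon> / 4 * full_count R"
    using \<epsilon> by (intro eventually_shell_le) simp
  ultimately show "\<forall>\<^sub>F R in at_top. dist ((real (card (pts ((+) \<tau> ` C) R)) - real (card (pts C R))) / full_count R) 0 < \<epsilon>"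
    using full_count_pos
  proof eventually_elim
    case (elim R)
    have "card (Sl R) \<le> (\<Sum>p\<in>UNIV \<times> X. card (pts (slab (fst p) (snd p + \<tau> $ fst p) (\<delta> (fst p) (snd p)) B') R))"
      unfolding Sl_def using X(1) by (intro card_UN_le) simp
    then have "real (card (Sl R)) \<le> (\<Sum>p\<in>UNIV \<times> X. real (card (pts (slab (fst p) (snd p + \<tau> $ fst p) (\<delta> (fst p) (snd p)) B') R)))"
      unfolding of_nat_sum[symmetric] of_nat_le_iff .
    also have "\<dots> \<le> (\<Sum>p\<in>(UNIV :: 'e set) \<times> X. (\<epsilon> / (4 * M)) * full_count R)" using elim(1) by (intro sum_mono) blast
    also have "\<dots> = (M - 1) * ((\<epsilon> / (4 * M)) * full_count R)" by (simp add: M_def card_cartesian_product)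
    also have "\<dots> \<le> M * ((\<epsilon> / (4 * M)) * full_count R)" using \<epsilon> M elim(3) by (intro mult_right_mono) auto
    also have "\<dots> = \<epsilon> / 4 * full_count R" using M by simp
    finally have "\<bar>real (card (pts ((+) \<tau> ` C) R)) - real (card (pts C R))\<bar> \<le> \<epsilon> / 4 * full_count R + \<epsilon> / 4 * full_count R"
      using close[of R] pts_lattice_shift[OF u(1) C, of R] elim(2) by linarith
    also have "\<dots> < \<epsilon> * full_count R" using \<epsilon> elim(3) by (simp add: field_simps)
    finally have "\<bar>(real (card (pts ((+) \<tau> ` C) R)) - real (card (pts C R))) / full_count R\<bar> < \<epsilon>"
      using elim(3) by (simp add: field_simps abs_divide)
    then show ?case by simp
  qed
qed

text \<open>Convergence is not needed: where the limit does not exist, \<open>Lim\<close> is one and the same junk value.\<close>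
lemma Lim_translate:
  assumes X: "finite X" "threshold_set X C" and C: "C \<subseteq> tbox B"
  shows "Lim at_top (\<lambda>R. real (card (pts ((+) \<tau> ` C) R)) / full_count R) = Lim at_top (\<lambda>R. real (card (pts C R)) / full_count R)"
proof -
  let ?a = "\<lambda>R. real (card (pts ((+) \<tau> ` C) R)) / full_count R" and ?b = "\<lambda>R. real (card (pts C R)) / full_count R"
  have d: "((\<lambda>R. ?a R - ?b R) \<longlongrightarrow> 0) at_top"
    using pts_translate[OF assms] by (simp add: diff_divide_distrib)
  have "(?a \<longlongrightarrow> l) at_top \<longleftrightarrow> (?b \<longlongrightarrow> l) at_top" for l
  proof
    assume "(?a \<longlongrightarrow> l) at_top"
    from tendsto_diff[OF this d] show "(?b \<longlongrightarrow> l) at_top" by simp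
  next
    assume "(?b \<longlongrightarrow> l) at_top"
    from tendsto_add[OF this d] show "(?a \<longlongrightarrow> l) at_top" by simp
  qed
  then show ?thesis by (simp add: t2_space_class.Lim_def)
qed

end

section \<open>Cells of the window\<close>

text \<open>\<open>P\<close> is the set of displacements admitted in a patch. Below a first component in the core \<open>N0\<close>
  all relevant displacements are admitted; \<open>N1\<close> is the boundary layer where only some of them are
  (empty for patches of type 2).\<close>
locale cells = cut_project A F0 v s
  for A :: "real^'d::finite^'e::finite" and F0 v s +
  fixes N0 N1 :: "(real^'d) set" and P :: "('d, 'e) pt set"
  assumes fin: "finite N0" "finite N1" and N0_int: "N0 \<subseteq> intvec" and N1_int: "N1 \<subseteq> intvec" and zero: "0 \<in> N0"
    and P_Zk: "P \<subseteq> Zk"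
    and core: "u \<in> Zk \<Longrightarrow> fst u \<in> N0 \<Longrightarrow> ell u \<in> tbox 1 \<Longrightarrow> u \<in> P"
    and P_fst: "u \<in> P \<Longrightarrow> ell u \<in> tbox 1 \<Longrightarrow> fst u \<in> N0 \<union> N1"
begin

definition "S z = {u \<in> P. ell z + ell u \<in> unit_box}"

text \<open>The values of coordinate \<open>j\<close> at which a displacement \<open>u\<close> leads
  exactly to the face 0 of the window. The face 1 contributes the same values, since periods make
  the set invariant under integer translation.\<close>

definition "Q j N = {- ell u $ j | u. u \<in> Zk \<and> fst u \<in> N}"

lemma Q_add_int: "x \<in> Q j N \<Longrightarrow> x + of_int k \<in> Q j N"
proof -
  assume "x \<in> Q j N"
  then obtain u where u: "x = - ell u $ j" "u \<in> Zk" "fst u \<in> N" by (auto simp: Q_def)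
  define g where "g = (\<lambda>i::'e. - k)"
  have "u + shift g \<in> Zk" "fst (u + shift g) \<in> N" using u by (auto intro!: Zk_add shift simp: shift)
  moreover have "x + of_int k = - ell (u + shift g) $ j" by (simp add: u ell_add shift g_def)
  ultimately show ?thesis unfolding Q_def by blast
qed

lemma Q_0: "0 \<in> N \<Longrightarrow> 0 \<in> Q j N"
  unfolding Q_def by (intro CollectI exI[of _ 0]) (simp add: linear_0[OF linear_ell] Zk_iff intvec_0)

lemma Q_1: "0 \<in> N \<Longrightarrow> 1 \<in> Q j N"
  using Q_add_int[OF Q_0[of N j], of 1] by simp

text \<open>After multiplication by the denominator \<open>D\<close>, the values belonging to one
  first component lie in a single class modulo the integers.\<close>

lemma finite_Q: 
  assumes N: "finite N" "N \<subseteq> intvec" shows "finite {x \<in> Q j N. a \<le> x \<and> x \<le> b}"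
proof -
  obtain D :: nat and c where D: "D > 0" "c \<in> intvec" "\<And>z. real D * ell z $ j = c \<bullet> snd z - (A *v fst z) \<bullet> c"
    using ell_integral_form by blast
  define w where "w n = (A *v n) \<bullet> c" for n
  define M where "M = real D * (\<bar>a\<bar> + \<bar>b\<bar>)"
  have "{x \<in> Q j N. a \<le> x \<and> x \<le> b} \<subseteq> (\<Union>n\<in>N. (\<lambda>p. (w n - p) / real D) ` {p \<in> \<int>. \<bar>p\<bar> \<le> M + \<bar>w n\<bar>})"
  proof
    fix x assume x: "x \<in> {x \<in> Q j N. a \<le> x \<and> x \<le> b}"
    then obtain u where u: "x = - ell u $ j" "u \<in> Zk" "fst u \<in> N" by (auto simp: Q_def)
    define p where "p = c \<bullet> snd u"
    have "p \<in> \<int>" using u D(2) by (auto simp: p_def inner_vec_def intvec_def Zk_iff intro!: Ints_sum)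
    have Dx: "real D * x = w (fst u) - p" using D(3)[of u] by (simp add: u w_def p_def)
    have "\<bar>x\<bar> \<le> \<bar>a\<bar> + \<bar>b\<bar>" using x by auto
    then have "\<bar>real D * x\<bar> \<le> M" by (simp add: abs_mult M_def mult_left_mono)
    then have "\<bar>p\<bar> \<le> M + \<bar>w (fst u)\<bar>" using Dx by linarith
    moreover have "x = (w (fst u) - p) / real D" using Dx D(1) by (simp add: field_simps)
    ultimately show "x \<in> (\<Union>n\<in>N. (\<lambda>p. (w n - p) / real D) ` {p \<in> \<int>. \<bar>p\<bar> \<le> M + \<bar>w n\<bar>})"
      using u(3) \<open>p \<in> \<int>\<close> by blast
  qed
  moreover have "finite (\<Union>n\<in>N. (\<lambda>p. (w n - p) / real D) ` {p \<in> \<int>. \<bar>p\<bar> \<le> M + \<bar>w n\<bar>})"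
    by (intro finite_UN_I N(1) finite_imageI finite_Ints_abs_le)
  ultimately show ?thesis by (rule finite_subset)
qed

lemma not_in_Q: "z \<in> shifted_lattice s \<Longrightarrow> ell z $ j \<notin> Q j N"
proof
  assume z: "z \<in> shifted_lattice s" "ell z $ j \<in> Q j N"
  then obtain u where u: "ell z $ j = - ell u $ j" "u \<in> Zk" by (auto simp: Q_def)
  have "ell (z + u) $ j = 0" by (simp add: ell_add u)
  then show False using ell_regular[OF shifted_lattice_add[OF z(1) u(2)]] by blast
qed

definition "lo z j = Max {x \<in> Q j N0. 0 \<le> x \<and> x \<le> 1 \<and> x < ell z $ j}"
definition "hi z j = Min {x \<in> Q j N0. 0 \<le> x \<and> x \<le> 1 \<and> ell z $ j < x}"

lemma lo_hi:
  assumes z: "z \<in> shifted_lattice s" "ell z \<in> unit_box"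
  shows "lo z j \<in> Q j N0" "hi z j \<in> Q j N0" "0 \<le> lo z j" "lo z j < ell z $ j" "ell z $ j < hi z j" "hi z j \<le> 1"
    and "x \<in> Q j N0 \<Longrightarrow> \<not> (lo z j < x \<and> x < hi z j)"
proof -
  let ?L = "{x \<in> Q j N0. 0 \<le> x \<and> x \<le> 1 \<and> x < ell z $ j}" and ?H = "{x \<in> Q j N0. 0 \<le> x \<and> x \<le> 1 \<and> ell z $ j < x}"
  have f: "finite ?L" "finite ?H" by (rule finite_subset[OF _ finite_Q[OF fin(1) N0_int, of j 0 1]]; auto)+
  have "ell z $ j \<noteq> 0" "ell z $ j \<noteq> 1" using not_in_Q[OF z(1)] Q_0[OF zero] Q_1[OF zero] by metis+
  then have "0 < ell z $ j" "ell z $ j < 1" using z(2) by (auto simp: unit_box_def order.strict_iff_order)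
  then have "0 \<in> ?L" "1 \<in> ?H" using Q_0[OF zero] Q_1[OF zero] by auto
  then have "lo z j \<in> ?L" "hi z j \<in> ?H" unfolding lo_def hi_def using f by (intro Max_in Min_in; blast)+
  then show b: "lo z j \<in> Q j N0" "hi z j \<in> Q j N0" "0 \<le> lo z j" "lo z j < ell z $ j" "ell z $ j < hi z j" "hi z j \<le> 1"
    by auto
  assume x: "x \<in> Q j N0"
  show "\<not> (lo z j < x \<and> x < hi z j)"
  proof
    assume *: "lo z j < x \<and> x < hi z j"
    have "x \<noteq> ell z $ j" using not_in_Q[OF z(1)] x by metis
    then have "x \<in> ?L \<or> x \<in> ?H" using x * b by auto
    then show False
    proof
      assume "x \<in> ?L" then have "x \<le> lo z j" unfolding lo_def by (intro Max_ge f)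
      then show False using * by simp
    next
      assume "x \<in> ?H" then have "hi z j \<le> x" unfolding hi_def by (intro Min_le f)
      then show False using * by simp
    qed
  qed
qed

text \<open>Only displacements with \<open>ell u \<in> tbox 1\<close> are tested, because any other
  leads out of the unit cube from each of its points.\<close>

definition "cell z0 = {t. (\<forall>j. lo z0 j < t $ j \<and> t $ j < hi z0 j) \<and> 
   (\<forall>u\<in>P. ell u \<in> tbox 1 \<longrightarrow> (t + ell u \<in> unit_box \<longleftrightarrow> ell z0 + ell u \<in> unit_box))}"

lemma unit_box_diff: "t \<in> unit_box \<Longrightarrow> t + w \<in> unit_box \<Longrightarrow> w \<in> tbox 1"
  unfolding unit_box_def tbox_def mem_Collect_eq
proof
  fix j assume "\<forall>j. 0 \<le> t $ j \<and> t $ j \<le> 1" "\<forall>j. 0 \<le> (t + w) $ j \<and> (t + w) $ j \<le> 1"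
  then have "0 \<le> t $ j" "t $ j \<le> 1" "0 \<le> t $ j + w $ j" "t $ j + w $ j \<le> 1" by (metis vector_add_component)+
  then show "\<bar>w $ j\<bar> \<le> 1" by linarith
qed

text \<open>Since the window tiles \<open>F\<close> under its lattice of periods, every integer vector with first
  component in \<open>N0\<close> has a translate by periods which is visible from \<open>z0\<close>; hence equality of the
  visible sets pins down every coordinate of the second point between the neighbouring hyperplanes.\<close>
lemma visible_translate:
  assumes z0: "z0 \<in> shifted_lattice s" "ell z0 \<in> unit_box" and x: "x \<in> Q j N0"
    and k: "0 \<le> ell z0 $ j - x + of_int k" "ell z0 $ j - x + of_int k \<le> 1"
  shows "\<exists>u \<in> S z0. ell u $ j = of_int k - x"
proof -
  obtain u where u: "x = - ell u $ j" "u \<in> Zk" "fst u \<in> N0" using x by (auto simp: Q_def)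
  define g where "g i = (if i = j then k else - \<lfloor>ell z0 $ i + ell u $ i\<rfloor>)" for i
  define w where "w = u + shift g"
  have w: "w \<in> Zk" "fst w \<in> N0" using u by (auto simp: w_def shift intro!: Zk_add shift)
  have "0 \<le> (ell z0 + ell w) $ i \<and> (ell z0 + ell w) $ i \<le> 1" for i
  proof (cases "i = j")
    case True
    then show ?thesis using k by (simp add: w_def ell_add shift g_def u algebra_simps)
  next
    case False
    have "(ell z0 + ell w) $ i = frac (ell z0 $ i + ell u $ i)"
      using False by (simp add: w_def ell_add shift g_def frac_def)
    then show ?thesis by (simp add: less_imp_le[OF frac_lt_1])
  qed
  then have "ell z0 + ell w \<in> unit_box" by (simp add: unit_box_def)
  moreover then have "w \<in> P" using w unit_box_diff[OF z0(2)] by (intro core)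
  ultimately have "w \<in> S z0" by (simp add: S_def)
  moreover have "ell w $ j = of_int k - x" by (simp add: w_def ell_add shift g_def u)
  ultimately show ?thesis by blast
qed

text \<open>Strict bounds of the cell and closed faces of the window are compatible because no
  lattice point has a coordinate in \<open>Q j N0\<close>.\<close>

lemma cell_iff:
  assumes z0: "z0 \<in> shifted_lattice s" "ell z0 \<in> unit_box" and z: "z \<in> shifted_lattice s"
  shows "ell z \<in> cell z0 \<longleftrightarrow> ell z \<in> unit_box \<and> S z = S z0"
proof
  assume c: "ell z \<in> cell z0"
  then have b: "lo z0 j < ell z $ j" "ell z $ j < hi z0 j" for j by (auto simp: cell_def)
  have "0 \<le> ell z $ j \<and> ell z $ j \<le> 1" for j using b[of j] lo_hi(3,6)[OF z0, of j] by linarith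
  then have u: "ell z \<in> unit_box" by (simp add: unit_box_def)
  have "w \<in> S z \<longleftrightarrow> w \<in> S z0" for w
  proof (cases "w \<in> P \<and> ell w \<in> tbox 1")
    case True
    then show ?thesis using c by (auto simp: cell_def S_def)
  next
    case False
    then show ?thesis using unit_box_diff[OF u, of "ell w"] unit_box_diff[OF z0(2), of "ell w"] by (auto simp: S_def)
  qed
  then show "ell z \<in> unit_box \<and> S z = S z0" using u by blast
next
  assume *: "ell z \<in> unit_box \<and> S z = S z0"
  have "lo z0 j < ell z $ j \<and> ell z $ j < hi z0 j" for j
  proof
    have "ell z0 $ j \<le> 1" using z0(2) by (simp add: unit_box_def)
    \<comment> \<open>The displacement attached to the lower bound meets the face 0 as it stands
      (\<open>k = 0\<close>); for the upper bound a translate by one period meets the face 1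
      (\<open>k = 1\<close>). Visibility from \<open>z\<close> is then the required
      inequality.\<close>
    then obtain u where "u \<in> S z0" "ell u $ j = of_int 0 - lo z0 j"
      using visible_translate[OF z0 lo_hi(1)[OF z0, of j], of 0] lo_hi(3,4)[OF z0, of j] by force
    moreover then have "u \<in> S z" using * by simp
    then have "0 \<le> (ell z + ell u) $ j" unfolding S_def unit_box_def by blast
    ultimately have "0 \<le> ell z $ j - lo z0 j" by simp
    moreover have "ell z $ j \<noteq> lo z0 j" using not_in_Q[OF z] lo_hi(1)[OF z0] by metis
    ultimately show "lo z0 j < ell z $ j" by linarith
    have "0 \<le> ell z0 $ j" using z0(2) by (simp add: unit_box_def)
    then obtain u where "u \<in> S z0" "ell u $ j = of_int 1 - hi z0 j"
      using visible_translate[OF z0 lo_hi(2)[OF z0, of j], of 1] lo_hi(5,6)[OF z0, of j] by force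
    moreover then have "u \<in> S z" using * by simp
    then have "(ell z + ell u) $ j \<le> 1" unfolding S_def unit_box_def by blast
    ultimately have "ell z $ j + (1 - hi z0 j) \<le> 1" by simp
    moreover have "ell z $ j \<noteq> hi z0 j" using not_in_Q[OF z] lo_hi(2)[OF z0] by metis
    ultimately show "ell z $ j < hi z0 j" by linarith
  qed
  moreover have "ell z + ell u \<in> unit_box \<longleftrightarrow> ell z0 + ell u \<in> unit_box" if "u \<in> P" for u
    using * that by (auto simp: S_def)
  ultimately show "ell z \<in> cell z0" by (auto simp: cell_def)
qed

section \<open>Cells up to translation\<close>

definition "lov z0 = (\<chi> j. lo z0 j)"

definition "rel z0 = {t. lov z0 + t \<in> cell z0}"

lemma cell_eq_rel: "cell z0 = (+) (lov z0) ` rel z0"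
  by (auto simp: rel_def intro!: image_eqI[of _ _ "_ - lov z0"])

text \<open>The thresholds that matter inside the translated cell: the two sides of the box and the
  layer hyperplanes that cross it.\<close>

definition "cuts z0 j = {0, hi z0 j - lo z0 j} \<union> {x - lo z0 j | x. x \<in> Q j N1 \<and> lo z0 j < x \<and> x < hi z0 j}"

lemma finite_cuts: "finite (cuts z0 j)"
proof -
  have "{x - lo z0 j | x. x \<in> Q j N1 \<and> lo z0 j < x \<and> x < hi z0 j} \<subseteq> (\<lambda>x. x - lo z0 j) ` {x \<in> Q j N1. lo z0 j \<le> x \<and> x \<le> hi z0 j}"
    by auto
  then show ?thesis unfolding cuts_def
    using finite_Q[OF fin(2) N1_int] finite_subset by blast
qed

text \<open>No core hyperplane runs strictly between the sides of the box. A comparison with a value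
  of \<open>Q j N0\<close> or \<open>Q j N1\<close> is therefore either constant on the box or a
  comparison with a cut.\<close>

lemma rel_cuts:
  assumes z0: "z0 \<in> shifted_lattice s" "ell z0 \<in> unit_box"
    and same: "\<And>j x. x \<in> cuts z0 j \<Longrightarrow> (t $ j < x \<longleftrightarrow> t' $ j < x) \<and> (t $ j \<le> x \<longleftrightarrow> t' $ j \<le> x)"
    and t: "t \<in> rel z0"
  shows "t' \<in> rel z0"
proof -
  have box: "lo z0 j < lo z0 j + t $ j \<and> lo z0 j + t $ j < hi z0 j" for j
    using t by (auto simp: rel_def cell_def lov_def)
  have box': "lo z0 j < lo z0 j + t' $ j \<and> lo z0 j + t' $ j < hi z0 j" for j
    using same[of 0 j] same[of "hi z0 j - lo z0 j" j] box[of j] by (auto simp: cuts_def)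
  have cmp: "x \<le> lo z0 j + t $ j \<longleftrightarrow> x \<le> lo z0 j + t' $ j" "lo z0 j + t $ j \<le> x \<longleftrightarrow> lo z0 j + t' $ j \<le> x"
    if x: "x \<in> Q j N0 \<union> Q j N1" for x j
  proof -
    consider "x \<le> lo z0 j" | "hi z0 j \<le> x" | "lo z0 j < x" "x < hi z0 j" by linarith
    then have "(x \<le> lo z0 j + t $ j \<longleftrightarrow> x \<le> lo z0 j + t' $ j) \<and> (lo z0 j + t $ j \<le> x \<longleftrightarrow> lo z0 j + t' $ j \<le> x)"
    proof cases
      case 3
      then have "x - lo z0 j \<in> cuts z0 j" using x lo_hi(7)[OF z0] by (auto simp: cuts_def)
      then show ?thesis using same by (smt (verit))
    qed (use box[of j] box'[of j] in linarith)+
    then show "x \<le> lo z0 j + t $ j \<longleftrightarrow> x \<le> lo z0 j + t' $ j" "lo z0 j + t $ j \<le> x \<longleftrightarrow> lo z0 j + t' $ j \<le> x" by auto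
  qed
  have "lov z0 + t' + ell u \<in> unit_box \<longleftrightarrow> ell z0 + ell u \<in> unit_box" if u: "u \<in> P" "ell u \<in> tbox 1" for u
  proof -
    have "0 \<le> (lov z0 + t + ell u) $ j \<and> (lov z0 + t + ell u) $ j \<le> 1 \<longleftrightarrow> 0 \<le> (lov z0 + t' + ell u) $ j \<and> (lov z0 + t' + ell u) $ j \<le> 1" for j
    proof -
      have uQ: "- ell u $ j \<in> Q j N0 \<union> Q j N1"
      proof -
        have "u \<in> Zk" using u(1) P_Zk by blast
        then show ?thesis using P_fst[OF u] unfolding Q_def by blast
      qed
      then have "- ell u $ j + of_int 1 \<in> Q j N0 \<union> Q j N1" using Q_add_int by blast
      from cmp(1)[OF uQ] cmp(2)[OF this] show ?thesis by (auto simp: lov_def)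
    qed
    then have "lov z0 + t + ell u \<in> unit_box \<longleftrightarrow> lov z0 + t' + ell u \<in> unit_box" by (simp only: unit_box_def mem_Collect_eq)
    moreover have "lov z0 + t + ell u \<in> unit_box \<longleftrightarrow> ell z0 + ell u \<in> unit_box"
      using t u by (auto simp: rel_def cell_def)
    ultimately show ?thesis by simp
  qed
  then show ?thesis using box' by (auto simp: rel_def cell_def lov_def)
qed

definition "class_freq z0 = Lim at_top (\<lambda>R. real (card {z \<in> shifted_lattice s. ell z \<in> unit_box \<and> infnorm (\<pi>1 z) \<le> R \<and> S z = S z0}) / full_count R)"

definition "Z = {z \<in> shifted_lattice s. ell z \<in> unit_box}"

lemma class_freq_rel:
  assumes z0: "z0 \<in> Z"
  shows "class_freq z0 = Lim at_top (\<lambda>R. real (card (pts (rel z0) R)) / full_count R)"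
proof -
  have z: "z0 \<in> shifted_lattice s" "ell z0 \<in> unit_box" using z0 by (auto simp: Z_def)
  have "{z \<in> shifted_lattice s. ell z \<in> unit_box \<and> infnorm (\<pi>1 z) \<le> R \<and> S z = S z0} = pts (cell z0) R" for R
    using cell_iff[OF z] by (auto simp: pts_def)
  then have "class_freq z0 = Lim at_top (\<lambda>R. real (card (pts ((+) (lov z0) ` rel z0) R)) / full_count R)"
    by (simp add: class_freq_def cell_eq_rel)
  also have "\<dots> = Lim at_top (\<lambda>R. real (card (pts (rel z0) R)) / full_count R)"
  proof (rule Lim_translate)
    show "finite (\<Union>j. cuts z0 j)" using finite_cuts by simp
    show "threshold_set (\<Union>j. cuts z0 j) (rel z0)"
      unfolding threshold_set_def
    proof (intro allI impI)
      fix t t' :: "real^'e" assume *: "\<forall>j. \<forall>x\<in>\<Union>j. cuts z0 j. (t $ j < x \<longleftrightarrow> t' $ j < x) \<and> (t $ j \<le> x \<longleftrightarrow> t' $ j \<le> x)"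
      show "t \<in> rel z0 \<longleftrightarrow> t' \<in> rel z0"
        using rel_cuts[OF z, of t t'] rel_cuts[OF z, of t' t] * by blast
    qed
    show "rel z0 \<subseteq> tbox 1"
    proof
      fix t assume t: "t \<in> rel z0"
      have "\<bar>t $ j\<bar> \<le> 1" for j
      proof -
        have "lo z0 j < lo z0 j + t $ j \<and> lo z0 j + t $ j < hi z0 j" using t by (auto simp: rel_def cell_def lov_def)
        then show ?thesis using lo_hi(3,6)[OF z, of j] by linarith
      qed
      then show "t \<in> tbox 1" by (simp add: tbox_def)
    qed
  qed
  finally show ?thesis .
qed

text \<open>The position of \<open>t\<close> among the thresholds \<open>X\<close>. Both comparisons
  are recorded, so that points on a hyperplane are told apart from those beside it.\<close>

definition sig :: "('e \<Rightarrow> real set) \<Rightarrow> real^'e \<Rightarrow> 'e \<Rightarrow> real set \<times> real set" where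
  "sig X t = (\<lambda>j. ({x \<in> X j. t $ j < x}, {x \<in> X j. t $ j \<le> x}))"

text \<open>A translated cell is determined by its cuts and by the set of signatures realised in it.
  With at most \<open>L\<close> cuts there are at most \<open>4 ^ L\<close> signatures per
  coordinate, so up to a constant factor only the choices of cuts count.\<close>

lemma card_rel_le:
  assumes X: "\<And>j. finite (XX j)" "\<And>z0 j. z0 \<in> Z \<Longrightarrow> cuts z0 j \<in> XX j" "\<And>z0 j. z0 \<in> Z \<Longrightarrow> card (cuts z0 j) \<le> L"
  shows "finite (class_freq ` Z)" 
    and "card (class_freq ` Z) \<le> (\<Prod>j\<in>UNIV. card (XX j)) * 2 ^ ((4 ^ L) ^ CARD('e))"
proof -
  define XL where "XL j = {Y \<in> XX j. finite Y \<and> card Y \<le> L}" for j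
  define T where "T = (SIGMA X : PiE UNIV XL. Pow (PiE UNIV (\<lambda>j. Pow (X j) \<times> Pow (X j))))"
  have finXL: "finite (PiE UNIV XL)" using X(1) by (intro finite_PiE) (auto simp: XL_def)
  have finX: "finite (PiE UNIV (\<lambda>j. Pow (X j) \<times> Pow (X j)))" if "X \<in> PiE UNIV XL" for X
    using that by (intro finite_PiE) (auto simp: XL_def PiE_iff)
  have finT: "finite T" unfolding T_def using finXL finX by (intro finite_SigmaI) auto
  have sub: "rel ` Z \<subseteq> (\<lambda>(X, \<Sigma>). {t. sig X t \<in> \<Sigma>}) ` T"
  proof
    fix C assume "C \<in> rel ` Z"
    then obtain z0 where z0: "z0 \<in> Z" "C = rel z0" by blast
    then have z: "z0 \<in> shifted_lattice s" "ell z0 \<in> unit_box" by (auto simp: Z_def)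
    let ?X = "cuts z0" and ?\<Sigma> = "sig (cuts z0) ` rel z0"
    have "?X \<in> PiE UNIV XL" using X(2,3)[OF z0(1)] finite_cuts[of z0] by (auto simp: XL_def)
    moreover have "?\<Sigma> \<subseteq> PiE UNIV (\<lambda>j. Pow (?X j) \<times> Pow (?X j))" by (auto simp: sig_def)
    ultimately have "(?X, ?\<Sigma>) \<in> T" by (simp add: T_def)
    moreover have "rel z0 = {t. sig ?X t \<in> ?\<Sigma>}"
    proof (intro set_eqI iffI)
      fix t' assume "t' \<in> {t. sig ?X t \<in> ?\<Sigma>}"
      then obtain t where t: "t \<in> rel z0" "sig ?X t' = sig ?X t" by auto
      show "t' \<in> rel z0"
      proof (rule rel_cuts[OF z _ t(1)])
        fix j x assume x: "x \<in> ?X j"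
        have "{x \<in> ?X j. t' $ j < x} = {x \<in> ?X j. t $ j < x} \<and> {x \<in> ?X j. t' $ j \<le> x} = {x \<in> ?X j. t $ j \<le> x}"
          using fun_cong[OF t(2), of j] by (simp only: sig_def prod.inject)
        then show "(t $ j < x \<longleftrightarrow> t' $ j < x) \<and> (t $ j \<le> x \<longleftrightarrow> t' $ j \<le> x)" using x by blast
      qed
    qed auto
    ultimately show "C \<in> (\<lambda>(X, \<Sigma>). {t. sig X t \<in> \<Sigma>}) ` T" using z0 by (intro image_eqI[of _ _ "(?X, ?\<Sigma>)"]) auto
  qed
  have eq: "class_freq ` Z = (\<lambda>C. Lim at_top (\<lambda>R. real (card (pts C R)) / full_count R)) ` rel ` Z"
    unfolding image_image by (rule image_cong[OF refl class_freq_rel])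
  have finrel: "finite (rel ` Z)" by (rule finite_subset[OF sub finite_imageI[OF finT]])
  then show "finite (class_freq ` Z)" unfolding eq by (rule finite_imageI)
  have "card (class_freq ` Z) \<le> card (rel ` Z)" unfolding eq by (rule card_image_le[OF finrel])
  also have "\<dots> \<le> card ((\<lambda>(X, \<Sigma>). {t. sig X t \<in> \<Sigma>}) ` T)" by (rule card_mono[OF finite_imageI[OF finT] sub])
  also have "\<dots> \<le> card T" by (rule card_image_le[OF finT])
  also have "\<dots> = (\<Sum>X\<in>PiE UNIV XL. card (Pow (PiE UNIV (\<lambda>j. Pow (X j) \<times> Pow (X j)))))"
    unfolding T_def using finXL finX by (intro card_SigmaI) auto
  also have "\<dots> \<le> (\<Sum>X\<in>PiE UNIV XL. 2 ^ ((4 ^ L) ^ CARD('e)))"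
  proof (rule sum_mono)
    fix X assume X: "X \<in> PiE UNIV XL"
    have "card (PiE UNIV (\<lambda>j. Pow (X j) \<times> Pow (X j))) = (\<Prod>j\<in>UNIV. 2 ^ card (X j) * 2 ^ card (X j))"
      using X by (subst card_PiE) (auto simp: XL_def card_cartesian_product card_Pow PiE_iff)
    also have "\<dots> \<le> (\<Prod>j\<in>(UNIV::'e set). 4 ^ L)"
    proof (rule prod_mono)
      fix j
      have "(2::nat) ^ card (X j) * 2 ^ card (X j) = 4 ^ card (X j)" by (simp flip: power_mult_distrib)
      also have "\<dots> \<le> 4 ^ L" using X by (intro power_increasing) (auto simp: XL_def PiE_iff)
      finally show "0 \<le> (2::nat) ^ card (X j) * 2 ^ card (X j) \<and> (2::nat) ^ card (X j) * 2 ^ card (X j) \<le> 4 ^ L" by simp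
    qed
    finally have "card (PiE UNIV (\<lambda>j. Pow (X j) \<times> Pow (X j))) \<le> (4 ^ L) ^ CARD('e)" by simp
    then show "card (Pow (PiE UNIV (\<lambda>j. Pow (X j) \<times> Pow (X j)))) \<le> 2 ^ ((4 ^ L) ^ CARD('e))"
      using finX[OF X] by (simp add: card_Pow)
  qed
  also have "\<dots> = (\<Prod>j\<in>UNIV. card (XL j)) * 2 ^ ((4 ^ L) ^ CARD('e))" by (simp add: card_PiE)
  also have "\<dots> \<le> (\<Prod>j\<in>UNIV. card (XX j)) * 2 ^ ((4 ^ L) ^ CARD('e))"
    using X(1) by (intro mult_right_mono prod_mono) (auto simp: XL_def intro!: card_mono)
  finally show "card (class_freq ` Z) \<le> (\<Prod>j\<in>UNIV. card (XX j)) * 2 ^ ((4 ^ L) ^ CARD('e))" .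
qed

end

section \<open>Counting cells\<close>

context cells
begin

text \<open>Two points of one layer \<open>n $ i = \<kappa>'\<close> differ by a vector with a vanishing coordinate, so a gap contains
  at most one of them. A single layer point, named by its offset in \<open>H\<close> from the lower end of the gap,
  fixes the \<open>i\<close>-th coordinate \<open>\<nu>\<close> of that end and thereby all other layer points in direction \<open>i\<close>.
  Together with the gap itself this makes \<open>d + 1\<close> choices of elements of \<open>H\<close>.\<close>
lemma cuts_family:
  fixes j :: 'e and D :: nat and c :: "real^'e" and \<rho> \<tau> M :: real and Ks :: "real set" and \<kappa> :: nat
  defines "u \<equiv> \<lambda>q. (A *v q) \<bullet> c"
  defines "H \<equiv> {h \<in> ibox (4 * M). u h \<in> near_int (2 * real D * \<tau>)}"
  assumes D: "D > 0" and c: "c \<in> intvec" and form: "\<And>z. real D * ell z $ j = c \<bullet> snd z - (A *v fst z) \<bullet> c"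
    and \<tau>: "\<tau> > 0" "2 * real D * \<tau> < 1"
    and cover: "\<And>x. \<exists>q\<in>intvec. (\<forall>i. \<bar>q $ i\<bar> \<le> \<rho>) \<and> x - u q \<in> near_int \<tau>"
    and N0_big: "\<And>q. q \<in> intvec \<Longrightarrow> (\<forall>i. \<bar>q $ i\<bar> \<le> \<rho>) \<Longrightarrow> real D *\<^sub>R q \<in> N0"
    and N_small: "N0 \<union> N1 \<subseteq> ibox M"
    and faces: "\<And>h. h \<in> ibox (4 * M) \<Longrightarrow> h \<noteq> 0 \<Longrightarrow> \<exists>i. h $ i = 0 \<Longrightarrow> u h \<notin> near_int (2 * real D * \<tau>)"
    and Ks: "finite Ks" "card Ks \<le> \<kappa>" "\<And>n. n \<in> N1 \<Longrightarrow> \<exists>i. n $ i \<in> Ks"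
  shows "\<exists>XX. finite XX \<and> (\<forall>z0\<in>Z. cuts z0 j \<in> XX \<and> card (cuts z0 j) \<le> 2 + CARD('d) * \<kappa>) \<and>
    card XX \<le> card H * (1 + \<kappa> * card H * 2 ^ \<kappa>) ^ CARD('d)"
proof -
  have finH: "finite H" unfolding H_def by (rule finite_subset[OF _ finite_ibox]) auto
  have M0: "M \<ge> 0" using N_small zero by (auto simp: ibox_def)
  \<comment> \<open>Candidates for gap lengths. Both ends of a gap come from vectors in the box of
    radius \<open>M\<close>, so their difference lies in that of radius \<open>2 * M\<close>;
    comparing two such differences leads to \<open>4 * M\<close>.\<close>
  define \<Gamma> where "\<Gamma> = {x. 0 < x \<and> x \<le> 2 * \<tau> \<and> (\<exists>w\<in>Zk. fst w \<in> ibox (2 * M) \<and> x = ell w $ j)}"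
  define Th where "Th i \<nu> = {x. 0 < x \<and> x \<le> 2 * \<tau> \<and> (\<exists>w\<in>Zk. fst w \<in> ibox (2 * M) \<and> x = ell w $ j \<and> fst w $ i = \<nu>)}" for i and \<nu> :: real
  have near: "u (fst w) \<in> near_int (2 * real D * \<tau>)" if "w \<in> Zk" "\<bar>ell w $ j\<bar> \<le> 2 * \<tau>" for w
  proof -
    have "c \<bullet> snd w \<in> \<int>" using that c by (auto simp: inner_vec_def intvec_def Zk_iff intro!: Ints_sum)
    then obtain p where p: "c \<bullet> snd w = of_int p" by (auto elim: Ints_cases)
    have "u (fst w) - of_int p = - (real D * ell w $ j)" using form[of w] p by (simp add: u_def)
    then have "\<bar>u (fst w) - of_int p\<bar> = real D * \<bar>ell w $ j\<bar>" by (simp add: abs_mult)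
    also have "\<dots> \<le> real D * (2 * \<tau>)" using that(2) by (intro mult_left_mono) auto
    finally show ?thesis unfolding near_int_def by (auto simp: mult_ac)
  qed
  \<comment> \<open>Equal first components make \<open>D\<close> times the difference an integer,
    and \<open>2 * real D * \<tau> < 1\<close> forces it to vanish. A short offset is thus
    determined by its first component.\<close>
  have same_fst: "ell w $ j = ell w' $ j" if "w \<in> Zk" "w' \<in> Zk" "fst w = fst w'" "\<bar>ell w $ j - ell w' $ j\<bar> \<le> 2 * \<tau>" for w w'
  proof -
    have "w - w' \<in> Zk" using that by (intro Zk_diff)
    then have "c \<bullet> snd (w - w') \<in> \<int>" using c by (auto simp: inner_vec_def intvec_def Zk_iff intro!: Ints_sum)
    moreover have eq: "real D * ell (w - w') $ j = c \<bullet> snd (w - w')" using form[of "w - w'"] that(3) by simp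
    moreover have "\<bar>real D * ell (w - w') $ j\<bar> < 1"
    proof -
      have "\<bar>real D * ell (w - w') $ j\<bar> = real D * \<bar>ell w $ j - ell w' $ j\<bar>" by (simp add: ell_diff abs_mult)
      also have "\<dots> \<le> real D * (2 * \<tau>)" using that(4) by (intro mult_left_mono) auto
      finally show ?thesis using \<tau>(2) by simp
    qed
    ultimately have "real D * ell (w - w') $ j = 0" using Ints_nonzero_abs_less1 by metis
    then show ?thesis using D by (simp add: ell_diff)
  qed
  have fst_diff: "fst (w - w') \<in> ibox (N + N')" if "fst w \<in> ibox N" "fst w' \<in> ibox N'" for w w' :: "('d, 'e) pt" and N N'
  proof -
    have "\<bar>fst w $ i - fst w' $ i\<bar> \<le> N + N'" for i
    proof -
      have "\<bar>fst w $ i\<bar> \<le> N" "\<bar>fst w' $ i\<bar> \<le> N'" using that by (auto simp: ibox_def)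
      then show ?thesis by linarith
    qed
    then show ?thesis using that by (auto simp: ibox_def intvec_diff)
  qed
  have gap: "hi z0 j - lo z0 j \<le> 2 * \<tau>" if z0: "z0 \<in> Z" for z0
  proof (rule ccontr)
    assume big: "\<not> ?thesis"
    have z: "z0 \<in> shifted_lattice s" "ell z0 \<in> unit_box" using z0 by (auto simp: Z_def)
    \<comment> \<open>In a gap longer than \<open>2 * \<tau>\<close>, covering the midpoint up to
      \<tau> would put a core hyperplane strictly inside.\<close>
    define x where "x = (lo z0 j + hi z0 j) / 2"
    obtain q where q: "q \<in> intvec" "\<forall>i. \<bar>q $ i\<bar> \<le> \<rho>" "x - u q \<in> near_int \<tau>" using cover by blast
    then obtain p where p: "\<bar>x - u q - of_int p\<bar> \<le> \<tau>" by (auto simp: near_int_def)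
    \<comment> \<open>The factor \<open>D\<close> cancels the denominator: this vector has
      \<open>j\<close>-th coordinate exactly \<open>- u q\<close>.\<close>
    define w where "w = (real D *\<^sub>R q, 0 :: real^'e)"
    have "real D *\<^sub>R q \<in> intvec" using q(1) by (auto simp: intvec_def)
    then have "w \<in> Zk" by (simp add: w_def Zk_iff intvec_0)
    moreover have "fst w \<in> N0" using N0_big[OF q(1,2)] by (simp add: w_def)
    moreover have "u q = - ell w $ j"
    proof -
      have "real D * ell w $ j = - (real D * u q)" using form[of w] by (simp add: w_def u_def matrix_vector_mult_scaleR)
      then have "real D * (ell w $ j + u q) = 0" by (simp add: algebra_simps)
      then show ?thesis using D by simp
    qed
    ultimately have "u q \<in> Q j N0" unfolding Q_def by blast
    then have "u q + of_int p \<in> Q j N0" by (rule Q_add_int)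
    then have "\<not> (lo z0 j < u q + of_int p \<and> u q + of_int p < hi z0 j)" by (rule lo_hi(7)[OF z])
    moreover have "lo z0 j < u q + of_int p" "u q + of_int p < hi z0 j" using p big unfolding x_def by (auto simp: abs_le_iff field_simps)
    ultimately show False by blast
  qed
  have card_Th: "card (Th i \<nu>) \<le> 1 \<and> finite (Th i \<nu>)" for i \<nu>
  proof -
    have "x = x'" if xTh: "x \<in> Th i \<nu>" "x' \<in> Th i \<nu>" for x x'
    proof -
      obtain w w' where w: "w \<in> Zk" "fst w \<in> ibox (2 * M)" "x = ell w $ j" "fst w $ i = \<nu>"
         "w' \<in> Zk" "fst w' \<in> ibox (2 * M)" "x' = ell w' $ j" "fst w' $ i = \<nu>"
        using xTh unfolding Th_def by blast
      have xx: "\<bar>x - x'\<bar> \<le> 2 * \<tau>" using xTh by (auto simp: Th_def)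
      have "u (fst (w - w')) \<in> near_int (2 * real D * \<tau>)"
        using xx w by (intro near Zk_diff) (simp_all add: ell_diff)
      moreover have "fst (w - w') \<in> ibox (4 * M)" using fst_diff[OF w(2,6)] by simp
      moreover have "fst (w - w') $ i = 0" using w by simp
      ultimately have "fst (w - w') = 0" using faces by blast
      then show ?thesis using same_fst[OF w(1,5)] xx w(3,7) by simp
    qed
    then show ?thesis
    proof (cases "Th i \<nu> = {}")
      case False
      then obtain x where "Th i \<nu> \<subseteq> {x}" using \<open>\<And>x x'. x \<in> Th i \<nu> \<Longrightarrow> x' \<in> Th i \<nu> \<Longrightarrow> x = x'\<close> by blast
      from card_mono[OF _ this] finite_subset[OF this] show ?thesis by simp
    qed simp
  qed
  have card_\<Gamma>: "finite \<Gamma> \<and> card \<Gamma> \<le> card H"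
  proof -
    have "\<forall>x\<in>\<Gamma>. \<exists>w\<in>Zk. fst w \<in> ibox (2 * M) \<and> x = ell w $ j" unfolding \<Gamma>_def by blast
    then obtain W where W: "\<And>x. x \<in> \<Gamma> \<Longrightarrow> W x \<in> Zk \<and> fst (W x) \<in> ibox (2 * M) \<and> x = ell (W x) $ j" by metis
    have rng: "0 < x" "x \<le> 2 * \<tau>" if "x \<in> \<Gamma>" for x using that by (auto simp: \<Gamma>_def)
    have "(\<lambda>x. fst (W x)) ` \<Gamma> \<subseteq> H"
    proof (rule image_subsetI)
      fix x assume x: "x \<in> \<Gamma>"
      have "u (fst (W x)) \<in> near_int (2 * real D * \<tau>)" using W[OF x] rng[OF x] by (intro near) auto
      moreover have "fst (W x) \<in> ibox (4 * M)" using W[OF x] M0 ibox_mono[of "2 * M" "4 * M"] by auto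
      ultimately show "fst (W x) \<in> H" by (simp add: H_def)
    qed
    moreover have "inj_on (\<lambda>x. fst (W x)) \<Gamma>"
    proof (rule inj_onI)
      fix x y assume xy: "x \<in> \<Gamma>" "y \<in> \<Gamma>" "fst (W x) = fst (W y)"
      have "\<bar>x - y\<bar> \<le> 2 * \<tau>" using rng[OF xy(1)] rng[OF xy(2)] by linarith
      then show "x = y" using same_fst[of "W x" "W y"] W[OF xy(1)] W[OF xy(2)] xy(3) by metis
    qed
    ultimately show ?thesis using finH by (meson card_inj_on_le inj_on_finite)
  qed
  \<comment> \<open>If the lower end has \<open>i\<close>-th coordinate \<nu>, a point of the layer
    \<kappa>' has an offset vector with \<open>i\<close>-th coordinate
    \<open>\<nu> - \<kappa>'\<close>, which leaves at most one value for the offset.\<close>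
  define \<Psi> where "\<Psi> i \<nu> = (\<Union>\<kappa>'\<in>Ks. Th i (\<nu> - \<kappa>'))" for i and \<nu> :: real
  have \<Psi>: "finite (\<Psi> i \<nu>) \<and> card (\<Psi> i \<nu>) \<le> \<kappa>" for i \<nu>
  proof
    show "finite (\<Psi> i \<nu>)" unfolding \<Psi>_def using Ks(1) card_Th by auto
    have "card (\<Psi> i \<nu>) \<le> (\<Sum>\<kappa>'\<in>Ks. card (Th i (\<nu> - \<kappa>')))" unfolding \<Psi>_def by (rule card_UN_le[OF Ks(1)])
    also have "\<dots> \<le> (\<Sum>\<kappa>'\<in>Ks. 1)" using card_Th by (intro sum_mono) blast
    finally show "card (\<Psi> i \<nu>) \<le> \<kappa>" using Ks(2) by simp
  qed
  define Nu where "Nu i = (\<lambda>(\<kappa>', h). \<kappa>' + h $ i) ` (Ks \<times> H)" for i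
  have Nu: "finite (Nu i) \<and> card (Nu i) \<le> \<kappa> * card H" for i
  proof
    show "finite (Nu i)" unfolding Nu_def using Ks(1) finH by auto
    have "card (Nu i) \<le> card (Ks \<times> H)" unfolding Nu_def using Ks(1) finH by (intro card_image_le) auto
    also have "\<dots> \<le> \<kappa> * card H" using Ks(2) by (simp add: card_cartesian_product)
    finally show "card (Nu i) \<le> \<kappa> * card H" .
  qed
  \<comment> \<open>The empty set stands for gaps without a layer point in direction
    \<open>i\<close>, where nothing determines \<nu>.\<close>
  define XI where "XI i = insert {} (\<Union>\<nu>\<in>Nu i. Pow (\<Psi> i \<nu>))" for i
  have XI: "finite (XI i) \<and> card (XI i) \<le> 1 + \<kappa> * card H * 2 ^ \<kappa>" for i
  proof
    show "finite (XI i)" unfolding XI_def using Nu \<Psi> by auto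
    have "card (XI i) \<le> Suc (card (\<Union>\<nu>\<in>Nu i. Pow (\<Psi> i \<nu>)))" unfolding XI_def by (rule card_insert_le_m1) auto
    also have "card (\<Union>\<nu>\<in>Nu i. Pow (\<Psi> i \<nu>)) \<le> (\<Sum>\<nu>\<in>Nu i. card (Pow (\<Psi> i \<nu>)))" using Nu by (intro card_UN_le) blast
    also have "\<dots> \<le> (\<Sum>\<nu>\<in>Nu i. 2 ^ \<kappa>)" using \<Psi> by (intro sum_mono) (auto simp: card_Pow)
    also have "\<dots> \<le> \<kappa> * card H * 2 ^ \<kappa>" using Nu[of i] by simp
    finally show "card (XI i) \<le> 1 + \<kappa> * card H * 2 ^ \<kappa>" by simp
  qed
  define XX where "XX = (\<lambda>(g, F). {0, g} \<union> (\<Union>i. F i)) ` (\<Gamma> \<times> PiE UNIV XI)"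
  have finXX: "finite (\<Gamma> \<times> PiE UNIV XI)" using card_\<Gamma> XI by (intro finite_cartesian_product finite_PiE) auto
  have "card XX \<le> card (\<Gamma> \<times> PiE UNIV XI)" unfolding XX_def by (rule card_image_le[OF finXX])
  also have "\<dots> = card \<Gamma> * (\<Prod>i\<in>UNIV. card (XI i))" by (simp add: card_cartesian_product card_PiE)
  also have "\<dots> \<le> card H * (\<Prod>i\<in>(UNIV::'d set). 1 + \<kappa> * card H * 2 ^ \<kappa>)"
    using card_\<Gamma> XI by (intro mult_mono prod_mono) auto
  finally have cXX: "card XX \<le> card H * (1 + \<kappa> * card H * 2 ^ \<kappa>) ^ CARD('d)" by simp
  have "cuts z0 j \<in> XX \<and> card (cuts z0 j) \<le> 2 + CARD('d) * \<kappa>" if z0: "z0 \<in> Z" for z0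
  proof -
    have z: "z0 \<in> shifted_lattice s" "ell z0 \<in> unit_box" using z0 by (auto simp: Z_def)
    obtain ul where ul: "lo z0 j = - ell ul $ j" "ul \<in> Zk" "fst ul \<in> N0" using lo_hi(1)[OF z, of j] unfolding Q_def by blast
    obtain uh where uh: "hi z0 j = - ell uh $ j" "uh \<in> Zk" "fst uh \<in> N0" using lo_hi(2)[OF z, of j] unfolding Q_def by blast
    have small: "fst w \<in> ibox M" if "fst w \<in> N0 \<union> N1" for w :: "('d, 'e) pt" using that N_small by blast
    define g where "g = hi z0 j - lo z0 j"
    have g: "g \<in> \<Gamma>"
    proof -
      have "0 < g" "g \<le> 2 * \<tau>" using lo_hi(4,5)[OF z, of j] gap[OF z0] by (auto simp: g_def)
      moreover have "g = ell (ul - uh) $ j" by (simp add: g_def ul uh ell_diff)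
      moreover have "fst (ul - uh) \<in> ibox (2 * M)" using fst_diff[OF small small, of ul uh] ul uh by simp
      moreover have "ul - uh \<in> Zk" using ul uh by (intro Zk_diff)
      ultimately show ?thesis unfolding \<Gamma>_def by blast
    qed
    \<comment> \<open>A point may lie in layers of several directions and is then listed in each of
      them; only the union matters.\<close>
    define F where "F i = {- ell w $ j - lo z0 j | w. w \<in> Zk \<and> fst w \<in> N1 \<and> fst w $ i \<in> Ks \<and> lo z0 j < - ell w $ j \<and> - ell w $ j < hi z0 j}" for i
    have inTh: "x \<in> Th i (fst ul $ i - fst w $ i) \<and> (\<exists>h\<in>H. fst ul $ i = fst w $ i + h $ i)" 
      if w: "x = - ell w $ j - lo z0 j" "w \<in> Zk" "fst w \<in> N1" "lo z0 j < - ell w $ j" "- ell w $ j < hi z0 j" for x w i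
    proof -
      have x: "x = ell (ul - w) $ j" by (simp add: w ul ell_diff)
      have rng: "0 < x" "x \<le> 2 * \<tau>" using w gap[OF z0] by auto
      have b: "fst (ul - w) \<in> ibox (2 * M)" using fst_diff[OF small small, of ul w] ul w by simp
      have Zw: "ul - w \<in> Zk" using ul w by (intro Zk_diff)
      have "u (fst (ul - w)) \<in> near_int (2 * real D * \<tau>)" using rng x by (intro near Zw) auto
      moreover have "fst (ul - w) \<in> ibox (4 * M)" using b M0 ibox_mono[of "2 * M" "4 * M"] by auto
      ultimately have "fst (ul - w) \<in> H" by (simp add: H_def)
      moreover have "fst ul $ i = fst w $ i + fst (ul - w) $ i" by simp
      moreover have "x \<in> Th i (fst ul $ i - fst w $ i)"
        unfolding Th_def using rng x b Zw by (intro CollectI conjI bexI[of _ "ul - w"]) simp_all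
      ultimately show ?thesis by blast
    qed
    have Fsub: "F i \<subseteq> \<Psi> i (fst ul $ i)" for i
    proof
      fix x assume "x \<in> F i"
      then obtain w where w: "x = - ell w $ j - lo z0 j" "w \<in> Zk" "fst w \<in> N1" "fst w $ i \<in> Ks" "lo z0 j < - ell w $ j" "- ell w $ j < hi z0 j"
        unfolding F_def by blast
      from inTh[OF w(1,2,3,5,6), of i] w(4) show "x \<in> \<Psi> i (fst ul $ i)" unfolding \<Psi>_def by blast
    qed
    have "F i \<in> XI i" for i
    proof (cases "F i = {}")
      case False
      then obtain x w where w: "x = - ell w $ j - lo z0 j" "w \<in> Zk" "fst w \<in> N1" "fst w $ i \<in> Ks" "lo z0 j < - ell w $ j" "- ell w $ j < hi z0 j"
        unfolding F_def by blast
      from inTh[OF w(1,2,3,5,6), of i] obtain h where "h \<in> H" "fst ul $ i = fst w $ i + h $ i" by blast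
      then have "fst ul $ i \<in> Nu i" unfolding Nu_def using w(4) by (intro image_eqI[of _ _ "(fst w $ i, h)"]) auto
      then show ?thesis using Fsub[of i] unfolding XI_def by blast
    qed (simp add: XI_def)
    then have F: "F \<in> PiE UNIV XI" by (simp add: PiE_iff)
    have eq: "cuts z0 j = {0, g} \<union> (\<Union>i. F i)"
    proof -
      have "{x - lo z0 j | x. x \<in> Q j N1 \<and> lo z0 j < x \<and> x < hi z0 j} = (\<Union>i. F i)"
      proof (intro set_eqI iffI)
        fix y assume "y \<in> {x - lo z0 j | x. x \<in> Q j N1 \<and> lo z0 j < x \<and> x < hi z0 j}"
        then obtain w where w: "y = - ell w $ j - lo z0 j" "w \<in> Zk" "fst w \<in> N1" "lo z0 j < - ell w $ j" "- ell w $ j < hi z0 j"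
          unfolding Q_def by blast
        obtain i where "fst w $ i \<in> Ks" using Ks(3)[OF w(3)] by blast
        with w have "y \<in> F i" unfolding F_def by blast
        then show "y \<in> (\<Union>i. F i)" by blast
      next
        fix y assume "y \<in> (\<Union>i. F i)"
        then show "y \<in> {x - lo z0 j | x. x \<in> Q j N1 \<and> lo z0 j < x \<and> x < hi z0 j}" unfolding F_def Q_def by blast
      qed
      then show ?thesis by (simp add: cuts_def g_def)
    qed
    have "cuts z0 j \<in> XX" unfolding XX_def eq using g F by (intro image_eqI[of _ _ "(g, F)"]) auto
    moreover have "card (cuts z0 j) \<le> 2 + CARD('d) * \<kappa>"
    proof -
      have "card (cuts z0 j) \<le> card {0, g} + card (\<Union>i. F i)" unfolding eq by (rule card_Un_le)
      also have "card {0, g} \<le> 2" by (cases "g = 0") auto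
      also have "card (\<Union>i. F i) \<le> (\<Sum>i\<in>UNIV. card (F i))" by (rule card_UN_le) simp
      also have "\<dots> \<le> (\<Sum>i\<in>(UNIV::'d set). \<kappa>)"
        using Fsub \<Psi> by (intro sum_mono) (meson card_mono order_trans)
      finally show ?thesis by simp
    qed
    ultimately show ?thesis by blast
  qed
  moreover have "finite XX" unfolding XX_def by (rule finite_imageI[OF finXX])
  ultimately show ?thesis using cXX by blast
qed

end

section \<open>Patch classes and their frequencies\<close>

lemma card_Ints_half_open_le:
  fixes p q :: real
  assumes "p \<le> q"
  shows "finite {x \<in> \<int>. p < x \<and> x \<le> q} \<and> real (card {x \<in> \<int>. p < x \<and> x \<le> q}) \<le> q - p + 1"
proof -
  have sub: "{x \<in> \<int>. p < x \<and> x \<le> q} \<subseteq> of_int ` {\<lfloor>p\<rfloor>+1..\<lfloor>q\<rfloor>}"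
  proof
    fix x assume x: "x \<in> {x \<in> \<int>. p < x \<and> x \<le> q}"
    then obtain k where k: "x = of_int k" by (auto elim: Ints_cases)
    have "k \<in> {\<lfloor>p\<rfloor>+1..\<lfloor>q\<rfloor>}" using x k by (auto simp: le_floor_iff) linarith
    then show "x \<in> of_int ` {\<lfloor>p\<rfloor>+1..\<lfloor>q\<rfloor>}" using k by blast
  qed
  have "card {x \<in> \<int>. p < x \<and> x \<le> q} \<le> card (of_int ` {\<lfloor>p\<rfloor>+1..\<lfloor>q\<rfloor>} :: real set)"
    using sub by (intro card_mono) auto
  also have "\<dots> \<le> card {\<lfloor>p\<rfloor>+1..\<lfloor>q\<rfloor>}" by (rule card_image_le) auto
  also have "\<dots> = nat (\<lfloor>q\<rfloor> - \<lfloor>p\<rfloor>)" by simp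
  finally have "real (card {x \<in> \<int>. p < x \<and> x \<le> q}) \<le> real (nat (\<lfloor>q\<rfloor> - \<lfloor>p\<rfloor>))" by linarith
  also have "\<dots> = of_int (\<lfloor>q\<rfloor> - \<lfloor>p\<rfloor>)" using assms by (simp add: floor_mono)
  also have "\<dots> \<le> q - p + 1" by (simp; linarith)
  finally show ?thesis using finite_subset[OF sub] by simp
qed

text \<open>The bound is independent of \<open>p\<close>, which keeps the number of layers bounded
  while the patch size grows.\<close>

lemma card_Ints_shell:
  fixes p w :: real
  assumes "w \<ge> 0"
  shows "finite {x \<in> \<int>. p < \<bar>x\<bar> \<and> \<bar>x\<bar> \<le> p + w}" 
    and "card {x \<in> \<int>. p < \<bar>x\<bar> \<and> \<bar>x\<bar> \<le> p + w} \<le> 2 * nat \<lceil>w + 1\<rceil>"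
proof -
  let ?I = "{x \<in> \<int>. p < x \<and> x \<le> p + w}"
  have I: "finite ?I" "real (card ?I) \<le> w + 1" using card_Ints_half_open_le[of p "p + w"] assms by auto
  then have "card ?I \<le> nat \<lceil>w + 1\<rceil>" by linarith
  have sub: "{x \<in> \<int>. p < \<bar>x\<bar> \<and> \<bar>x\<bar> \<le> p + w} \<subseteq> ?I \<union> uminus ` ?I"
  proof
    fix x assume x: "x \<in> {x \<in> \<int>. p < \<bar>x\<bar> \<and> \<bar>x\<bar> \<le> p + w}"
    show "x \<in> ?I \<union> uminus ` ?I"
    proof (cases "x \<ge> 0")
      case False
      then have "- x \<in> ?I" using x by auto
      then show ?thesis by (intro UnI2 image_eqI[of _ _ "- x"]) auto
    qed (use x in auto)
  qed
  then show "finite {x \<in> \<int>. p < \<bar>x\<bar> \<and> \<bar>x\<bar> \<le> p + w}" using I(1) finite_subset by blast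
  have "card {x \<in> \<int>. p < \<bar>x\<bar> \<and> \<bar>x\<bar> \<le> p + w} \<le> card (?I \<union> uminus ` ?I)" using sub I(1) by (intro card_mono) auto
  also have "\<dots> \<le> card ?I + card (uminus ` ?I)" by (rule card_Un_le)
  also have "card (uminus ` ?I) \<le> card ?I" by (rule card_image_le[OF I(1)])
  finally show "card {x \<in> \<int>. p < \<bar>x\<bar> \<and> \<bar>x\<bar> \<le> p + w} \<le> 2 * nat \<lceil>w + 1\<rceil>" using \<open>card ?I \<le> nat \<lceil>w + 1\<rceil>\<close> by simp
qed

section \<open>Patches as sets of lattice displacements\<close>

context cut_project
begin

definition "patch_lattice i \<Omega> r = {u \<in> Zk. (if i = (1::nat) then \<pi>1 u else (fst u, A *v fst u)) \<in> (\<lambda>z. r *\<^sub>R z) ` \<Omega>}"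

definition "lifted = {z \<in> shifted_lattice s. ell z \<in> unit_box}"

definition "visible i \<Omega> r z = {u \<in> patch_lattice i \<Omega> r. ell z + ell u \<in> unit_box}"

lemma strip_Int_lattice: "strip A W \<inter> shifted_lattice s = lifted"
  by (rule set_eqI) (simp only: Int_iff lifted_def mem_Collect_eq strip_iff unit_box_def conj_commute)

lemma cps_eq: "cps A F0 W s = \<pi>1 ` lifted"
  by (simp only: cps_def strip_Int_lattice \<pi>1_def)

lemma lifted_shifted: "z \<in> lifted \<Longrightarrow> z \<in> shifted_lattice s"
  by (simp add: lifted_def)

lemma inj_lifted: "inj_on \<pi>1 lifted"
  by (rule inj_on_subset[OF \<pi>1_inj_shifted]) (auto simp: lifted_def)

lemma lift_\<pi>1: "z \<in> lifted \<Longrightarrow> lift A F0 W s (\<pi>1 z) = z"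
  unfolding lift_def strip_Int_lattice \<pi>1_def[symmetric]
  by (rule the_equality) (use inj_lifted in \<open>auto dest: inj_onD\<close>)

lemma Collect_image_eq: "{y \<in> g ` X. Pr y} = g ` {x \<in> X. Pr (g x)}"
  by blast

lemma pclass_eq:
  assumes z: "z \<in> lifted"
  shows "pclass i A F0 W s \<Omega> (\<pi>1 z) r = \<pi>1 ` visible i \<Omega> r z"
proof -
  define T where "T y = (if i = 1 then \<pi>1 y else (fst y, A *v fst y))" for y
  have "patch i A F0 W s \<Omega> (\<pi>1 z) r = \<pi>1 ` {z' \<in> lifted. T (z' - z) \<in> (\<lambda>z. r *\<^sub>R z) ` \<Omega>}"
  proof (cases "i = 1")
    case True
    then show ?thesis
      by (simp only: patch_def cps_eq T_def Collect_image_eq linear_diff[OF linear_\<pi>1] if_True simp_thms)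
  next
    case False
    have "patch i A F0 W s \<Omega> (\<pi>1 z) r = {y' \<in> \<pi>1 ` lifted. T (lift A F0 W s y' - z) \<in> (\<lambda>z. r *\<^sub>R z) ` \<Omega>}"
      using False by (simp only: patch_def cps_eq T_def lift_\<pi>1[OF z] proj_along_graphE_Fsp if_False)
    also have "\<dots> = \<pi>1 ` {z' \<in> lifted. T (z' - z) \<in> (\<lambda>z. r *\<^sub>R z) ` \<Omega>}"
      unfolding Collect_image_eq
      by (intro arg_cong[where f = "image \<pi>1"] Collect_cong conj_cong refl) (simp only: lift_\<pi>1)
    finally show ?thesis .
  qed
  then have "pclass i A F0 W s \<Omega> (\<pi>1 z) r = (\<lambda>z'. \<pi>1 (z' - z)) ` {z' \<in> lifted. T (z' - z) \<in> (\<lambda>z. r *\<^sub>R z) ` \<Omega>}"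
    by (simp only: pclass_def image_image linear_diff[OF linear_\<pi>1])
  also have "\<dots> = \<pi>1 ` ((\<lambda>z'. z' - z) ` {z' \<in> lifted. T (z' - z) \<in> (\<lambda>z. r *\<^sub>R z) ` \<Omega>})"
    by (simp only: image_image)
  also have "(\<lambda>z'. z' - z) ` {z' \<in> lifted. T (z' - z) \<in> (\<lambda>z. r *\<^sub>R z) ` \<Omega>} = visible i \<Omega> r z"
  proof -
    have vis: "u \<in> visible i \<Omega> r z \<longleftrightarrow> (u \<in> Zk \<and> T u \<in> (\<lambda>z. r *\<^sub>R z) ` \<Omega>) \<and> ell z + ell u \<in> unit_box" for u
      by (simp only: visible_def patch_lattice_def T_def mem_Collect_eq)
    show ?thesis
  proof (intro set_eqI iffI)
    fix u assume "u \<in> (\<lambda>z'. z' - z) ` {z' \<in> lifted. T (z' - z) \<in> (\<lambda>z. r *\<^sub>R z) ` \<Omega>}"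
    then obtain z' where z': "z' \<in> lifted" "T (z' - z) \<in> (\<lambda>z. r *\<^sub>R z) ` \<Omega>" "u = z' - z" by blast
    then show "u \<in> visible i \<Omega> r z"
      using shifted_lattice_diff[OF lifted_shifted[OF z'(1)] lifted_shifted[OF z]]
      by (simp add: vis ell_diff lifted_def)
  next
    fix u assume u: "u \<in> visible i \<Omega> r z"
    then have "z + u \<in> lifted"
      using shifted_lattice_add[OF lifted_shifted[OF z], of u] by (simp add: vis ell_add lifted_def)
    then show "u \<in> (\<lambda>z'. z' - z) ` {z' \<in> lifted. T (z' - z) \<in> (\<lambda>z. r *\<^sub>R z) ` \<Omega>}"
      using u by (intro image_eqI[of _ _ "z + u"]) (simp_all add: vis)
  qed
  qed
  finally show ?thesis .
qed

text \<open>\<open>\<pi>1\<close> is injective on \<open>Zk\<close>, so equal classes mean equal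
  sets of visible displacements; it is injective on lifted points, so counting in \<open>E\<close>
  is counting in the lattice.\<close>

lemma freq_eq:
  assumes z0: "z0 \<in> lifted"
  shows "freq i A F0 W s \<Omega> r (pclass i A F0 W s \<Omega> (\<pi>1 z0) r)
    = Lim at_top (\<lambda>R. real (card {z \<in> shifted_lattice s. ell z \<in> unit_box \<and> infnorm (\<pi>1 z) \<le> R \<and> visible i \<Omega> r z = visible i \<Omega> r z0}) / full_count R)"
proof -
  have vis: "visible i \<Omega> r z \<subseteq> Zk" for z by (auto simp: visible_def patch_lattice_def)
  have "{y' \<in> cps A F0 W s. infnorm y' \<le> R \<and> pclass i A F0 W s \<Omega> y' r = pclass i A F0 W s \<Omega> (\<pi>1 z0) r}
     = \<pi>1 ` {z \<in> lifted. infnorm (\<pi>1 z) \<le> R \<and> visible i \<Omega> r z = visible i \<Omega> r z0}" for R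
  proof -
    have "pclass i A F0 W s \<Omega> (\<pi>1 z) r = pclass i A F0 W s \<Omega> (\<pi>1 z0) r \<longleftrightarrow> visible i \<Omega> r z = visible i \<Omega> r z0" if "z \<in> lifted" for z
      unfolding pclass_eq[OF that] pclass_eq[OF z0] by (rule inj_on_image_eq_iff[OF \<pi>1_inj vis vis])
    then show ?thesis unfolding cps_eq by blast
  qed
  moreover have "card (\<pi>1 ` {z \<in> lifted. infnorm (\<pi>1 z) \<le> R \<and> visible i \<Omega> r z = visible i \<Omega> r z0}) 
      = card {z \<in> shifted_lattice s. ell z \<in> unit_box \<and> infnorm (\<pi>1 z) \<le> R \<and> visible i \<Omega> r z = visible i \<Omega> r z0}" for R
    by (subst card_image[OF inj_on_subset[OF inj_lifted]]) (auto simp: lifted_def intro!: arg_cong[where f = card])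
  moreover have "{y' \<in> cps A F0 W s. infnorm y' \<le> R} = \<pi>1 ` {z \<in> lifted. infnorm (\<pi>1 z) \<le> R}" for R
    unfolding cps_eq by blast
  moreover have "real (card (\<pi>1 ` {z \<in> lifted. infnorm (\<pi>1 z) \<le> R})) = full_count R" for R
  proof -
    have "{z \<in> lifted. infnorm (\<pi>1 z) \<le> R} = pts unit_box R" by (auto simp: lifted_def pts_def)
    then show ?thesis by (subst card_image[OF inj_on_subset[OF inj_lifted]]) (auto simp: full_count_def)
  qed
  ultimately show ?thesis by (simp only: freq_def)
qed

lemma xi_eq:
  "xi i A F0 W s \<Omega> r = (\<lambda>z0. Lim at_top (\<lambda>R. real (card {z \<in> shifted_lattice s. ell z \<in> unit_box \<and> infnorm (\<pi>1 z) \<le> R \<and> visible i \<Omega> r z = visible i \<Omega> r z0}) / full_count R)) ` lifted"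
proof -
  have "xi i A F0 W s \<Omega> r = (\<lambda>z0. freq i A F0 W s \<Omega> r (pclass i A F0 W s \<Omega> (\<pi>1 z0) r)) ` lifted"
    unfolding xi_def cps_eq by blast
  then show ?thesis by (simp only: freq_eq cong: image_cong)
qed

text \<open>What the geometry of \<Omega> must supply: a core with all integer vectors up to \<rho>,
  an undecided part inside at most \<kappa> layers per direction, and everything within radius
  \<open>M\<close>. The remaining argument is common to both types.\<close>

definition "shape i \<Omega> r \<rho> M \<kappa> \<longleftrightarrow> (\<exists>N0 N1 Ks. finite N0 \<and> finite N1 \<and> N0 \<subseteq> intvec \<and> N1 \<subseteq> intvec \<and> 0 \<in> N0
    \<and> (\<forall>u\<in>Zk. fst u \<in> N0 \<longrightarrow> ell u \<in> tbox 1 \<longrightarrow> u \<in> patch_lattice i \<Omega> r)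
    \<and> (\<forall>u\<in>patch_lattice i \<Omega> r. ell u \<in> tbox 1 \<longrightarrow> fst u \<in> N0 \<union> N1)
    \<and> (\<forall>q\<in>intvec. (\<forall>i. \<bar>q $ i\<bar> \<le> \<rho>) \<longrightarrow> q \<in> N0) \<and> N0 \<union> N1 \<subseteq> ibox M
    \<and> finite Ks \<and> card Ks \<le> \<kappa> \<and> (\<forall>n\<in>N1. \<exists>i. n $ i \<in> Ks))" for \<rho> M :: real and Ks :: "real set" and \<kappa> :: nat

text \<open>Each of the \<open>CARD('e)\<close> coordinates contributes a power of \<open>G\<close>
  with exponent \<open>CARD('d) + 1\<close>, one factor for the gap and one per direction of layers.
  All other factors depend only on \<kappa> and the dimensions.\<close>

lemma card_xi_le:
  fixes D :: nat and c :: "'e \<Rightarrow> real^'e" and \<tau> :: "'e \<Rightarrow> real" and \<rho> M G :: real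
  assumes shape: "shape i \<Omega> r (real D * \<rho>) M \<kappa>"
    and D: "D > 0" "\<And>j. c j \<in> intvec" "\<And>j z. real D * ell z $ j = c j \<bullet> snd z - (A *v fst z) \<bullet> c j"
    and \<tau>: "\<And>j. \<tau> j > 0" "\<And>j. 2 * real D * \<tau> j < 1"
    and cover: "\<And>j x. \<exists>q\<in>intvec. (\<forall>i. \<bar>q $ i\<bar> \<le> \<rho>) \<and> x - (A *v q) \<bullet> c j \<in> near_int (\<tau> j)"
    and count: "\<And>j. real (card {h \<in> ibox (4 * M). (A *v h) \<bullet> c j \<in> near_int (2 * real D * \<tau> j)}) \<le> G"
    and faces: "\<And>j h. h \<in> ibox (4 * M) \<Longrightarrow> h \<noteq> 0 \<Longrightarrow> \<exists>i. h $ i = 0 \<Longrightarrow> (A *v h) \<bullet> c j \<notin> near_int (2 * real D * \<tau> j)"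
    and G: "G \<ge> 1"
  shows "finite (xi i A F0 W s \<Omega> r)"
    and "real (card (xi i A F0 W s \<Omega> r)) \<le> (((1 + real \<kappa> * 2 ^ \<kappa>) ^ CARD('d)) ^ CARD('e) * 2 ^ ((4 ^ (2 + CARD('d) * \<kappa>)) ^ CARD('e))) * G ^ ((CARD('d) + 1) * CARD('e))"
proof -
  obtain N0 N1 Ks where C: "finite N0 \<and> finite N1 \<and> N0 \<subseteq> intvec \<and> N1 \<subseteq> intvec \<and> 0 \<in> N0
    \<and> (\<forall>u\<in>Zk. fst u \<in> N0 \<longrightarrow> ell u \<in> tbox 1 \<longrightarrow> u \<in> patch_lattice i \<Omega> r)
    \<and> (\<forall>u\<in>patch_lattice i \<Omega> r. ell u \<in> tbox 1 \<longrightarrow> fst u \<in> N0 \<union> N1)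
    \<and> (\<forall>q\<in>intvec. (\<forall>i. \<bar>q $ i\<bar> \<le> real D * \<rho>) \<longrightarrow> q \<in> N0) \<and> N0 \<union> N1 \<subseteq> ibox M
    \<and> finite Ks \<and> card Ks \<le> \<kappa> \<and> (\<forall>n\<in>N1. \<exists>i. n $ i \<in> Ks)"
    using shape unfolding shape_def by (elim exE)
  have N: "finite N0" "finite N1" "N0 \<subseteq> intvec" "N1 \<subseteq> intvec" "0 \<in> N0"
    "\<forall>u\<in>Zk. fst u \<in> N0 \<longrightarrow> ell u \<in> tbox 1 \<longrightarrow> u \<in> patch_lattice i \<Omega> r"
    "\<forall>u\<in>patch_lattice i \<Omega> r. ell u \<in> tbox 1 \<longrightarrow> fst u \<in> N0 \<union> N1"
    "\<forall>q\<in>intvec. (\<forall>i. \<bar>q $ i\<bar> \<le> real D * \<rho>) \<longrightarrow> q \<in> N0" "N0 \<union> N1 \<subseteq> ibox M"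
    "finite Ks" "card Ks \<le> \<kappa>" "\<forall>n\<in>N1. \<exists>i. n $ i \<in> Ks"
    using C by - (elim conjE, assumption)+
  have Ks: "\<exists>i. n $ i \<in> Ks" if "n \<in> N1" for n using N(12) that by (rule bspec)
  interpret cells A F0 v s N0 N1 "patch_lattice i \<Omega> r"
  proof unfold_locales
    show "patch_lattice i \<Omega> r \<subseteq> Zk" unfolding patch_lattice_def by blast
    show "u \<in> patch_lattice i \<Omega> r" if "u \<in> Zk" "fst u \<in> N0" "ell u \<in> tbox 1" for u by (rule N(6)[rule_format, OF that])
    show "fst u \<in> N0 \<union> N1" if "u \<in> patch_lattice i \<Omega> r" "ell u \<in> tbox 1" for u by (rule N(7)[rule_format, OF that])
  qed (rule N(1) N(2) N(3) N(4) N(5))+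
  let ?H = "\<lambda>j. {h \<in> ibox (4 * M). (A *v h) \<bullet> c j \<in> near_int (2 * real D * \<tau> j)}"
  have big: "real D *\<^sub>R q \<in> N0" if "q \<in> intvec" "\<forall>i. \<bar>q $ i\<bar> \<le> \<rho>" for q
    using that D(1) by (intro N(8)[rule_format]) (auto simp: intvec_def abs_mult)
  have "\<exists>XX. finite XX \<and> (\<forall>z0\<in>Z. cuts z0 j \<in> XX \<and> card (cuts z0 j) \<le> 2 + CARD('d) * \<kappa>) \<and>
    card XX \<le> card (?H j) * (1 + \<kappa> * card (?H j) * 2 ^ \<kappa>) ^ CARD('d)" for j
    by (rule cuts_family[where D = D and c = "c j" and \<rho> = \<rho> and \<tau> = "\<tau> j" and M = M and Ks = Ks and \<kappa> = \<kappa>])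
       (fact D \<tau> cover big N(9-11) Ks faces)+
  then have "\<forall>j. \<exists>XX. finite XX \<and> (\<forall>z0\<in>Z. cuts z0 j \<in> XX \<and> card (cuts z0 j) \<le> 2 + CARD('d) * \<kappa>) \<and>
    card XX \<le> card (?H j) * (1 + \<kappa> * card (?H j) * 2 ^ \<kappa>) ^ CARD('d)" by (rule allI)
  then obtain XX where "\<forall>j. finite (XX j) \<and> (\<forall>z0\<in>Z. cuts z0 j \<in> XX j \<and> card (cuts z0 j) \<le> 2 + CARD('d) * \<kappa>) \<and>
    card (XX j) \<le> card (?H j) * (1 + \<kappa> * card (?H j) * 2 ^ \<kappa>) ^ CARD('d)" by (rule choice[THEN exE])
  then have XX: "\<And>j. finite (XX j)" "\<And>j z0. z0 \<in> Z \<Longrightarrow> cuts z0 j \<in> XX j" "\<And>j z0. z0 \<in> Z \<Longrightarrow> card (cuts z0 j) \<le> 2 + CARD('d) * \<kappa>"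
    "\<And>j. card (XX j) \<le> card (?H j) * (1 + \<kappa> * card (?H j) * 2 ^ \<kappa>) ^ CARD('d)" by blast+
  have xi: "xi i A F0 W s \<Omega> r = class_freq ` Z"
    unfolding xi_eq class_freq_def[abs_def] S_def visible_def Z_def lifted_def ..
  show "finite (xi i A F0 W s \<Omega> r)" unfolding xi by (rule card_rel_le(1)[OF XX(1,2,3)])
  define K where "K = 1 + real \<kappa> * 2 ^ \<kappa>"
  have XG: "real (card (XX j)) \<le> K ^ CARD('d) * G ^ (CARD('d) + 1)" for j
  proof -
    define h where "h = real (card (?H j))"
    have h: "0 \<le> h" "h \<le> G" using count[of j] by (auto simp: h_def)
    have "real (card (XX j)) \<le> real (card (?H j) * (1 + \<kappa> * card (?H j) * 2 ^ \<kappa>) ^ CARD('d))"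
      using XX(4) by (rule of_nat_mono)
    also have "\<dots> = h * (1 + real \<kappa> * h * 2 ^ \<kappa>) ^ CARD('d)" by (simp add: h_def)
    also have "\<dots> \<le> G * (K * G) ^ CARD('d)"
    proof (intro mult_mono power_mono)
      have "real \<kappa> * h * 2 ^ \<kappa> \<le> real \<kappa> * G * 2 ^ \<kappa>" using h by (intro mult_right_mono mult_left_mono) auto
      then show "1 + real \<kappa> * h * 2 ^ \<kappa> \<le> K * G" using G by (simp add: K_def algebra_simps)
    qed (use h G in auto)
    also have "\<dots> = K ^ CARD('d) * G ^ (CARD('d) + 1)" by (simp add: power_mult_distrib)
    finally show ?thesis .
  qed
  have "real (card (xi i A F0 W s \<Omega> r)) \<le> real ((\<Prod>j\<in>UNIV. card (XX j)) * 2 ^ ((4 ^ (2 + CARD('d) * \<kappa>)) ^ CARD('e)))"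
    unfolding xi by (intro of_nat_mono card_rel_le(2)[OF XX(1,2,3)])
  also have "\<dots> = (\<Prod>j\<in>UNIV. real (card (XX j))) * 2 ^ ((4 ^ (2 + CARD('d) * \<kappa>)) ^ CARD('e))" by simp
  also have "\<dots> \<le> (\<Prod>j\<in>(UNIV::'e set). K ^ CARD('d) * G ^ (CARD('d) + 1)) * 2 ^ ((4 ^ (2 + CARD('d) * \<kappa>)) ^ CARD('e))"
    using XG by (intro mult_right_mono prod_mono) auto
  also have "(\<Prod>j\<in>(UNIV::'e set). K ^ CARD('d) * G ^ (CARD('d) + 1)) = (K ^ CARD('d)) ^ CARD('e) * G ^ ((CARD('d) + 1) * CARD('e))"
    by (simp only: prod_constant power_mult_distrib power_mult)
  finally show "real (card (xi i A F0 W s \<Omega> r)) \<le> (((1 + real \<kappa> * 2 ^ \<kappa>) ^ CARD('d)) ^ CARD('e) * 2 ^ ((4 ^ (2 + CARD('d) * \<kappa>)) ^ CARD('e))) * G ^ ((CARD('d) + 1) * CARD('e))"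
    by (simp only: K_def mult_ac)
qed

text \<open>The count is run with \<open>\<epsilon> / 2\<close>. The other half of \<epsilon> leaves
  a positive power of \<open>ln r\<close>, which eventually exceeds every constant.\<close>

lemma eventually_xi_bound:
  assumes gen: "\<And>c. c \<in> intvec - {0} \<Longrightarrow> generic_form (\<lambda>q. (A *v q) \<bullet> c)"
    and shape: "\<forall>\<^sub>F r in at_top. shape i (\<Omega> :: ('d, 'e) pt set) r (\<rho> * r) (M * r) \<kappa>" and pos: "\<rho> > 0" "M > 0" "\<epsilon> > 0"
  shows "\<forall>\<^sub>F r in at_top. finite (xi i A F0 W s \<Omega> r) \<and>
     real (card (xi i A F0 W s \<Omega> r)) \<le> ln r powr ((1 + \<epsilon>) * real ((CARD('d) + 1) * CARD('e)))"
proof -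
  obtain D :: nat where D: "D > 0" "\<forall>j. \<exists>c\<in>intvec - {0}. \<forall>z. real D * ell z $ j = c \<bullet> snd z - (A *v fst z) \<bullet> c"
    using ell_integral_form by blast
  then obtain c where c: "\<And>j. c j \<in> intvec - {0}" "\<And>j z. real D * ell z $ j = c j \<bullet> snd z - (A *v fst z) \<bullet> c j" by metis
  \<comment> \<open>The core has to contain \<open>D\<close> times every covering vector, so these
    may only reach radius \<open>\<rho> * r / D\<close>.\<close>
  define K1 where "K1 = real D / \<rho>"
  have lin: "linear (\<lambda>q. (A *v q) \<bullet> c j)" for j
    by (auto intro!: linearI simp: matrix_vector_right_distrib matrix_vector_mult_scaleR inner_add_left)
  let ?E = "\<epsilon> / 2"
  define good where "good C r j \<longleftrightarrow> (\<exists>\<tau>>0. 2 * real D * \<tau> < 1 \<and> 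
     (\<forall>x. \<exists>q\<in>intvec. (\<forall>i. \<bar>q $ i\<bar> \<le> r / K1) \<and> x - (A *v q) \<bullet> c j \<in> near_int \<tau>) \<and>
     real (card {h \<in> ibox ((4 * M) * r). (A *v h) \<bullet> c j \<in> near_int (2 * real D * \<tau>)}) \<le> C * ln r powr (1 + ?E) \<and>
     (\<forall>h \<in> ibox ((4 * M) * r). h \<noteq> 0 \<longrightarrow> (\<exists>i. h $ i = 0) \<longrightarrow> (A *v h) \<bullet> c j \<notin> near_int (2 * real D * \<tau>)))" for C r j
  have "\<exists>C. \<forall>\<^sub>F r in at_top. good C r j" for j
    unfolding good_def using pos D(1)
    by (intro generic_form_scales lin gen c) (auto simp: K1_def)
  then obtain C where C: "\<And>j. \<forall>\<^sub>F r in at_top. good (C j) r j" by metis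
  define C' where "C' = (\<Sum>j\<in>UNIV. \<bar>C j\<bar>) + 1"
  have C': "C' \<ge> 1" "C j \<le> C'" for j
  proof -
    show "C' \<ge> 1" by (simp add: C'_def sum_nonneg)
    have "\<bar>C j\<bar> \<le> (\<Sum>j\<in>UNIV. \<bar>C j\<bar>)" by (rule member_le_sum) auto
    then show "C j \<le> C'" by (simp add: C'_def)
  qed
  define m where "m = (CARD('d) + 1) * CARD('e)"
  define B where "B = ((1 + real \<kappa> * 2 ^ \<kappa>) ^ CARD('d)) ^ CARD('e) * 2 ^ ((4 ^ (2 + CARD('d) * \<kappa>)) ^ CARD('e))"
  have B: "B \<ge> 0" by (simp add: B_def)
  have m: "m > 0" by (simp add: m_def)
  have "filterlim (\<lambda>r. ln r powr (?E * real m)) at_top at_top"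
    using pos m by real_asymp
  then have ev: "\<forall>\<^sub>F r in at_top. B * C' ^ m \<le> ln r powr (?E * real m)" by (auto simp: filterlim_at_top)
  have all: "\<forall>\<^sub>F r in at_top. \<forall>j\<in>UNIV. good (C j) r j" using C by (intro eventually_ball_finite) auto
  show ?thesis
    using shape all ev eventually_ge_at_top[of "exp 1"]
  proof eventually_elim
    case (elim r)
    have l1: "ln r \<ge> 1" using elim(4) ln_ge_iff[of r 1] by (auto intro: less_le_trans[OF exp_gt_zero])
    define G where "G = C' * ln r powr (1 + ?E)"
    have "ln r powr (1 + ?E) \<ge> 1" using l1 pos by (intro ge_one_powr_ge_zero) auto
    then have G: "G \<ge> 1" unfolding G_def using C'(1) mult_mono[of 1 C' 1 "ln r powr (1 + ?E)"] by simp
    have "\<forall>j. good (C j) r j" using elim(2) by blast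
    then have "\<forall>j. \<exists>\<tau>. \<tau> > 0 \<and> 2 * real D * \<tau> < 1 \<and> 
     (\<forall>x. \<exists>q\<in>intvec. (\<forall>i. \<bar>q $ i\<bar> \<le> r / K1) \<and> x - (A *v q) \<bullet> c j \<in> near_int \<tau>) \<and>
     real (card {h \<in> ibox ((4 * M) * r). (A *v h) \<bullet> c j \<in> near_int (2 * real D * \<tau>)}) \<le> C j * ln r powr (1 + ?E) \<and>
     (\<forall>h \<in> ibox ((4 * M) * r). h \<noteq> 0 \<longrightarrow> (\<exists>i. h $ i = 0) \<longrightarrow> (A *v h) \<bullet> c j \<notin> near_int (2 * real D * \<tau>))"
      unfolding good_def by blast
    then obtain \<tau> where \<tau>: "\<forall>j. \<tau> j > 0 \<and> 2 * real D * \<tau> j < 1 \<and> 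
     (\<forall>x. \<exists>q\<in>intvec. (\<forall>i. \<bar>q $ i\<bar> \<le> r / K1) \<and> x - (A *v q) \<bullet> c j \<in> near_int (\<tau> j)) \<and>
     real (card {h \<in> ibox ((4 * M) * r). (A *v h) \<bullet> c j \<in> near_int (2 * real D * \<tau> j)}) \<le> C j * ln r powr (1 + ?E) \<and>
     (\<forall>h \<in> ibox ((4 * M) * r). h \<noteq> 0 \<longrightarrow> (\<exists>i. h $ i = 0) \<longrightarrow> (A *v h) \<bullet> c j \<notin> near_int (2 * real D * \<tau> j))"
      by (rule choice[THEN exE])
    have r4: "4 * M * r = 4 * (M * r)" by simp
    note \<tau> = \<tau>[unfolded r4]
    have sc: "real D * (r / K1) = \<rho> * r" using D(1) pos by (simp add: K1_def)
    have cnt: "real (card {h \<in> ibox (4 * (M * r)). (A *v h) \<bullet> c j \<in> near_int (2 * real D * \<tau> j)}) \<le> G" for j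
    proof -
      have "real (card {h \<in> ibox (4 * (M * r)). (A *v h) \<bullet> c j \<in> near_int (2 * real D * \<tau> j)}) \<le> C j * ln r powr (1 + ?E)"
        using \<tau> by blast
      also have "\<dots> \<le> G" unfolding G_def using C'(2) by (intro mult_right_mono) auto
      finally show ?thesis .
    qed
    have fc: "(A *v h) \<bullet> c j \<notin> near_int (2 * real D * \<tau> j)" if "h \<in> ibox (4 * (M * r))" "h \<noteq> 0" "\<exists>i. h $ i = 0" for j h
      using \<tau> that by blast
    have cj: "c j \<in> intvec" for j using c(1) by blast
    have t1: "\<tau> j > 0" "2 * real D * \<tau> j < 1" for j using \<tau> by blast+
    have cov: "\<exists>q\<in>intvec. (\<forall>i. \<bar>q $ i\<bar> \<le> r / K1) \<and> x - (A *v q) \<bullet> c j \<in> near_int (\<tau> j)" for j x using \<tau> by blast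
    have sh: "shape i \<Omega> r (real D * (r / K1)) (M * r) \<kappa>" unfolding sc by (rule elim(1))
    have L1: "finite (xi i A F0 W s \<Omega> r)"
      by (rule card_xi_le(1)[where D = D and \<rho> = "r / K1" and M = "M * r" and \<kappa> = \<kappa> and c = c and \<tau> = \<tau> and G = G])
        (fact sh D(1) cj c(2) t1 cov cnt fc G)+
    have L2: "real (card (xi i A F0 W s \<Omega> r)) \<le> B * G ^ m" unfolding B_def m_def
      by (rule card_xi_le(2)[where D = D and \<rho> = "r / K1" and M = "M * r" and \<kappa> = \<kappa> and c = c and \<tau> = \<tau> and G = G])
        (fact sh D(1) cj c(2) t1 cov cnt fc G)+
    note L2
    also have "\<dots> = (B * C' ^ m) * ln r powr ((1 + ?E) * real m)"
    proof -
      have "(ln r powr (1 + ?E)) ^ m = ln r powr ((1 + ?E) * real m)"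
        using l1 by (simp add: powr_powr[symmetric] powr_realpow)
      then show ?thesis by (simp only: G_def power_mult_distrib mult.assoc)
    qed
    also have "\<dots> \<le> ln r powr (?E * real m) * ln r powr ((1 + ?E) * real m)"
      using elim(3) by (intro mult_right_mono) auto
    also have "\<dots> = ln r powr ((1 + \<epsilon>) * real m)" by (simp add: algebra_simps flip: powr_add)
    finally show ?case using L1 by (simp only: m_def)
  qed
qed

text \<open>Projection along \<open>F\<close> sees only the first component, which therefore decides
  membership alone: the core is everything and there are no layers.\<close>

lemma shape_type2:
  assumes \<Omega>: "admissible_Omega A \<Omega>"
  shows "\<exists>\<rho>>0. \<exists>M>0. \<forall>\<^sub>F r in at_top. shape 2 \<Omega> r (\<rho> * r) (M * r) 0"
proof -
  obtain e where e: "e > 0" "graphE A \<inter> ball 0 e \<subseteq> \<Omega>" using \<Omega> by (auto simp: admissible_Omega_def)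
  have sub: "\<Omega> \<subseteq> graphE A" and "bounded \<Omega>" using \<Omega> by (auto simp: admissible_Omega_def)
  then obtain b where b: "\<And>z. z \<in> \<Omega> \<Longrightarrow> norm z \<le> b" unfolding bounded_iff by blast
  \<comment> \<open>\<open>K\<close> bounds the norm of a point of \<open>E\<close> in terms of the
    largest of its first coordinates.\<close>
  define K where "K = (1 + onorm ((*v) A)) * real CARD('d)"
  have bl: "bounded_linear ((*v) A)" by (simp add: linear_conv_bounded_linear[symmetric])
  have K: "K > 0" using onorm_pos_le[OF bl] by (simp add: K_def add_pos_nonneg)
  define \<rho> where "\<rho> = e / (2 * K)"
  define M where "M = \<bar>b\<bar> + 1"
  have pos: "\<rho> > 0" "M > 0" using e K by (auto simp: \<rho>_def M_def)
  have "\<forall>\<^sub>F r in at_top. shape 2 \<Omega> r (\<rho> * r) (M * r) 0"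
    using eventually_gt_at_top[of 0]
  proof eventually_elim
    case (elim r)
    define N0 where "N0 = {n \<in> intvec. (n, A *v n) \<in> (\<lambda>z. r *\<^sub>R z) ` \<Omega>}"
    have N0M: "N0 \<subseteq> ibox (M * r)"
    proof
      fix n assume n: "n \<in> N0"
      then obtain z where z: "z \<in> \<Omega>" "(n, A *v n) = r *\<^sub>R z" by (auto simp: N0_def)
      have "norm n \<le> norm (n, A *v n)" by (simp add: norm_Pair)
      also have "\<dots> = r * norm z" using z elim by simp
      also have "\<dots> \<le> r * M" using b[OF z(1)] elim by (intro mult_left_mono) (auto simp: M_def)
      finally have "\<bar>n $ i\<bar> \<le> M * r" for i using component_le_norm_cart[of n i] by (simp add: mult.commute)
      then show "n \<in> ibox (M * r)" using n by (simp add: ibox_def N0_def)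
    qed
    have big: "q \<in> N0" if q: "q \<in> intvec" "\<forall>i. \<bar>q $ i\<bar> \<le> \<rho> * r" for q
    proof -
      define x where "x = (1/r) *\<^sub>R q"
      have "\<bar>x $ i\<bar> \<le> \<rho>" for i using q(2) elim by (auto simp: x_def abs_mult field_simps)
      then have "(\<Sum>i\<in>UNIV. \<bar>x $ i\<bar>) \<le> (\<Sum>i\<in>(UNIV::'d set). \<rho>)" by (intro sum_mono)
      then have nx: "norm x \<le> real CARD('d) * \<rho>" using norm_le_l1_cart[of x] by simp
      have "norm (x, A *v x) \<le> norm x + norm (A *v x)" by (rule norm_Pair_le)
      also have "norm (A *v x) \<le> onorm ((*v) A) * norm x" by (rule onorm[OF bl])
      finally have "norm (x, A *v x) \<le> (1 + onorm ((*v) A)) * norm x" by (simp add: algebra_simps)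
      also have "\<dots> \<le> (1 + onorm ((*v) A)) * (real CARD('d) * \<rho>)"
        using nx onorm_pos_le[OF bl] by (intro mult_left_mono) auto
      also have "\<dots> = K * \<rho>" by (simp add: K_def)
      also have "\<dots> < e" using K e by (simp add: \<rho>_def)
      finally have "(x, A *v x) \<in> \<Omega>" using e(2) by (auto simp: graphE_def)
      moreover have "(q, A *v q) = r *\<^sub>R (x, A *v x)" using elim by (simp add: x_def matrix_vector_mult_scaleR)
      ultimately have "(q, A *v q) \<in> (\<lambda>z. r *\<^sub>R z) ` \<Omega>" by (intro image_eqI)
      then show ?thesis using q(1) by (simp add: N0_def)
    qed
    show ?case unfolding shape_def
    proof (rule exI[of _ N0], rule exI[of _ "{}"], rule exI[of _ "{}"], intro conjI ballI impI)
      show "finite N0" by (rule finite_subset[OF N0M finite_ibox])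
      show "0 \<in> N0" using elim pos by (intro big) (auto simp: intvec_0)
      show "u \<in> patch_lattice 2 \<Omega> r" if "u \<in> Zk" "fst u \<in> N0" for u
        using that by (simp add: patch_lattice_def N0_def)
      show "fst u \<in> N0 \<union> {}" if "u \<in> patch_lattice 2 \<Omega> r" for u
        using that by (simp add: patch_lattice_def N0_def Zk_iff)
      show "N0 \<union> {} \<subseteq> ibox (M * r)" using N0M by simp
    qed (use big in \<open>auto simp: N0_def\<close>)
  qed
  then show ?thesis using pos by blast
qed

lemma shape_type1:
  assumes a: "a > 0"
  shows "\<exists>\<rho>>0. \<exists>M>0. \<exists>\<kappa>. \<forall>\<^sub>F r in at_top. shape 1 (cube_Omega A a) r (\<rho> * r) (M * r) \<kappa>"
proof -
  obtain b where b: "b \<ge> 0" "\<And>t. t \<in> tbox 1 \<Longrightarrow> norm (drift t) \<le> b" using linear_tbox_bound[OF linear_drift] by blast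
  define \<kappa> where "\<kappa> = 2 * nat \<lceil>2 * b + 1\<rceil>"
  have "\<forall>\<^sub>F r in at_top. shape 1 (cube_Omega A a) r (a / 2 * r) ((a + b) * r) \<kappa>"
    \<comment> \<open>From here on \<open>a / 2 * r \<le> r * a - b\<close>, so the core keeps a
      fixed proportion of the cube.\<close>
    using eventually_ge_at_top[of "max 1 (2 * b / a)"]
  proof eventually_elim
    case (elim r)
    have r: "r \<ge> 1" "2 * b \<le> a * r" using elim a by (auto simp: field_simps)
    define N0 where "N0 = ({n \<in> intvec. \<forall>i. \<bar>n $ i\<bar> \<le> r * a - b} :: (real^'d) set)"
    define N1 where "N1 = {n \<in> intvec. \<forall>i. \<bar>n $ i\<bar> \<le> r * a + b} - N0"
    define Ks where "Ks = {x \<in> \<int>. r * a - b < \<bar>x\<bar> \<and> \<bar>x\<bar> \<le> (r * a - b) + 2 * b}"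
    have inP: "u \<in> patch_lattice 1 (cube_Omega A a) r \<longleftrightarrow> u \<in> Zk \<and> (\<forall>i. \<bar>(fst u + drift (ell u)) $ i\<bar> \<le> r * a)" for u
    proof -
      define y where "y = fst u + drift (ell u)"
      have "\<pi>1 u \<in> (\<lambda>z. r *\<^sub>R z) ` cube_Omega A a \<longleftrightarrow> (\<forall>i. \<bar>y $ i\<bar> \<le> r * a)"
      proof
        assume "\<pi>1 u \<in> (\<lambda>z. r *\<^sub>R z) ` cube_Omega A a"
        then obtain x where x: "\<forall>i. \<bar>x $ i\<bar> \<le> a" "(y, A *v y) = r *\<^sub>R (x, A *v x)"
          by (auto simp: cube_Omega_def \<pi>1_eq y_def)
        then have "y = r *\<^sub>R x" by simp
        then show "\<forall>i. \<bar>y $ i\<bar> \<le> r * a" using x(1) r(1) by (simp add: abs_mult)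
      next
        assume *: "\<forall>i. \<bar>y $ i\<bar> \<le> r * a"
        define x where "x = (1/r) *\<^sub>R y"
        have "\<forall>i. \<bar>x $ i\<bar> \<le> a" using * r(1) by (simp add: x_def abs_mult field_simps)
        moreover have "\<pi>1 u = r *\<^sub>R (x, A *v x)" using r(1) by (simp add: \<pi>1_eq y_def[symmetric] x_def matrix_vector_mult_scaleR)
        ultimately show "\<pi>1 u \<in> (\<lambda>z. r *\<^sub>R z) ` cube_Omega A a"
          by (intro image_eqI[of _ _ "(x, A *v x)"]) (auto simp: cube_Omega_def)
      qed
      then show ?thesis by (simp add: patch_lattice_def y_def)
    qed
    have dr: "\<bar>drift (ell u) $ i\<bar> \<le> b" if "ell u \<in> tbox 1" for u i
      using component_le_norm_cart[of "drift (ell u)" i] b(2)[OF that] by linarith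
    have N01: "N0 \<union> N1 = {n \<in> intvec. \<forall>i. \<bar>n $ i\<bar> \<le> r * a + b}" 
    proof -
      have "N0 \<subseteq> {n \<in> intvec. \<forall>i. \<bar>n $ i\<bar> \<le> r * a + b}"
      proof (intro subsetI CollectI conjI allI)
        fix n i assume "n \<in> N0"
        then have "\<bar>n $ i\<bar> \<le> r * a - b" by (simp add: N0_def)
        then show "\<bar>n $ i\<bar> \<le> r * a + b" using b(1) by linarith
      qed (simp add: N0_def)
      then show ?thesis unfolding N1_def by blast
    qed
    have le: "r * a + b \<le> (a + b) * r"
    proof -
      have "b \<le> b * r" using mult_left_mono[OF r(1) b(1)] by simp
      then show ?thesis by (simp add: algebra_simps)
    qed
    have N01M: "N0 \<union> N1 \<subseteq> ibox ((a + b) * r)" unfolding N01 ibox_def using le by (auto intro: order_trans)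
    show ?case unfolding shape_def
    proof (rule exI[of _ N0], rule exI[of _ N1], rule exI[of _ Ks], intro conjI ballI impI)
      show "finite N0" "finite N1" using finite_subset[OF N01M finite_ibox] by auto
      show "0 \<in> N0" using r b by (simp add: N0_def intvec_0 mult.commute)
      show "u \<in> patch_lattice 1 (cube_Omega A a) r" if u: "u \<in> Zk" "fst u \<in> N0" "ell u \<in> tbox 1" for u
      proof -
        have "\<bar>(fst u + drift (ell u)) $ i\<bar> \<le> r * a" for i
        proof -
          have "\<bar>fst u $ i\<bar> \<le> r * a - b" using u(2) by (simp add: N0_def)
          then show ?thesis using dr[OF u(3), of i] by simp
        qed
        then show ?thesis using u(1) unfolding inP by blast
      qed
      show "fst u \<in> N0 \<union> N1" if u: "u \<in> patch_lattice 1 (cube_Omega A a) r" "ell u \<in> tbox 1" for u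
      proof -
        have "\<bar>fst u $ i\<bar> \<le> r * a + b" for i
        proof -
          have "\<bar>(fst u + drift (ell u)) $ i\<bar> \<le> r * a" using u(1) unfolding inP by blast
          then show ?thesis using dr[OF u(2), of i] by simp
        qed
        moreover have "fst u \<in> intvec" using u(1) unfolding inP Zk_iff by blast
        ultimately show ?thesis unfolding N01 by simp
      qed
      show "q \<in> N0" if q: "q \<in> intvec" "\<forall>i. \<bar>q $ i\<bar> \<le> a / 2 * r" for q
      proof -
        have le': "a / 2 * r \<le> r * a - b" using r(2) by (simp add: algebra_simps)
        have "\<bar>q $ i\<bar> \<le> r * a - b" for i using order_trans[OF q(2)[rule_format] le'] .
        then show ?thesis using q(1) by (simp add: N0_def)
      qed
      show "finite Ks" "card Ks \<le> \<kappa>" unfolding Ks_def \<kappa>_def using b(1) by (intro card_Ints_shell; simp)+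
      show "\<exists>i. n $ i \<in> Ks" if "n \<in> N1" for n
      proof -
        have n: "n \<in> intvec" "\<forall>i. \<bar>n $ i\<bar> \<le> r * a + b" "n \<notin> N0" using that by (auto simp: N1_def)
        then obtain i where "\<not> \<bar>n $ i\<bar> \<le> r * a - b" by (auto simp: N0_def)
        moreover have "\<bar>n $ i\<bar> \<le> r * a + b" "n $ i \<in> \<int>" using n by (auto simp: intvec_def)
        ultimately have "n $ i \<in> Ks" by (simp add: Ks_def)
        then show ?thesis by blast
      qed
    qed (use N01M in \<open>auto simp: N0_def N1_def\<close>)
  qed
  moreover have "a / 2 > 0" "a + b > 0" using a b by auto
  ultimately show ?thesis by blast
qed

end

theorem theorem1p2:
  shows "\<exists>\<L> :: (real^'d^'e) set. \<L> \<in> sets lborel \<and> UNIV - \<L> \<in> null_sets lborel \<and>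
    (\<forall>A \<in> \<L>. totally_irrational A \<and>
      (\<forall>W. parallelotope_window W \<longrightarrow>
        (\<forall>F0 \<Omega> s \<epsilon>. admissible_F0 A F0 \<and> admissible_Omega A \<Omega> \<and> regular A W s \<and> \<epsilon> > 0 \<longrightarrow>
           (\<forall>\<^sub>F r in at_top. finite (xi 2 A F0 W s \<Omega> r) \<and>
              real (card (xi 2 A F0 W s \<Omega> r))
                \<le> ln r powr ((1 + \<epsilon>) * real ((CARD('d) + 1) * CARD('e))))) \<and>
        (\<forall>F0 s \<epsilon> a. admissible_F0 A F0 \<and> regular A W s \<and> \<epsilon> > 0 \<and> a > 0 \<longrightarrow>
           (\<forall>\<^sub>F r in at_top. finite (xi 1 A F0 W s (cube_Omega A a) r) \<and>
              real (card (xi 1 A F0 W s (cube_Omega A a) r))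
                \<le> ln r powr ((1 + \<epsilon>) * real ((CARD('d) + 1) * CARD('e)))))))"
proof -
  \<comment> \<open>The null set is fixed before the window, \<epsilon> and all other data;
    genericity already ranges over all \<open>c\<close> and all exponents.\<close>
  obtain N :: "(real^'d^'e) set" where N: "{A \<in> space lborel. \<not> (\<forall>c\<in>intvec - {0}. generic_form (\<lambda>q. (A *v q) \<bullet> c))} \<subseteq> N"
    "emeasure lborel N = 0" "N \<in> sets lborel"
    using AE_generic_form by (rule AE_E)
  have gen: "generic_form (\<lambda>q. (A *v q) \<bullet> c)" if "A \<in> - N" "c \<in> intvec - {0}" for A c
    using N(1) that by auto
  have irr: "(A *v q) \<bullet> c \<notin> \<int>" if "A \<in> - N" "c \<in> intvec - {0}" "q \<in> intvec" "q \<noteq> 0" for A c q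
    using gen[OF that(1,2)] that(3,4) by (auto simp: generic_form_def)
  have window: "\<exists>v. cut_project A F0 v s \<and> cut_project.W v = W"
    if AN: "A \<in> - N" and W: "parallelotope_window W" and F0: "admissible_F0 A F0" and reg: "regular A W s" for A W F0 s
  proof -
    obtain w :: "'e \<Rightarrow> ('d, 'e) pt" where w: "\<And>j. w j \<in> Fsp \<inter> Zk" "inj w" "independent (range w)"
      "W = {(\<Sum>j\<in>UNIV. t j *\<^sub>R w j) | t. \<forall>j. 0 \<le> t j \<and> t j \<le> 1}"
      using W unfolding parallelotope_window_def by blast
    define v where "v j = snd (w j)" for j
    have wv: "w j = (0, v j)" for j using w(1)[of j] by (simp add: Fsp_def v_def prod_eq_iff)
    have "(\<Sum>j\<in>UNIV. t j *\<^sub>R w j) = (0, \<Sum>j\<in>UNIV. t j *\<^sub>R v j)" for t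
      by (simp add: wv prod_eq_iff fst_sum snd_sum)
    then have Weq: "W = {(0, \<Sum>j\<in>UNIV. t j *\<^sub>R v j) | t. \<forall>j. 0 \<le> t j \<and> t j \<le> (1::real)}" unfolding w(4) by (simp only:)
    have inj: "inj v" using w(2) by (auto simp: inj_on_def wv)
    have "span (range w) \<subseteq> Fsp" using w(1) subspace_Fsp by (intro span_minimal) auto
    \<comment> \<open>\<open>snd\<close> is injective on \<open>Fsp\<close>, so the last components
      of the generators remain independent.\<close>
    have "inj_on snd (span (range w))"
    proof (rule inj_onI)
      fix x y assume "x \<in> span (range w)" "y \<in> span (range w)" "snd x = snd y"
      moreover from this(1,2) \<open>span (range w) \<subseteq> Fsp\<close> have "fst x = 0" "fst y = 0" unfolding Fsp_def by blast+
      ultimately show "x = y" by (simp add: prod_eq_iff)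
    qed
    then have "independent (snd ` range w)" by (intro linear_independent_injective_image linear_snd w(3))
    moreover have "snd ` range w = range v" by (auto simp: v_def)
    ultimately have ind: "independent (range v)" by simp
    have "cut_project A F0 v s"
    proof
      show "admissible_F0 A F0" by (rule F0)
      show "v j \<in> intvec" for j using w(1)[of j] by (simp add: v_def Zk_iff)
      show "\<exists>n\<in>intvec. \<exists>m\<in>intvec. norm (m - A *v n - y) < \<delta>" if "\<delta> > 0" for \<delta> y
        by (rule generic_dense[OF irr[OF AN] that])
      show "regular A {(0, \<Sum>j\<in>UNIV. t j *\<^sub>R v j) | t. \<forall>j. 0 \<le> t j \<and> t j \<le> (1::real)} s"
        using reg by (simp only: Weq)
    qed (rule inj ind)+
    then show ?thesis using cut_project.W_def[of A F0 v s] Weq by blast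
  qed
  have type2: "\<forall>\<^sub>F r in at_top. finite (xi 2 A F0 W s \<Omega> r) \<and>
      real (card (xi 2 A F0 W s \<Omega> r)) \<le> ln r powr ((1 + \<epsilon>) * real ((CARD('d) + 1) * CARD('e)))"
    if A: "A \<in> - N" and W: "parallelotope_window W" and F0: "admissible_F0 A F0" and \<Omega>: "admissible_Omega A \<Omega>"
      and reg: "regular A W s" and \<epsilon>: "\<epsilon> > 0" for A W F0 \<Omega> s \<epsilon>
  proof -
    obtain v where v: "cut_project A F0 v s" "cut_project.W v = W" using window[OF A W F0 reg] by blast
    interpret cut_project A F0 v s by (rule v(1))
    obtain \<rho> M where "\<rho> > 0" "M > 0" "\<forall>\<^sub>F r in at_top. shape 2 \<Omega> r (\<rho> * r) (M * r) 0"
      using shape_type2[OF \<Omega>] by blast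
    then show ?thesis using eventually_xi_bound[OF gen[OF A], of 2 \<Omega> \<rho> M 0 \<epsilon>] \<epsilon> unfolding v(2) by blast
  qed
  have type1: "\<forall>\<^sub>F r in at_top. finite (xi 1 A F0 W s (cube_Omega A a) r) \<and>
      real (card (xi 1 A F0 W s (cube_Omega A a) r)) \<le> ln r powr ((1 + \<epsilon>) * real ((CARD('d) + 1) * CARD('e)))"
    if A: "A \<in> - N" and W: "parallelotope_window W" and F0: "admissible_F0 A F0"
      and reg: "regular A W s" and \<epsilon>: "\<epsilon> > 0" and a: "a > 0" for A W F0 s \<epsilon> a
  proof -
    obtain v where v: "cut_project A F0 v s" "cut_project.W v = W" using window[OF A W F0 reg] by blast
    interpret cut_project A F0 v s by (rule v(1))
    obtain \<rho> M \<kappa> where "\<rho> > 0" "M > 0" "\<forall>\<^sub>F r in at_top. shape 1 (cube_Omega A a) r (\<rho> * r) (M * r) \<kappa>"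
      using shape_type1[OF a] by blast
    then show ?thesis using eventually_xi_bound[OF gen[OF A], of 1 "cube_Omega A a" \<rho> M \<kappa> \<epsilon>] \<epsilon> unfolding v(2) by blast
  qed
  show ?thesis
  proof (rule exI[of _ "- N"], intro conjI ballI)
    show "- N \<in> sets lborel" using sets.compl_sets[OF N(3)] by (simp add: Compl_eq_Diff_UNIV)
    show "UNIV - - N \<in> null_sets lborel" using N by (simp add: null_sets_def)
    fix A assume A: "A \<in> - N"
    show "totally_irrational A" by (rule totally_irrational_generic[OF irr[OF A]])
  qed (use type1 type2 in blast)+
qed

end
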